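(* Let $d\ge 3$, let $K\subset\mathbb{R}^d$ be a convex body and let $\delta\in(0,\mathrm{vol}_d(K))$. For $\xi\in S^{d-1}$ let $H(\xi)$ be the cutting hyperplane of $K$ in the direction $\xi$ at the level $\delta$. (i) If $K$ floats in equilibrium at the level $\delta$ in every orientation, then there is a constant $c$ such that $I_{K\cap H(\xi)}(\Pi)=c$ for every $\xi\in S^{d-1}$ and every $(d-2)$-dimensional plane $\Pi\subset H(\xi)$ passing through the center of mass $\mathcal{C}(K\cap H(\xi))$ of the cutting section. (ii) Conversely, assume that $K$ has a $C^1$-smooth boundary and that the center of mass of $K$ coincides with the center of mass of the surface of centers $\mathcal{S}_\delta$. If there is a constant $c$ such that $I_{K\cap H(\xi)}(\Pi)=c$ for every $\xi\in S^{d-1}$ and every $(d-2)$-dimensional plane $\Pi\subset H(\xi)$ passing through $\mathcal{C}(K\cap H(\xi))$, then $K$ floats in equilibrium at the level $\delta$ in every orientation.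
   Context: A convex body $K\subset\mathbb{R}^d$ is a compact convex set with non-empty interior. The set $S^{d-1}$ is the unit sphere centered at the origin. $K$ has a $C^1$-smooth boundary if near each of its points $\partial K$ can be written as the graph of a $C^1$ function. For a compact convex set $L$ with non-empty relative interior in a $j$-dimensional plane, $\mathcal{C}(L)=\frac{1}{\mathrm{vol}_j(L)}\int_L x\,dx$ denotes its center of mass. For $\xi\in S^{d-1}$, the cutting hyperplane of $K$ in the direction $\xi$ at the level $\delta$ is the hyperplane $H(\xi)=\{p\in\mathbb{R}^d: p\cdot\xi=t(\xi)\}$, where $t(\xi)\in\mathbb{R}$ is chosen so that $\mathrm{vol}_d(K\cap H^-(\xi))=\delta$, with $H^-(\xi)=\{p\in\mathbb{R}^d: p\cdot\xi\le t(\xi)\}$. The set $K\cap H(\xi)$ is called a cutting section. Let $\mathcal{C}_\delta(\xi)=\mathcal{C}(K\cap H^-(\xi))$ be the center of mass of the submerged part. $K$ floats in equilibrium in the direction $\xi$ at the level $\delta$ if the line through $\mathcal{C}(K)$ and $\mathcal{C}_\delta(\xi)$ is parallel to $\xi$ (i.e. orthogonal to $H(\xi)$). $K$ floats in equilibrium in every orientation at the level $\delta$ if this holds for every $\xi\in S^{d-1}$. The surface of centers is the set $\mathcal{S}_\delta=\{\mathcal{C}_\delta(\xi):\xi\in S^{d-1}\}$; it is the boundary of a strictly convex body. Its center of mass is its centroid with respect to the $(d-1)$-dimensional surface measure. The moment of inertia of $K\cap H(\xi)$ with respect to a $(d-2)$-dimensional plane $\Pi\subset H(\xi)$ is $I_{K\cap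 H(\xi)}(\Pi)=\int_{K\cap H(\xi)}\mathrm{dist}(\Pi,v)^2\,dv$, where $\mathrm{dist}(\Pi,v)=\min_{x\in\Pi}|v-x|$ and $dv$ is the $(d-1)$-dimensional Lebesgue measure on $H(\xi)$. *)

theory Defs
  imports "HOL-Analysis.Analysis"
begin

definition convex_body :: "'a::euclidean_space set \<Rightarrow> bool" where
  "convex_body K \<longleftrightarrow> compact K \<and> convex K \<and> interior K \<noteq> {}"

(* A function on a hyperplane {x. x \<bullet> n = 0} is C^1 near a point iff it is the restriction of a C^1
   function g on an open set W of the ambient space, so g is taken on such a W and its graph
   only over W \<inter> {x. x \<bullet> n = 0}. The function G is the gradient of g. *)
definition C1_boundary :: "'a::euclidean_space set \<Rightarrow> bool" where
  "C1_boundary K \<longleftrightarrow>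
    (\<forall>p\<in>frontier K. \<exists>n U W g G. norm n = 1 \<and> open U \<and> p \<in> U \<and> open W \<and>
       (\<forall>x\<in>W. GDERIV g x :> G x) \<and> continuous_on W G \<and>
       frontier K \<inter> U = {x + g x *\<^sub>R n | x. x \<in> W \<and> x \<bullet> n = 0} \<inter> U)"

subsection \<open>Lebesgue measure on planes and surface measure\<close>

definition orthonormal_basis_of :: "'a::euclidean_space set \<Rightarrow> 'a set \<Rightarrow> bool" where
  "orthonormal_basis_of V B \<longleftrightarrow> pairwise orthogonal B \<and> (\<forall>b\<in>B. norm b = 1) \<and> span B = V"

(* Lebesgue measure on a non-empty affine set A of dimension j, as a Borel measure on the ambient
   space concentrated on A: the image of the product of j copies of the one-dimensional Lebesgue
   measure under orthonormal coordinates of A (compare lborel_def, where the coordinates are those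
   of Basis). It does not depend on the origin p and the orthonormal basis B that are selected. *)
definition plane_lborel :: "'a::euclidean_space set \<Rightarrow> 'a measure" where
  "plane_lborel A =
    (let p = (SOME p. p \<in> A);
         B = (SOME B. orthonormal_basis_of {x - p | x. x \<in> A} B)
     in distr (Pi\<^sub>M B (\<lambda>_. lborel)) borel (\<lambda>f. p + (\<Sum>b\<in>B. f b *\<^sub>R b)))"

(* The bound on the diameters comes with boundedness because the library's diameter is
   unspecified on unbounded sets. *)
definition hausdorff_premeasure :: "nat \<Rightarrow> real \<Rightarrow> 'a::metric_space set \<Rightarrow> ennreal" where
  "hausdorff_premeasure n \<epsilon> A =
    (INF U \<in> {U :: nat \<Rightarrow> 'a set. A \<subseteq> (\<Union>i. U i) \<and> (\<forall>i. bounded (U i) \<and> diameter (U i) \<le> \<epsilon>)}.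
       \<Sum>i. if U i = {} then 0
           else ennreal (unit_ball_vol (real n) * (diameter (U i) / 2) ^ n))"

definition hausdorff_outer :: "nat \<Rightarrow> 'a::metric_space set \<Rightarrow> ennreal" where
  "hausdorff_outer n A = (SUP \<epsilon>\<in>{0<..}. hausdorff_premeasure n \<epsilon> A)"

(* The n-dimensional surface measure of a Borel set; it is normalized so as to agree with
   n-dimensional Lebesgue measure on n-dimensional planes. *)
definition hausdorff_measure :: "nat \<Rightarrow> 'a::metric_space measure" where
  "hausdorff_measure n = measure_of UNIV (sets borel) (hausdorff_outer n)"

definition center_of_mass :: "'a::euclidean_space measure \<Rightarrow> 'a set \<Rightarrow> 'a" where
  "center_of_mass M L = (1 / measure M L) *\<^sub>R (LINT x:L|M. x)"

subsection \<open>Floating bodies\<close>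

definition cut_level :: "'a::euclidean_space set \<Rightarrow> real \<Rightarrow> 'a \<Rightarrow> real" where
  "cut_level K \<delta> \<xi> = (THE t. measure lborel (K \<inter> {p. p \<bullet> \<xi> \<le> t}) = \<delta>)"

definition cut_plane :: "'a::euclidean_space set \<Rightarrow> real \<Rightarrow> 'a \<Rightarrow> 'a set" where
  "cut_plane K \<delta> \<xi> = {p. p \<bullet> \<xi> = cut_level K \<delta> \<xi>}"

definition cut_halfspace :: "'a::euclidean_space set \<Rightarrow> real \<Rightarrow> 'a \<Rightarrow> 'a set" where
  "cut_halfspace K \<delta> \<xi> = {p. p \<bullet> \<xi> \<le> cut_level K \<delta> \<xi>}"

definition section_center :: "'a::euclidean_space set \<Rightarrow> real \<Rightarrow> 'a \<Rightarrow> 'a" where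
  "section_center K \<delta> \<xi> =
    center_of_mass (plane_lborel (cut_plane K \<delta> \<xi>)) (K \<inter> cut_plane K \<delta> \<xi>)"

definition submerged_center :: "'a::euclidean_space set \<Rightarrow> real \<Rightarrow> 'a \<Rightarrow> 'a" where
  "submerged_center K \<delta> \<xi> = center_of_mass lborel (K \<inter> cut_halfspace K \<delta> \<xi>)"

definition floats_in_equilibrium :: "'a::euclidean_space set \<Rightarrow> real \<Rightarrow> 'a \<Rightarrow> bool" where
  "floats_in_equilibrium K \<delta> \<xi> \<longleftrightarrow>
    affine_parallel (affine hull {center_of_mass lborel K, submerged_center K \<delta> \<xi>}) (span {\<xi>})"

definition floats_in_every_orientation :: "'a::euclidean_space set \<Rightarrow> real \<Rightarrow> bool" where
  "floats_in_every_orientation K \<delta> \<longleftrightarrow> (\<forall>\<xi>\<in>sphere 0 1. floats_in_equilibrium K \<delta> \<xi>)"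

definition surface_of_centers :: "'a::euclidean_space set \<Rightarrow> real \<Rightarrow> 'a set" where
  "surface_of_centers K \<delta> = submerged_center K \<delta> ` sphere 0 1"

(* The moment of inertia of L, a subset of the plane H, with respect to P. *)
definition moment_of_inertia :: "'a::euclidean_space set \<Rightarrow> 'a set \<Rightarrow> 'a set \<Rightarrow> real" where
  "moment_of_inertia H L P = (LINT v:L|plane_lborel H. (infdist v P)\<^sup>2)"

definition constant_section_moments :: "'a::euclidean_space set \<Rightarrow> real \<Rightarrow> bool" where
  "constant_section_moments K \<delta> \<longleftrightarrow>
    (\<exists>c. \<forall>\<xi>\<in>sphere 0 1. \<forall>P. affine P \<and> aff_dim P = int DIM('a) - 2 \<and>
       P \<subseteq> cut_plane K \<delta> \<xi> \<and> section_center K \<delta> \<xi> \<in> P \<longrightarrow>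
       moment_of_inertia (cut_plane K \<delta> \<xi>) (K \<inter> cut_plane K \<delta> \<xi>) P = c)"

end

theory Submission
  imports Defs
begin

text \<open>Tilt the cutting plane at \<open>\<xi>\<close> in the direction of a unit vector \<open>\<eta>\<close> orthogonal to \<open>\<xi>\<close>.
  Because the submerged volume is kept, the plane turns to first order about the centroid \<open>c\<close> of the
  section, and the derivative of the submerged center at \<open>\<xi>\<close> in the direction \<open>\<eta>\<close> is
  \<open>- M \<eta> / \<delta>\<close>, where \<open>M\<close> is the matrix of second moments of the section about \<open>c\<close>. Its
  diagonal values \<open>\<eta> \<bullet> M \<eta>\<close> are the moments of inertia. The
  difference quotients converge by dominated convergence, because the relative boundary of a section
  through the interior of \<open>K\<close> is a null set.

  If \<open>K\<close> floats in every orientation, the submerged center is \<open>C + k(\<xi>) \<xi>\<close>, where \<open>C\<close> is the center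
  of mass of \<open>K\<close>. As \<open>M \<eta>\<close> is orthogonal to \<open>\<xi>\<close>, the function \<open>k\<close> has derivative 0 along great circles,
  so it is constant, and \<open>M = - \<delta> k\<close> on the orthogonal complement of \<open>\<xi>\<close>. Conversely, if all moments
  are \<open>m\<close>, then \<open>M\<close> is \<open>m\<close> times the identity there by polarization, the submerged center plus \<open>(m / \<delta>) \<xi>\<close> is a
  constant \<open>p\<close>, and the surface of centers is a sphere around \<open>p\<close>. The centroid of a sphere is its
  center by symmetry, as soon as its surface measure is known to be positive and finite.\<close>

subsection \<open>Hausdorff measures\<close>

text \<open>Three objects come from a choice or a default and must be tied down before anything can
  be computed. \<open>measure_of\<close> gives the zero measure unless its set function is countably
  additive, so \<open>hausdorff_measure\<close> has no usable values until the outer measure is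
  known to be a measure on the Borel sets. \<open>plane_lborel\<close> rests on an arbitrary origin
  and an arbitrary orthonormal basis, so integrals over sections are traced back to
  \<open>lborel\<close> by Fubini along the normal. \<open>cut_level\<close> is a definite
  description and needs a unique level of volume \<delta>. The level is not assumed to depend
  smoothly on the direction. The tilted half-space is written over the old plane as height at most
  \<open>a - e * (x \<bullet> \<eta>)\<close>, with slope \<open>e = tan \<theta>\<close> and an
  unknown offset \<open>a\<close>. Equality of volumes bounds \<open>a\<close> by a multiple of
  \<open>e\<close>, and then determines the limit of \<open>a / e\<close>. Equilibrium demands a
  genuine line through the two centers, so they must be distinct. In the converse direction this
  comes from the strict positivity of the second moments, which also keeps the sphere of centers
  from shrinking to a point.\<close>

lemma hausdorff_premeasure_leI:
  fixes U :: "nat \<Rightarrow> 'a::metric_space set"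
  assumes "A \<subseteq> (\<Union>i. U i)" "\<And>i. bounded (U i)" "\<And>i. diameter (U i) \<le> \<epsilon>"
  shows "hausdorff_premeasure n \<epsilon> A \<le>
    (\<Sum>i. if U i = {} then 0 else ennreal (unit_ball_vol (real n) * (diameter (U i) / 2) ^ n))"
  unfolding hausdorff_premeasure_def by (rule INF_lower) (use assms in auto)

lemma hausdorff_premeasure_geI:
  fixes A :: "'a::metric_space set"
  assumes "\<And>U :: nat \<Rightarrow> 'a set. A \<subseteq> (\<Union>i. U i) \<Longrightarrow> (\<And>i. bounded (U i)) \<Longrightarrow> (\<And>i. diameter (U i) \<le> \<epsilon>) \<Longrightarrow>
    c \<le> (\<Sum>i. if U i = {} then 0 else ennreal (unit_ball_vol (real n) * (diameter (U i) / 2) ^ n))"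
  shows "c \<le> hausdorff_premeasure n \<epsilon> A"
  unfolding hausdorff_premeasure_def by (rule INF_greatest) (use assms in auto)

lemma hausdorff_premeasure_mono:
  fixes A :: "'a::metric_space set"
  assumes "A \<subseteq> B" "\<epsilon>' \<le> \<epsilon>"
  shows "hausdorff_premeasure n \<epsilon> A \<le> hausdorff_premeasure n \<epsilon>' B"
proof (rule hausdorff_premeasure_geI)
  fix U :: "nat \<Rightarrow> 'a set"
  assume "B \<subseteq> (\<Union>i. U i)" and b: "\<And>i. bounded (U i)" and d: "\<And>i. diameter (U i) \<le> \<epsilon>'"
  then have "A \<subseteq> (\<Union>i. U i)" using assms by auto
  then show "hausdorff_premeasure n \<epsilon> A \<le>
    (\<Sum>i. if U i = {} then 0 else ennreal (unit_ball_vol (real n) * (diameter (U i) / 2) ^ n))"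
    using b d assms(2) by (intro hausdorff_premeasure_leI) (auto intro: order_trans)
qed

lemma hausdorff_premeasure_le_outer:
  "0 < \<epsilon> \<Longrightarrow> hausdorff_premeasure n \<epsilon> A \<le> hausdorff_outer n A"
  unfolding hausdorff_outer_def by (intro SUP_upper) auto

lemma hausdorff_outer_leI:
  "(\<And>\<epsilon>. 0 < \<epsilon> \<Longrightarrow> hausdorff_premeasure n \<epsilon> A \<le> c) \<Longrightarrow> hausdorff_outer n A \<le> c"
  unfolding hausdorff_outer_def by (intro SUP_least) auto

lemma hausdorff_outer_mono: "A \<subseteq> B \<Longrightarrow> hausdorff_outer n A \<le> hausdorff_outer n B"
  by (intro hausdorff_outer_leI order_trans[OF hausdorff_premeasure_mono hausdorff_premeasure_le_outer]) auto

lemma hausdorff_outer_empty: "hausdorff_outer n ({} :: 'a::metric_space set) = 0"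
proof -
  have "hausdorff_outer n ({} :: 'a set) \<le> 0"
  proof (rule hausdorff_outer_leI)
    fix \<epsilon> :: real assume "0 < \<epsilon>"
    then show "hausdorff_premeasure n \<epsilon> ({} :: 'a set) \<le> 0"
      using hausdorff_premeasure_leI[of "{} :: 'a set" "\<lambda>_. {}" \<epsilon> n] by simp
  qed
  then show ?thesis by simp
qed

text \<open>Covers that are optimal up to an excess of \<open>e * (1/2)^Suc i\<close> are merged
  into one cover of the union, at the same scale; the excesses add up to \<open>e\<close>.\<close>

lemma hausdorff_premeasure_countably_subadditive:
  fixes A :: "nat \<Rightarrow> 'a::metric_space set"
  shows "hausdorff_premeasure n \<epsilon> (\<Union>i. A i) \<le> (\<Sum>i. hausdorff_premeasure n \<epsilon> (A i))"
proof (rule ennreal_le_epsilon)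
  fix e :: real assume "0 < e" and fin: "(\<Sum>i. hausdorff_premeasure n \<epsilon> (A i)) < top"
  define w where "w V = (if V = {} then 0 else ennreal (unit_ball_vol (real n) * (diameter V / 2) ^ n))"
    for V :: "'a set"
  \<comment> \<open>Finiteness is essential here: only a finite infimum is strictly exceeded after
    adding a positive number.\<close>
  have "hausdorff_premeasure n \<epsilon> (A i) < hausdorff_premeasure n \<epsilon> (A i) + e * (1/2)^Suc i" for i
    using fin \<open>0 < e\<close> by (auto simp: less_top dest!: ennreal_suminf_lessD)
  then have "\<exists>U. A i \<subseteq> (\<Union>j. U j) \<and> (\<forall>j. bounded (U j) \<and> diameter (U j) \<le> \<epsilon>) \<and>
      (\<Sum>j. w (U j)) < hausdorff_premeasure n \<epsilon> (A i) + e * (1/2)^Suc i" for i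
  proof -
    obtain U where "U \<in> {U :: nat \<Rightarrow> 'a set. A i \<subseteq> (\<Union>j. U j) \<and> (\<forall>j. bounded (U j) \<and> diameter (U j) \<le> \<epsilon>)}"
      "(\<Sum>j. w (U j)) < hausdorff_premeasure n \<epsilon> (A i) + e * (1/2)^Suc i"
      using \<open>hausdorff_premeasure n \<epsilon> (A i) < hausdorff_premeasure n \<epsilon> (A i) + e * (1/2)^Suc i\<close>
      unfolding w_def hausdorff_premeasure_def[of n \<epsilon> "A i"] by (subst (asm) INF_less_iff) blast
    then show ?thesis by (intro exI[of _ U]) simp
  qed
  then obtain U where "\<And>i. A i \<subseteq> (\<Union>j. U i j) \<and> (\<forall>j. bounded (U i j) \<and> diameter (U i j) \<le> \<epsilon>) \<and>
      (\<Sum>j. w (U i j)) < hausdorff_premeasure n \<epsilon> (A i) + e * (1/2)^Suc i"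
    using choice[of "\<lambda>i U. A i \<subseteq> (\<Union>j. U j) \<and> (\<forall>j. bounded (U j) \<and> diameter (U j) \<le> \<epsilon>) \<and>
      (\<Sum>j. w (U j)) < hausdorff_premeasure n \<epsilon> (A i) + e * (1/2)^Suc i"] by auto
  then have U: "\<And>i. A i \<subseteq> (\<Union>j. U i j)" "\<And>i j. bounded (U i j)" "\<And>i j. diameter (U i j) \<le> \<epsilon>"
    "\<And>i. (\<Sum>j. w (U i j)) < hausdorff_premeasure n \<epsilon> (A i) + e * (1/2)^Suc i"
    by simp_all
  define C where "C = case_prod U \<circ> prod_decode"
  have "(\<Union>i. A i) \<subseteq> (\<Union>i. C i)"
    using U(1) by (auto simp: C_def subset_eq) (metis prod.case prod_encode_inverse)
  then have "hausdorff_premeasure n \<epsilon> (\<Union>i. A i) \<le> (\<Sum>i. w (C i))"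
    unfolding w_def by (rule hausdorff_premeasure_leI) (auto simp: C_def split_beta U)
  also have "\<dots> = (\<Sum>i. \<Sum>j. w (U i j))"
    using suminf_ennreal_2dimen[of "\<lambda>i. \<Sum>j. w (U i j)" "\<lambda>p. w (case_prod U p)"] by (simp add: C_def)
  also have "\<dots> \<le> (\<Sum>i. hausdorff_premeasure n \<epsilon> (A i) + e * (1/2) ^ Suc i)"
  proof (rule suminf_le)
    show "(\<Sum>j. w (U i j)) \<le> hausdorff_premeasure n \<epsilon> (A i) + e * (1/2) ^ Suc i" for i
      using U(4)[of i] by (rule less_imp_le)
  qed auto
  also have "\<dots> = (\<Sum>i. hausdorff_premeasure n \<epsilon> (A i)) + (\<Sum>i. ennreal e * ennreal ((1/2) ^ Suc i))"
  proof -
    have "ennreal (e * (1/2) ^ Suc i) = ennreal e * ennreal ((1/2) ^ Suc i)" for i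
      using \<open>0 < e\<close> by (intro ennreal_mult) auto
    then show ?thesis
      by (simp only: suminf_add[symmetric] summableI)
  qed
  also have "\<dots> = (\<Sum>i. hausdorff_premeasure n \<epsilon> (A i)) + e"
    unfolding ennreal_suminf_cmult
    by (subst suminf_ennreal_eq[OF zero_le_power power_half_series]) auto
  finally show "hausdorff_premeasure n \<epsilon> (\<Union>i. A i) \<le> (\<Sum>i. hausdorff_premeasure n \<epsilon> (A i)) + e" .
qed

lemma hausdorff_outer_countably_subadditive:
  "hausdorff_outer n (\<Union>i. A i) \<le> (\<Sum>i. hausdorff_outer n (A i))"
proof (rule hausdorff_outer_leI)
  fix \<epsilon> :: real assume "0 < \<epsilon>"
  have "hausdorff_premeasure n \<epsilon> (\<Union>i. A i) \<le> (\<Sum>i. hausdorff_premeasure n \<epsilon> (A i))"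
    by (rule hausdorff_premeasure_countably_subadditive)
  also have "\<dots> \<le> (\<Sum>i. hausdorff_outer n (A i))"
    using \<open>0 < \<epsilon>\<close> by (intro suminf_le hausdorff_premeasure_le_outer) auto
  finally show "hausdorff_premeasure n \<epsilon> (\<Union>i. A i) \<le> (\<Sum>i. hausdorff_outer n (A i))" .
qed

lemma hausdorff_outer_subadditive:
  "hausdorff_outer n (A \<union> B) \<le> hausdorff_outer n A + hausdorff_outer n B"
proof -
  have "hausdorff_outer n (\<Union>i::nat. if i = 0 then A else if i = 1 then B else {}) \<le>
    (\<Sum>i::nat. hausdorff_outer n (if i = 0 then A else if i = 1 then B else {}))"
    by (rule hausdorff_outer_countably_subadditive)
  also have "\<dots> = (\<Sum>i\<in>{0,1::nat}. hausdorff_outer n (if i = 0 then A else if i = 1 then B else {}))"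
    by (rule suminf_finite) (auto simp: hausdorff_outer_empty)
  also have "(\<Union>i::nat. if i = 0 then A else if i = 1 then B else {}) = A \<union> B"
    by (auto split: if_splits)
  finally show ?thesis by simp
qed

text \<open>A set of diameter less than the distance of \<open>A\<close> and \<open>B\<close> meets at most one of them.\<close>

lemma hausdorff_outer_add_separated:
  fixes A :: "'a::metric_space set"
  assumes d: "0 < d" "\<And>x y. x \<in> A \<Longrightarrow> y \<in> B \<Longrightarrow> d \<le> dist x y"
  shows "hausdorff_outer n A + hausdorff_outer n B \<le> hausdorff_outer n (A \<union> B)"
proof -
  have small: "hausdorff_premeasure n \<epsilon> A + hausdorff_premeasure n \<epsilon> B \<le> hausdorff_premeasure n \<epsilon> (A \<union> B)"
    if \<epsilon>: "0 < \<epsilon>" "\<epsilon> < d" for \<epsilon>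
  proof (rule hausdorff_premeasure_geI)
    fix U :: "nat \<Rightarrow> 'a set"
    assume cov: "A \<union> B \<subseteq> (\<Union>i. U i)" and b: "\<And>i. bounded (U i)" and dm: "\<And>i. diameter (U i) \<le> \<epsilon>"
    define w where "w V = (if V = {} then 0 else ennreal (unit_ball_vol (real n) * (diameter V / 2) ^ n))"
      for V :: "'a set"
    define V where "V S i = (if U i \<inter> S = {} then {} else U i)" for S i
    have le: "hausdorff_premeasure n \<epsilon> S \<le> (\<Sum>i. w (V S i))" if "S \<subseteq> A \<union> B" for S
      unfolding w_def
    proof (rule hausdorff_premeasure_leI)
      show "S \<subseteq> (\<Union>i. V S i)" using cov that by (force simp: V_def)
    qed (use b dm \<epsilon> in \<open>auto simp: V_def\<close>)
    have "w (V A i) + w (V B i) \<le> w (U i)" for i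
    proof (cases "U i \<inter> A = {} \<or> U i \<inter> B = {}")
      case True
      then show ?thesis by (auto simp: V_def w_def)
    next
      case False
      then obtain x y where "x \<in> U i" "x \<in> A" "y \<in> U i" "y \<in> B" by blast
      then have "d \<le> dist x y" "dist x y \<le> diameter (U i)"
        using d diameter_bounded_bound[OF b] by auto
      then show ?thesis using dm[of i] \<epsilon> by linarith
    qed
    then have "(\<Sum>i. w (V A i)) + (\<Sum>i. w (V B i)) \<le> (\<Sum>i. w (U i))"
      by (subst suminf_add) (auto intro!: suminf_le)
    then show "hausdorff_premeasure n \<epsilon> A + hausdorff_premeasure n \<epsilon> B \<le>
      (\<Sum>i. if U i = {} then 0 else ennreal (unit_ball_vol (real n) * (diameter (U i) / 2) ^ n))"
      using add_mono[OF le[of A] le[of B]] unfolding w_def by auto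
  qed
  \<comment> \<open>Two independent scales are allowed because the two suprema are pulled out of the
    sum one after the other; passing to a common smaller scale only increases the
    premeasures.\<close>
  have two: "hausdorff_premeasure n \<epsilon> A + hausdorff_premeasure n \<epsilon>' B \<le> hausdorff_outer n (A \<union> B)"
    if "0 < \<epsilon>" "0 < \<epsilon>'" for \<epsilon> \<epsilon>'
  proof -
    let ?m = "min (min \<epsilon> \<epsilon>') (d/2)"
    have "hausdorff_premeasure n \<epsilon> A + hausdorff_premeasure n \<epsilon>' B \<le>
      hausdorff_premeasure n ?m A + hausdorff_premeasure n ?m B"
      by (intro add_mono hausdorff_premeasure_mono) auto
    also have "\<dots> \<le> hausdorff_premeasure n ?m (A \<union> B)"
      using that d by (intro small) auto
    also have "\<dots> \<le> hausdorff_outer n (A \<union> B)"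
      using that d by (intro hausdorff_premeasure_le_outer) auto
    finally show ?thesis .
  qed
  have "hausdorff_premeasure n \<epsilon> A + hausdorff_outer n B \<le> hausdorff_outer n (A \<union> B)" if "0 < \<epsilon>" for \<epsilon>
    unfolding hausdorff_outer_def[of n B] using that two
    by (subst ennreal_SUP_add_right) (auto intro!: SUP_least)
  then show ?thesis
    unfolding hausdorff_outer_def[of n A]
    by (subst ennreal_SUP_add_left[symmetric]) (auto intro!: SUP_least)
qed

text \<open>Caratheodory's criterion: the layers \<open>D k\<close> at distance between \<open>1/(k+2)\<close> and \<open>1/(k+1)\<close>
  from \<open>C\<close> have finite total measure because those of equal parity are separated.\<close>

lemma hausdorff_outer_closed_split:
  assumes "closed C"
  shows "hausdorff_outer n (C \<inter> T) + hausdorff_outer n (T - C) \<le> hausdorff_outer n T"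
proof (cases "C = {} \<or> hausdorff_outer n T = \<infinity>")
  case True
  then show ?thesis by (auto simp: hausdorff_outer_empty)
next
  case False
  then have C: "C \<noteq> {}" and T: "hausdorff_outer n T \<noteq> \<infinity>" by auto
  define A where "A k = {x\<in>T. 1 / real (k + 1) \<le> infdist x C}" for k :: nat
  define D where "D k = {x\<in>T. 1 / real (k + 2) \<le> infdist x C \<and> infdist x C < 1 / real (k + 1)}" for k :: nat
  define g where "g k = hausdorff_outer n (D k)" for k
  have sep: "\<exists>d>0. \<forall>x\<in>P. \<forall>y\<in>Q. d \<le> dist x y"
    if "b < a" "\<And>x. x \<in> P \<Longrightarrow> a \<le> infdist x C" "\<And>y. y \<in> Q \<Longrightarrow> infdist y C \<le> b" for a b P Q
  proof (intro exI[of _ "a - b"] conjI ballI)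
    fix x y assume "x \<in> P" "y \<in> Q"
    then show "a - b \<le> dist x y"
      using that(2)[of x] that(3)[of y] infdist_triangle[of x C y] by linarith
  qed (use that in simp)
  have add: "hausdorff_outer n P + hausdorff_outer n Q \<le> hausdorff_outer n (P \<union> Q)"
    if "b < a" "\<And>x. x \<in> P \<Longrightarrow> a \<le> infdist x C" "\<And>y. y \<in> Q \<Longrightarrow> infdist y C \<le> b" for a b P Q
    using sep[OF that] hausdorff_outer_add_separated by metis
  have parity: "(\<Sum>i<N. g (2 * i + p)) \<le> hausdorff_outer n T" for N p
  proof -
    have "(\<Sum>i<N. g (2 * i + p)) \<le> hausdorff_outer n (\<Union>i<N. D (2 * i + p))"
    proof (induction N)
      case (Suc N)
      have "(\<Sum>i<Suc N. g (2 * i + p)) \<le> hausdorff_outer n (\<Union>i<N. D (2 * i + p)) + hausdorff_outer n (D (2 * N + p))"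
        unfolding g_def sum.lessThan_Suc using Suc.IH[unfolded g_def] by (intro add_mono) auto
      also have "\<dots> \<le> hausdorff_outer n ((\<Union>i<N. D (2 * i + p)) \<union> D (2 * N + p))"
      \<comment> \<open>Skipping one index leaves the gap between \<open>1 / (2 * N + p + 1)\<close>
        and \<open>1 / (2 * N + p)\<close> empty. For \<open>N = 0\<close> and \<open>p = 0\<close>
        the latter would be a division by zero, but then there are no earlier layers.\<close>
      proof (cases "N = 0")
        case False
        show ?thesis
        proof (rule add)
          show "1 / real (2 * N + p + 1) < 1 / real (2 * N + p)"
            using False by (intro divide_strict_left_mono) auto
          show "1 / real (2 * N + p) \<le> infdist x C" if xD: "x \<in> (\<Union>i<N. D (2 * i + p))" for x
          proof -
            obtain i where "i < N" and "x \<in> D (2 * i + p)"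
              using xD by blast
            then have x: "1 / real (2 * i + p + 2) \<le> infdist x C"
              by (simp only: D_def mem_Collect_eq)
            have "1 / real (2 * N + p) \<le> 1 / real (2 * i + p + 2)"
              using \<open>i < N\<close> by (intro divide_left_mono) auto
            then show ?thesis using x by linarith
          qed
          show "infdist y C \<le> 1 / real (2 * N + p + 1)" if "y \<in> D (2 * N + p)" for y
            using that by (simp add: D_def)
        qed
      qed (simp add: hausdorff_outer_empty)
      also have "(\<Union>i<N. D (2 * i + p)) \<union> D (2 * N + p) = (\<Union>i<Suc N. D (2 * i + p))"
        by (auto simp: less_Suc_eq)
      finally show ?case .
    qed simp
    also have "\<dots> \<le> hausdorff_outer n T"
      by (intro hausdorff_outer_mono) (auto simp: D_def)
    finally show ?thesis .
  qed
  have partial: "(\<Sum>i<N. g i) \<le> 2 * hausdorff_outer n T" for N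
  proof -
    have "(\<Sum>i<N. g i) \<le> (\<Sum>i<2 * N. g i)"
      by (intro sum_mono2) auto
    also have "\<dots> = (\<Sum>i<N. g (2 * i + 0)) + (\<Sum>i<N. g (2 * i + 1))"
      by (induction N) (auto simp: algebra_simps)
    also have "\<dots> \<le> hausdorff_outer n T + hausdorff_outer n T"
      by (intro add_mono parity)
    finally show ?thesis by (simp add: mult_2)
  qed
  have "(\<Sum>i. g i) \<le> 2 * hausdorff_outer n T"
    unfolding suminf_eq_SUP using partial by (intro SUP_least)
  then have S: "(\<Sum>i. g i) \<noteq> \<infinity>"
    using T by (auto simp: ennreal_mult_eq_top_iff top_unique)
  \<comment> \<open>What \<open>A k\<close> misses of \<open>T - C\<close> is bounded by the tail of
    the layers from \<open>k\<close> on. The head of the series is added to both sides in place of a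
    subtraction, so that \<open>k\<close> can tend to infinity and the finite total be cancelled at
    the end.\<close>
  have step: "hausdorff_outer n (C \<inter> T) + hausdorff_outer n (T - C) + (\<Sum>j<k. g j) \<le> hausdorff_outer n T + (\<Sum>j. g j)" for k
  proof -
    have pos: "0 < infdist x C" if "x \<notin> C" for x
      using in_closed_iff_infdist_zero[OF \<open>closed C\<close> C, of x] that infdist_nonneg[of x C] by linarith
    have "T - C \<subseteq> A k \<union> (\<Union>j. D (j + k))"
    proof
      fix x assume x: "x \<in> T - C"
      show "x \<in> A k \<union> (\<Union>j. D (j + k))"
      proof (cases "x \<in> A k")
        case False
        then have lt: "infdist x C < 1 / real (k + 1)" using x by (auto simp: A_def)
        obtain m where m: "1 / real (m + 1) \<le> infdist x C"
          using reals_Archimedean[of "infdist x C"] pos[of x] x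
          by (auto simp: inverse_eq_divide intro: less_imp_le)
        \<comment> \<open>By minimality of \<open>l\<close> the point lies in layer
          \<open>l - 1\<close>, and \<open>k < l\<close> makes this one of the layers from
          \<open>k\<close> on.\<close>
        define l where "l = (LEAST m. 1 / real (m + 1) \<le> infdist x C)"
        have l: "1 / real (l + 1) \<le> infdist x C"
          unfolding l_def by (rule LeastI[of _ m]) (use m in simp)
        have "k < l"
        proof (rule ccontr)
          assume "\<not> k < l"
          then have "1 / real (k + 1) \<le> 1 / real (l + 1)" by (intro divide_left_mono) auto
          then show False using l lt by linarith
        qed
        moreover have "\<not> 1 / real (l - 1 + 1) \<le> infdist x C"
          using not_less_Least[of "l - 1" "\<lambda>m. 1 / real (m + 1) \<le> infdist x C"] \<open>k < l\<close>
          unfolding l_def[symmetric] by simp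
        ultimately have "x \<in> D (l - 1 - k + k)"
          using x l by (auto simp: D_def not_le of_nat_diff)
        then show ?thesis by blast
      qed simp
    qed
    then have "hausdorff_outer n (T - C) \<le> hausdorff_outer n (A k \<union> (\<Union>j. D (j + k)))"
      by (rule hausdorff_outer_mono)
    also have "\<dots> \<le> hausdorff_outer n (A k) + (\<Sum>j. g (j + k))"
      unfolding g_def
      by (intro order_trans[OF hausdorff_outer_subadditive] add_left_mono hausdorff_outer_countably_subadditive)
    finally have 1: "hausdorff_outer n (T - C) \<le> hausdorff_outer n (A k) + (\<Sum>j. g (j + k))" .
    have "hausdorff_outer n (A k) + hausdorff_outer n (C \<inter> T) \<le> hausdorff_outer n (A k \<union> (C \<inter> T))"
      by (rule add[of 0 "1 / real (k + 1)"]) (auto simp: A_def)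
    also have "\<dots> \<le> hausdorff_outer n T"
      by (intro hausdorff_outer_mono) (auto simp: A_def)
    finally have 2: "hausdorff_outer n (A k) + hausdorff_outer n (C \<inter> T) \<le> hausdorff_outer n T" .
    have "hausdorff_outer n (C \<inter> T) + hausdorff_outer n (T - C) + (\<Sum>j<k. g j) \<le>
      hausdorff_outer n (C \<inter> T) + (hausdorff_outer n (A k) + (\<Sum>j. g (j + k))) + (\<Sum>j<k. g j)"
      using 1 by (intro add_mono) auto
    also have "\<dots> = (hausdorff_outer n (A k) + hausdorff_outer n (C \<inter> T)) + ((\<Sum>j. g (j + k)) + (\<Sum>j<k. g j))"
      by (simp add: ac_simps)
    also have "(\<Sum>j. g (j + k)) + (\<Sum>j<k. g j) = (\<Sum>j. g j)"
      by (rule suminf_offset[symmetric]) simp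
    also have "(hausdorff_outer n (A k) + hausdorff_outer n (C \<inter> T)) + (\<Sum>j. g j) \<le> hausdorff_outer n T + (\<Sum>j. g j)"
      using 2 by (intro add_mono) auto
    finally show ?thesis .
  qed
  have "hausdorff_outer n (C \<inter> T) + hausdorff_outer n (T - C) + (\<Sum>j. g j) \<le> hausdorff_outer n T + (\<Sum>j. g j)"
    unfolding suminf_eq_SUP[of g]
    by (subst ennreal_SUP_add_right) (use step in \<open>auto intro!: SUP_least simp: suminf_eq_SUP\<close>)
  then show ?thesis using S by (simp add: ennreal_add_left_cancel_le add.commute)
qed

text \<open>Caratheodory's theorem yields a measure on the sets that split every set additively.
  Closed sets do so, and they generate the Borel sets. Only with this does \<open>measure_of\<close>
  in \<open>hausdorff_measure\<close> return the outer measure and not zero.\<close>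

lemma measure_space_hausdorff_outer:
  "measure_space UNIV (sets borel) (hausdorff_outer n :: 'a::metric_space set \<Rightarrow> ennreal)"
proof -
  let ?f = "hausdorff_outer n :: 'a set \<Rightarrow> ennreal"
  let ?L = "lambda_system UNIV (Pow UNIV) ?f"
  interpret P: sigma_algebra "UNIV :: 'a set" "Pow UNIV" by (rule sigma_algebra_Pow)
  have "outer_measure_space (Pow UNIV) ?f"
    unfolding outer_measure_space_def positive_def increasing_def countably_subadditive_def
    using hausdorff_outer_empty hausdorff_outer_mono hausdorff_outer_countably_subadditive by auto
  then have ms: "measure_space UNIV ?L ?f"
    by (rule P.caratheodory_lemma)
  have "C \<in> ?L" if "closed C" for C
  proof -
    have "?f (C \<inter> T) + ?f ((UNIV - C) \<inter> T) = ?f T" for T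
    proof (rule antisym)
      have *: "(UNIV - C) \<inter> T = T - C" "C \<inter> T \<union> (T - C) = T" by auto
      show "?f (C \<inter> T) + ?f ((UNIV - C) \<inter> T) \<le> ?f T"
        unfolding * by (rule hausdorff_outer_closed_split[OF that])
      show "?f T \<le> ?f (C \<inter> T) + ?f ((UNIV - C) \<inter> T)"
        using hausdorff_outer_subadditive[of n "C \<inter> T" "T - C"] unfolding * .
    qed
    then show ?thesis by (simp add: lambda_system_def)
  qed
  then have "sigma_sets UNIV (Collect closed) \<subseteq> ?L"
    using ms sigma_algebra.sigma_sets_subset[of UNIV ?L "Collect closed"]
    unfolding measure_space_def by blast
  then have "sets borel \<subseteq> ?L"
    by (simp add: borel_eq_closed)
  moreover have "sigma_algebra UNIV (sets (borel :: 'a measure))"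
    by (metis sets.sigma_algebra_axioms space_borel)
  ultimately show ?thesis
    using measure_down[OF ms] by blast
qed

lemma sets_hausdorff_measure [simp, measurable_cong]: "sets (hausdorff_measure n) = sets borel"
  using sets.sigma_sets_eq[of borel] by (simp add: hausdorff_measure_def)

lemma space_hausdorff_measure [simp]: "space (hausdorff_measure n) = UNIV"
  by (simp add: hausdorff_measure_def)

lemma emeasure_hausdorff_measure:
  assumes "A \<in> sets borel"
  shows "emeasure (hausdorff_measure n) A = hausdorff_outer n A"
  using measure_space_hausdorff_outer[of n] assms
  unfolding hausdorff_measure_def measure_space_def by (blast intro: emeasure_measure_of_sigma)

section \<open>Invariance of the Hausdorff measure under point reflections\<close>

lemma diameter_isometric_image:
  assumes "\<And>x y. dist (T x) (T y) = dist x y"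
  shows "diameter (T ` U) = diameter U"
proof -
  have "(\<lambda>(x, y). dist x y) ` (T ` U \<times> T ` U) = (\<lambda>(x, y). dist x y) ` (U \<times> U)"
  proof -
    have "T ` U \<times> T ` U = map_prod T T ` (U \<times> U)" by auto
    then show ?thesis by (simp only: image_image) (simp add: split_beta assms)
  qed
  then show ?thesis unfolding diameter_def by simp
qed

lemma bounded_isometric_image:
  assumes "\<And>x y. dist (T x) (T y) = dist x y" "bounded U"
  shows "bounded (T ` U)"
proof -
  obtain a e where "\<forall>y\<in>U. dist a y \<le> e" using assms(2) by (auto simp: bounded_def)
  then show ?thesis unfolding bounded_def using assms(1) by (intro exI[of _ "T a"] exI[of _ e]) auto
qed

text \<open>Isometries carry covers to covers of equal weight. For an involution the one inequality
  so obtained, applied to \<open>A\<close> and to its image, gives both directions.\<close>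

lemma hausdorff_outer_isometric_involution:
  fixes A :: "'a::metric_space set"
  assumes iso: "\<And>x y. dist (T x) (T y) = dist x y" and inv: "\<And>x. T (T x) = x"
  shows "hausdorff_outer n (T ` A) = hausdorff_outer n A"
proof -
  have le: "hausdorff_outer n (T ` B) \<le> hausdorff_outer n B" for B
  proof (rule hausdorff_outer_leI)
    fix \<epsilon> :: real assume "0 < \<epsilon>"
    have "hausdorff_premeasure n \<epsilon> (T ` B) \<le> hausdorff_premeasure n \<epsilon> B"
    proof (rule hausdorff_premeasure_geI)
      fix U :: "nat \<Rightarrow> 'a set"
      assume U: "B \<subseteq> (\<Union>i. U i)" "\<And>i. bounded (U i)" "\<And>i. diameter (U i) \<le> \<epsilon>"
      have "hausdorff_premeasure n \<epsilon> (T ` B) \<le> (\<Sum>i. if T ` U i = {} then 0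
        else ennreal (unit_ball_vol (real n) * (diameter (T ` U i) / 2) ^ n))"
      proof (rule hausdorff_premeasure_leI)
        show "T ` B \<subseteq> (\<Union>i. T ` U i)" using U(1) by blast
      qed (use U in \<open>auto simp: diameter_isometric_image[OF iso] intro!: bounded_isometric_image[OF iso]\<close>)
      then show "hausdorff_premeasure n \<epsilon> (T ` B) \<le>
        (\<Sum>i. if U i = {} then 0 else ennreal (unit_ball_vol (real n) * (diameter (U i) / 2) ^ n))"
        unfolding diameter_isometric_image[OF iso] image_is_empty .
    qed
    also have "\<dots> \<le> hausdorff_outer n B"
      using \<open>0 < \<epsilon>\<close> by (rule hausdorff_premeasure_le_outer)
    finally show "hausdorff_premeasure n \<epsilon> (T ` B) \<le> hausdorff_outer n B" .
  qed
  have "T ` T ` A = A" by (simp add: image_image inv)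
  then show ?thesis using le[of A] le[of "T ` A"] by (intro antisym) auto
qed

lemma distr_hausdorff_measure_reflect:
  fixes p :: "'a::euclidean_space"
  shows "distr (hausdorff_measure n) borel (\<lambda>x. 2 *\<^sub>R p - x) = hausdorff_measure n"
proof (rule measure_eqI)
  let ?T = "\<lambda>x. 2 *\<^sub>R p - x"
  fix A assume "A \<in> sets (distr (hausdorff_measure n) borel ?T)"
  then have [measurable]: "A \<in> sets borel" by simp
  have im: "?T -` A = ?T ` A" by (force simp: image_iff)
  have m: "?T -` A \<in> sets borel"
    using measurable_sets[of ?T borel borel A] by simp
  have "emeasure (distr (hausdorff_measure n) borel ?T) A = emeasure (hausdorff_measure n) (?T -` A)"
    by (subst emeasure_distr) auto
  also have "\<dots> = hausdorff_outer n (?T ` A)"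
    using emeasure_hausdorff_measure[OF m] im by simp
  also have "\<dots> = hausdorff_outer n A"
    by (rule hausdorff_outer_isometric_involution) (auto simp: dist_norm norm_minus_commute)
  finally show "emeasure (distr (hausdorff_measure n) borel ?T) A = emeasure (hausdorff_measure n) A"
    by (simp add: emeasure_hausdorff_measure)
qed simp

subsection \<open>The surface measure of a sphere\<close>

lemma hausdorff_premeasure_finite_cover:
  fixes F :: "'a::euclidean_space set"
  assumes "finite F" "A \<subseteq> (\<Union>x\<in>F. cball x r)" "0 < r"
  shows "hausdorff_premeasure n (2 * r) A \<le> ennreal (real (card F) * (unit_ball_vol (real n) * r ^ n))"
proof -
  obtain e where "bij_betw e {0..<card F} F"
    using ex_bij_betw_nat_finite[OF assms(1)] by blast
  then have e: "e ` {..<card F} = F" by (simp add: bij_betw_def atLeast0LessThan)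
  \<comment> \<open>Covers are sequences, so the finite one is padded with empty sets. These weigh 0
    by definition, even for \<open>n = 0\<close>, where the power of the diameter would be
    1.\<close>
  define U where "U i = (if i < card F then cball (e i) r else {})" for i
  have "A \<subseteq> (\<Union>i. U i)"
  proof
    fix x assume "x \<in> A"
    then obtain y where y: "y \<in> F" "x \<in> cball y r" using assms(2) by blast
    then obtain i where "i < card F" "y = e i" using e by blast
    then have "x \<in> U i" using y by (simp add: U_def)
    then show "x \<in> (\<Union>i. U i)" by blast
  qed
  then have "hausdorff_premeasure n (2 * r) A \<le>
      (\<Sum>i. if U i = {} then 0 else ennreal (unit_ball_vol (real n) * (diameter (U i) / 2) ^ n))"
    by (rule hausdorff_premeasure_leI) (use assms in \<open>auto simp: U_def\<close>)
  also have "\<dots> = (\<Sum>i<card F. if U i = {} then 0 else ennreal (unit_ball_vol (real n) * (diameter (U i) / 2) ^ n))"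
    by (rule suminf_finite) (auto simp: U_def)
  also have "\<dots> = (\<Sum>i<card F. ennreal (unit_ball_vol (real n) * r ^ n))"
    using assms(3) by (intro sum.cong) (auto simp: U_def)
  also have "\<dots> = ennreal (real (card F) * (unit_ball_vol (real n) * r ^ n))"
    using assms(3) by (simp add: ennreal_mult' ennreal_of_nat_eq_real_of_nat)
  finally show ?thesis .
qed

lemma power_diff_le:
  fixes a b :: real
  assumes "0 \<le> b" "b \<le> a"
  shows "a ^ n - b ^ n \<le> real n * (a - b) * a ^ (n - 1)"
proof (induction n)
  case (Suc n)
  have "a ^ Suc n - b ^ Suc n = a * (a ^ n - b ^ n) + (a - b) * b ^ n"
    by (simp add: algebra_simps)
  also have "\<dots> \<le> a * (real n * (a - b) * a ^ (n - 1)) + (a - b) * a ^ n"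
    using assms Suc by (intro add_mono mult_left_mono power_mono) auto
  also have "\<dots> = real (Suc n) * (a - b) * a ^ (Suc n - 1)"
    by (cases n) (auto simp: algebra_simps)
  finally show ?case .
qed simp

text \<open>Balls of radius \<open>r/2\<close> about the points are disjoint and lie in the shell
  between the radii \<open>R - r/2\<close> and \<open>R + r/2\<close>. The volume of the shell is of
  order \<open>r\<close>, which cancels one of the \<open>DIM('a)\<close> powers of \<open>r\<close>
  in the volume of the balls.\<close>

lemma card_separated_sphere_le:
  fixes p :: "'a::euclidean_space"
  assumes r: "0 < r" "r \<le> R" and F: "finite F" "F \<subseteq> sphere p R"
    and sep: "\<And>x y. x \<in> F \<Longrightarrow> y \<in> F \<Longrightarrow> x \<noteq> y \<Longrightarrow> r \<le> dist x y"
  shows "real (card F) * r ^ (DIM('a) - 1) \<le> 2 ^ DIM('a) * real DIM('a) * (2 * R) ^ (DIM('a) - 1)"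
proof -
  let ?d = "DIM('a)" let ?w = "unit_ball_vol (real ?d)"
  have w: "?w > 0" by simp
  have "measure lborel (\<Union>x\<in>F. ball x (r/2)) = (\<Sum>x\<in>F. measure lborel (ball x (r/2)))"
  proof (rule measure_finite_Union)
    show "disjoint_family_on (\<lambda>x. ball x (r/2)) F"
    proof (clarsimp simp: disjoint_family_on_def)
      fix x y assume xy: "x \<in> F" "y \<in> F" "x \<noteq> y"
      have False if "dist x z < r/2" "dist y z < r/2" for z
        using sep[OF xy] that dist_triangle2[of x y z] by linarith
      then show "ball x (r/2) \<inter> ball y (r/2) = {}" by auto
    qed
  qed (use F emeasure_lborel_ball_finite in \<open>auto simp: less_top[symmetric]\<close>)
  also have "\<dots> = real (card F) * (?w * (r/2) ^ ?d)"
    using r by (simp add: content_ball)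
  finally have 1: "measure lborel (\<Union>x\<in>F. ball x (r/2)) = real (card F) * (?w * (r/2) ^ ?d)" .
  have "measure lborel (\<Union>x\<in>F. ball x (r/2)) \<le> measure lborel (cball p (R + r/2) - ball p (R - r/2))"
  proof (rule measure_mono_fmeasurable)
    show "(\<Union>x\<in>F. ball x (r/2)) \<subseteq> cball p (R + r/2) - ball p (R - r/2)"
    proof clarify
      fix x z assume "x \<in> F" and z: "z \<in> ball x (r/2)"
      then have "dist p x = R" using F by auto
      then show "z \<in> cball p (R + r/2) - ball p (R - r/2)"
        using z dist_triangle[of p z x] dist_triangle[of p x z] by (auto simp: dist_commute)
    qed
    show "cball p (R + r/2) - ball p (R - r/2) \<in> fmeasurable lborel"
      using emeasure_lborel_cball_finite[of p "R + r/2"]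
      by (intro fmeasurable_Diff) (auto simp: fmeasurable_def)
    show "(\<Union>x\<in>F. ball x (r/2)) \<in> sets lborel"
      using F(1) by (intro sets.finite_UN) auto
  qed
  also have "\<dots> = measure lborel (cball p (R + r/2)) - measure lborel (ball p (R - r/2))"
  proof (rule measure_Diff)
    show "emeasure lborel (cball p (R + r/2)) \<noteq> \<infinity>"
      using emeasure_lborel_cball_finite[of p "R + r/2"] by simp
    show "ball p (R - r/2) \<subseteq> cball p (R + r/2)" using r by (auto)
  qed auto
  also have "\<dots> = ?w * ((R + r/2) ^ ?d - (R - r/2) ^ ?d)"
    using r by (simp add: content_ball content_cball algebra_simps)
  also have "\<dots> \<le> ?w * (real ?d * r * (2 * R) ^ (?d - 1))"
  proof -
    have "(R + r/2) ^ ?d - (R - r/2) ^ ?d \<le> real ?d * r * (R + r/2) ^ (?d - 1)"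
      using power_diff_le[of "R - r/2" "R + r/2" ?d] r by simp
    also have "\<dots> \<le> real ?d * r * (2 * R) ^ (?d - 1)"
      using r by (intro mult_left_mono power_mono) auto
    finally show ?thesis using w by (intro mult_left_mono) auto
  qed
  finally have "real (card F) * (?w * (r/2) ^ ?d) \<le> ?w * (real ?d * r * (2 * R) ^ (?d - 1))"
    unfolding 1 .
  then have "?w * (real (card F) * (r/2) ^ ?d) \<le> ?w * (real ?d * r * (2 * R) ^ (?d - 1))"
    by (simp add: mult_ac)
  then have "real (card F) * (r/2) ^ ?d \<le> real ?d * r * (2 * R) ^ (?d - 1)"
    using w mult_le_cancel_left_pos by blast
  then have "real (card F) * r ^ ?d \<le> 2 ^ ?d * (real ?d * r * (2 * R) ^ (?d - 1))"
    by (simp add: power_divide field_simps)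
  moreover have "r ^ ?d = r * r ^ (?d - 1)"
    by (metis DIM_positive power_eq_if less_numeral_extra(3))
  ultimately have "r * (real (card F) * r ^ (?d - 1)) \<le> r * (2 ^ ?d * real ?d * (2 * R) ^ (?d - 1))"
    by (simp add: mult_ac)
  then show ?thesis using r(1) mult_le_cancel_left_pos by blast
qed

text \<open>A maximal \<open>r\<close>-separated subset of the sphere is an \<open>r\<close>-net.
  The packing bound makes the cardinality at most of order \<open>r\<close> to the power
  \<open>- (DIM('a) - 1)\<close>, so the weight of the covering balls is bounded independently of
  \<open>r\<close>.\<close>

lemma hausdorff_outer_sphere_finite:
  fixes p :: "'a::euclidean_space"
  assumes R: "0 < R"
  shows "hausdorff_outer (DIM('a) - 1) (sphere p R) < \<infinity>"
proof -
  let ?n = "DIM('a) - 1"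
  define C where "C = 2 ^ DIM('a) * real DIM('a) * (2 * R) ^ ?n"
  have "hausdorff_outer ?n (sphere p R) \<le> ennreal (C * unit_ball_vol (real ?n))"
  proof (rule hausdorff_outer_leI)
    fix \<epsilon> :: real assume "0 < \<epsilon>"
    \<comment> \<open>The packing bound needs \<open>r \<le> R\<close>, and balls of radius
      \<open>r\<close> have diameter \<open>2 * r \<le> \<epsilon>\<close>.\<close>
    define r where "r = min (\<epsilon>/2) R"
    have r: "0 < r" "r \<le> R" "2 * r \<le> \<epsilon>" using R \<open>0 < \<epsilon>\<close> by (auto simp: r_def)
    define P where "P F \<longleftrightarrow> finite F \<and> F \<subseteq> sphere p R \<and> (\<forall>x\<in>F. \<forall>y\<in>F. x \<noteq> y \<longrightarrow> r \<le> dist x y)" for F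
    have bound: "real (card F) * r ^ ?n \<le> C" if "P F" for F
      using card_separated_sphere_le[of r R F p] that r unfolding P_def C_def by blast
    have "card F < nat \<lfloor>C / r ^ ?n\<rfloor> + 1" if "P F" for F
    proof -
      have "real (card F) \<le> C / r ^ ?n"
        using bound[OF that] r by (simp add: pos_le_divide_eq)
      then show ?thesis by linarith
    qed
    moreover have "P {}" by (simp add: P_def)
    ultimately obtain F where F: "P F" and max: "\<And>G. P G \<Longrightarrow> card G \<le> card F"
      using ex_has_greatest_nat[of P "{}" card "nat \<lfloor>C / r ^ ?n\<rfloor> + 1"] by blast
    have "sphere p R \<subseteq> (\<Union>x\<in>F. cball x r)"
    proof (rule ccontr)
      assume "\<not> sphere p R \<subseteq> (\<Union>x\<in>F. cball x r)"
      then obtain z where z: "z \<in> sphere p R" "\<And>x. x \<in> F \<Longrightarrow> r < dist x z" by fastforce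
      then have "z \<notin> F" using r by force
      moreover have "P (insert z F)"
        using F z by (auto simp: P_def dist_commute less_imp_le)
      ultimately show False using max[of "insert z F"] F by (simp add: P_def)
    qed
    then have "hausdorff_premeasure ?n (2 * r) (sphere p R) \<le> ennreal (real (card F) * (unit_ball_vol (real ?n) * r ^ ?n))"
      using F r by (intro hausdorff_premeasure_finite_cover) (auto simp: P_def)
    also have "\<dots> \<le> ennreal (C * unit_ball_vol (real ?n))"
      using mult_right_mono[OF bound[OF F], of "unit_ball_vol (real ?n)"] by (intro ennreal_leI) (simp add: mult_ac)
    finally show "hausdorff_premeasure ?n \<epsilon> (sphere p R) \<le> ennreal (C * unit_ball_vol (real ?n))"
      using hausdorff_premeasure_mono[of "sphere p R" "sphere p R" "2 * r" \<epsilon>] r by (meson order_refl order_trans)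
  qed
  then show ?thesis by (simp add: le_less_trans)
qed

text \<open>Project a cover of the sphere along a basis vector \<open>b\<close>: the cylinders of height \<open>R\<close> over the
  projections are contained in boxes and cover a half ball.\<close>

lemma hausdorff_outer_sphere_pos:
  fixes p :: "'a::euclidean_space"
  assumes R: "0 < R"
  shows "0 < hausdorff_outer (DIM('a) - 1) (sphere p R)"
proof -
  let ?n = "DIM('a) - 1" let ?w = "unit_ball_vol (real ?n)"
  obtain b :: 'a where b: "b \<in> Basis" using nonempty_Basis by blast
  \<comment> \<open>The ball of radius \<open>R/2\<close> about \<open>q\<close> lies in the upper
    half of the ball about \<open>p\<close>; covering this smaller ball of positive volume is
    enough.\<close>
  define q where "q = p + (R/2) *\<^sub>R b"
  define m where "m = measure lborel (ball q (R/2))"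
  have m: "m > 0" unfolding m_def using R by simp
  \<comment> \<open>The box over a set of diameter \<open>D\<close> has height \<open>R\<close> and
    \<open>?n\<close> sides \<open>2 * D\<close>, hence volume
    \<open>R * 4 ^ ?n * (D / 2) ^ ?n\<close>. So \<open>c\<close> is the ratio of the weight in the
    premeasure to the volume of the box.\<close>
  define c where "c = ?w / (R * 4 ^ ?n)"
  have c: "c > 0" using R by (simp add: c_def)
  have "ennreal (c * m) \<le> hausdorff_premeasure ?n 1 (sphere p R)"
  proof (rule hausdorff_premeasure_geI)
    fix U :: "nat \<Rightarrow> 'a set"
    assume cov: "sphere p R \<subseteq> (\<Union>i. U i)" and bdd: "\<And>i. bounded (U i)"
    define s where "s i = (SOME x. x \<in> U i)" for i
    define l u where "l i = (\<Sum>j\<in>Basis. (if j = b then p \<bullet> b else s i \<bullet> j - diameter (U i)) *\<^sub>R j)"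
      and "u i = (\<Sum>j\<in>Basis. (if j = b then p \<bullet> b + R else s i \<bullet> j + diameter (U i)) *\<^sub>R j)" for i
    define Q where "Q i = (if U i = {} then {} else cbox (l i) (u i))" for i
    have dp: "0 \<le> diameter (U i)" for i using bdd diameter_ge_0 by blast
    have Q: "emeasure lborel (Q i) = ennreal (inverse c) *
      (if U i = {} then 0 else ennreal (?w * (diameter (U i) / 2) ^ ?n))" for i
    proof (cases "U i = {}")
      case False
      have "emeasure lborel (Q i) = (\<Prod>j\<in>Basis. (u i - l i) \<bullet> j)"
      proof -
        have "Q i = cbox (l i) (u i)" using False by (simp add: Q_def)
        moreover have "l i \<bullet> j \<le> u i \<bullet> j" if "j \<in> Basis" for j
          using that dp[of i] R by (simp add: l_def u_def)
        ultimately show ?thesis by (simp add: emeasure_lborel_cbox)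
      qed
      also have "(\<Prod>j\<in>Basis. (u i - l i) \<bullet> j) = (\<Prod>j\<in>Basis. if j = b then R else 2 * diameter (U i))"
        by (intro prod.cong) (auto simp: l_def u_def inner_diff_left)
      also have "\<dots> = R * (\<Prod>j\<in>Basis - {b}. 2 * diameter (U i))"
        using b by (subst prod.remove[of _ b]) (auto intro!: prod.cong)
      also have "\<dots> = inverse c * (?w * (diameter (U i) / 2) ^ ?n)"
      proof -
        have "(4::real) ^ ?n = 2 ^ ?n * 2 ^ ?n" by (simp flip: power_mult_distrib)
        moreover have "?w \<noteq> 0" by (metis unit_ball_vol_pos of_nat_0_le_iff less_irrefl)
        ultimately show ?thesis
          using R b by (simp add: c_def field_simps power_mult_distrib power_divide)
      qed
      finally show ?thesis using False c by (simp add: ennreal_mult')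
    qed (simp add: Q_def)
    have cover: "ball q (R/2) \<subseteq> (\<Union>i. Q i)"
    proof
      fix y assume y: "y \<in> ball q (R/2)"
      define v where "v = y - p"
      have nb: "norm b = 1" "b \<bullet> b = 1" using b by auto
      have vb: "\<bar>v \<bullet> b - R/2\<bar> < R/2"
      proof -
        have "norm (v - (R/2) *\<^sub>R b) < R/2"
          using y by (simp add: v_def q_def dist_norm norm_minus_commute algebra_simps)
        moreover have "\<bar>(v - (R/2) *\<^sub>R b) \<bullet> b\<bar> \<le> norm (v - (R/2) *\<^sub>R b)"
          using Cauchy_Schwarz_ineq2[of "v - (R/2) *\<^sub>R b" b] nb by simp
        ultimately show ?thesis by (simp add: inner_diff_left nb)
      qed
      have "norm v \<le> R"
      proof -
        have "norm v \<le> norm (v - (R/2) *\<^sub>R b) + norm ((R/2) *\<^sub>R b)"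
          by (metis diff_add_cancel norm_triangle_ineq)
        also have "norm (v - (R/2) *\<^sub>R b) < R/2"
          using y by (simp add: v_def q_def dist_norm norm_minus_commute algebra_simps)
        finally show ?thesis using R nb by simp
      qed
      define v' where "v' = v - (v \<bullet> b) *\<^sub>R b"
      have orth: "v' \<bullet> b = 0" by (simp add: v'_def inner_diff_left nb)
      have nv: "(norm v)\<^sup>2 = (norm v')\<^sup>2 + (v \<bullet> b)\<^sup>2"
      proof -
        have "v = v' + (v \<bullet> b) *\<^sub>R b" by (simp add: v'_def)
        then have "(norm v)\<^sup>2 = (norm v')\<^sup>2 + (norm ((v \<bullet> b) *\<^sub>R b))\<^sup>2"
          using norm_add_Pythagorean[of v' "(v \<bullet> b) *\<^sub>R b"] orth by (simp add: orthogonal_def)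
        then show ?thesis by (simp add: nb)
      qed
      have le: "(norm v')\<^sup>2 \<le> R\<^sup>2"
        using nv \<open>norm v \<le> R\<close> power_mono[of "norm v" R 2] by (smt (verit) norm_ge_zero zero_le_power2)
      \<comment> \<open>The point of the upper hemisphere with the same projection along
        \<open>b\<close> as \<open>y\<close>. Whichever \<open>U i\<close> contains it, the box
        \<open>Q i\<close> contains \<open>y\<close>.\<close>
      define x where "x = p + (v' + sqrt (R\<^sup>2 - (norm v')\<^sup>2) *\<^sub>R b)"
      have "(norm (x - p))\<^sup>2 = R\<^sup>2"
        using norm_add_Pythagorean[of v' "sqrt (R\<^sup>2 - (norm v')\<^sup>2) *\<^sub>R b"] orth le
        by (simp add: x_def orthogonal_def nb)
      then have "norm (x - p) = R" using R by (simp add: power2_eq_iff_nonneg)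
      then have "x \<in> sphere p R" by (simp add: dist_norm norm_minus_commute)
      then obtain i where i: "x \<in> U i" using cov by auto
      then have s: "s i \<in> U i" unfolding s_def by (rule someI)
      have "y \<in> Q i"
      proof -
        have "l i \<bullet> j \<le> y \<bullet> j \<and> y \<bullet> j \<le> u i \<bullet> j" if j: "j \<in> Basis" for j
        proof (cases "j = b")
          case True
          have "p \<bullet> b \<le> y \<bullet> b \<and> y \<bullet> b \<le> p \<bullet> b + R"
            using vb unfolding v_def inner_diff_left by linarith
          then show ?thesis using True j by (simp add: l_def u_def)
        next
          case False
          have "b \<bullet> j = 0" using b j False by (simp add: inner_Basis)
          then have "x \<bullet> j = y \<bullet> j"
            by (simp add: x_def v'_def v_def inner_add_left inner_diff_left)
          moreover have "\<bar>(x - s i) \<bullet> j\<bar> \<le> diameter (U i)"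
            using Basis_le_norm[OF j, of "x - s i"] diameter_bounded_bound[OF bdd i s]
            by (simp add: dist_norm)
          ultimately have "s i \<bullet> j - diameter (U i) \<le> y \<bullet> j \<and> y \<bullet> j \<le> s i \<bullet> j + diameter (U i)"
            unfolding inner_diff_left by linarith
          then show ?thesis using False j by (simp add: l_def u_def)
        qed
        then show ?thesis using i by (auto simp: Q_def mem_box)
      qed
      then show "y \<in> (\<Union>i. Q i)" by blast
    qed
    have Qm: "range Q \<subseteq> sets lborel" by (auto simp: Q_def)
    have "ennreal m = emeasure lborel (ball q (R/2))"
      unfolding m_def by (rule emeasure_eq_ennreal_measure[symmetric])
        (use emeasure_lborel_ball_finite[of q "R/2"] in auto)
    also have "\<dots> \<le> emeasure lborel (\<Union>i. Q i)"
      using cover Qm by (intro emeasure_mono) auto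
    also have "\<dots> \<le> (\<Sum>i. emeasure lborel (Q i))"
      using Qm by (rule emeasure_subadditive_countably)
    also have "\<dots> = ennreal (inverse c) * (\<Sum>i. if U i = {} then 0 else ennreal (?w * (diameter (U i) / 2) ^ ?n))"
      unfolding Q by (rule ennreal_suminf_cmult)
    finally have "ennreal c * ennreal m \<le> ennreal c * (ennreal (inverse c) * (\<Sum>i. if U i = {} then 0 else ennreal (?w * (diameter (U i) / 2) ^ ?n)))"
      by (rule mult_left_mono) simp
    also have "\<dots> = (\<Sum>i. if U i = {} then 0 else ennreal (?w * (diameter (U i) / 2) ^ ?n))"
      using c by (simp add: mult.assoc[symmetric] ennreal_mult'[symmetric])
    finally show "ennreal (c * m) \<le> (\<Sum>i. if U i = {} then 0 else ennreal (?w * (diameter (U i) / 2) ^ ?n))"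
      using c m by (simp add: ennreal_mult')
  qed
  also have "\<dots> \<le> hausdorff_outer ?n (sphere p R)"
    by (rule hausdorff_premeasure_le_outer) simp
  finally have "ennreal (c * m) \<le> hausdorff_outer ?n (sphere p R)" .
  moreover have "0 < ennreal (c * m)" using c m by simp
  ultimately show ?thesis by (rule less_le_trans[rotated])
qed

text \<open>The reflection of \<open>x\<close> to \<open>2 *\<^sub>R p - x\<close> preserves the
  measure and the sphere. It turns the first moment into the measure times
  \<open>2 *\<^sub>R p\<close> minus itself; finiteness gives integrability and positivity allows
  the division.\<close>

lemma center_of_mass_hausdorff_sphere:
  fixes p :: "'a::euclidean_space"
  assumes R: "0 < R"
  shows "center_of_mass (hausdorff_measure (DIM('a) - 1)) (sphere p R) = p"
proof -
  let ?M = "hausdorff_measure (DIM('a) - 1) :: 'a measure" let ?S = "sphere p R"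
  have em: "0 < emeasure ?M ?S" "emeasure ?M ?S < \<infinity>"
    using hausdorff_outer_sphere_finite[OF R, of p] hausdorff_outer_sphere_pos[OF R, of p]
    by (auto simp: emeasure_hausdorff_measure)
  then have pos: "measure ?M ?S > 0"
    by (simp add: measure_def enn2real_positive_iff)
  have S[measurable]: "?S \<in> sets ?M" by simp
  have int: "integrable ?M (\<lambda>x. indicator ?S x *\<^sub>R x)"
  proof (rule integrableI_bounded_set_indicator[of _ _ _ "norm p + R"])
    have "norm x \<le> norm p + R" if "x \<in> ?S" for x
    proof -
      have "norm x \<le> norm p + norm (x - p)" by (metis norm_triangle_sub)
      then show ?thesis using that by (simp add: dist_norm norm_minus_commute)
    qed
    then show "AE x in ?M. x \<in> ?S \<longrightarrow> norm x \<le> norm p + R" by simp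
  qed (use em in auto)
  have int': "integrable ?M (\<lambda>x. indicator ?S x *\<^sub>R (2 *\<^sub>R p))"
    using em by (intro integrable_scaleR_left integrable_real_indicator) auto
  have "(LINT x|?M. indicator ?S x *\<^sub>R x) = (LINT x|distr ?M borel (\<lambda>x. 2 *\<^sub>R p - x). indicator ?S x *\<^sub>R x)"
    by (simp add: distr_hausdorff_measure_reflect)
  also have "\<dots> = (LINT x|?M. indicator ?S (2 *\<^sub>R p - x) *\<^sub>R (2 *\<^sub>R p - x))"
    by (subst integral_distr) auto
  also have "\<dots> = (LINT x|?M. indicator ?S x *\<^sub>R (2 *\<^sub>R p) - indicator ?S x *\<^sub>R x)"
  proof (rule Bochner_Integration.integral_cong)
    fix x
    have "2 *\<^sub>R p - x \<in> ?S \<longleftrightarrow> x \<in> ?S"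
      by (simp add: dist_norm scaleR_2 norm_minus_commute algebra_simps)
    then show "indicator ?S (2 *\<^sub>R p - x) *\<^sub>R (2 *\<^sub>R p - x) = indicator ?S x *\<^sub>R (2 *\<^sub>R p) - indicator ?S x *\<^sub>R x"
      by (auto simp: indicator_def)
  qed simp
  also have "\<dots> = measure ?M ?S *\<^sub>R (2 *\<^sub>R p) - (LINT x|?M. indicator ?S x *\<^sub>R x)"
  proof -
    have "(LINT x|?M. indicator ?S x *\<^sub>R (2 *\<^sub>R p)) = measure ?M ?S *\<^sub>R (2 *\<^sub>R p)"
      using em by (subst integral_scaleR_left) auto
    then show ?thesis by (simp only: Bochner_Integration.integral_diff[OF int' int])
  qed
  finally have "(LINT x|?M. indicator ?S x *\<^sub>R x) + (LINT x|?M. indicator ?S x *\<^sub>R x) =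
      measure ?M ?S *\<^sub>R (2 *\<^sub>R p)"
    unfolding eq_diff_eq .
  then have "2 *\<^sub>R (LINT x|?M. indicator ?S x *\<^sub>R x) = 2 *\<^sub>R (measure ?M ?S *\<^sub>R p)"
    by (simp only: scaleR_2 scaleR_add_right)
  then have "(LINT x|?M. indicator ?S x *\<^sub>R x) = measure ?M ?S *\<^sub>R p"
    by (metis scaleR_cancel_left zero_neq_numeral)
  then show ?thesis
    using pos by (simp add: center_of_mass_def set_lebesgue_integral_def)
qed

subsection \<open>Lebesgue measure in orthonormal coordinates\<close>

lemma sigma_finite_measure_cballI:
  fixes M :: "'a::euclidean_space measure"
  assumes "sets M = sets borel" and fin: "\<And>n::nat. emeasure M (cball 0 (real (Suc n))) < \<infinity>"
  shows "sigma_finite_measure M"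
proof
  have sp: "space M = UNIV"
    using sets_eq_imp_space_eq[OF assms(1)] by simp
  have "x \<in> \<Union>(range (\<lambda>n::nat. cball 0 (real (Suc n))))" for x :: 'a
  proof -
    obtain n :: nat where "norm x \<le> real n" using real_arch_simple by blast
    then have "x \<in> cball 0 (real (Suc n))" by simp
    then show ?thesis by blast
  qed
  then show "\<exists>A. countable A \<and> A \<subseteq> sets M \<and> \<Union>A = space M \<and> (\<forall>a\<in>A. emeasure M a \<noteq> \<infinity>)"
    using fin assms(1) sp
    by (intro exI[of _ "range (\<lambda>n::nat. cball 0 (real (Suc n)))"]) (auto simp: less_top)
qed

text \<open>Integrating \<open>indicator A x * indicator B (x + y)\<close> in both orders gives
  \<open>\<mu> A * \<nu> B = \<mu> B * \<nu> (-A)\<close> for translation invariant \<open>\<mu>\<close>, \<open>\<nu>\<close>; take for \<open>A\<close> a ball.\<close>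

lemma translation_invariant_eq_lborel:
  fixes M :: "'a::euclidean_space measure"
  assumes sets_M[measurable_cong]: "sets M = sets borel"
    and trans: "\<And>a. distr M borel (\<lambda>x. x + a) = M"
    and ball: "\<And>r. 0 < r \<Longrightarrow> emeasure M (cball 0 r) = emeasure lborel (cball 0 r :: 'a set)"
  shows "M = lborel"
proof -
  have bf: "emeasure M (cball 0 (real (Suc n))) < \<infinity>" for n :: nat
    using ball[of "real (Suc n)"] emeasure_lborel_cball_finite[of "0::'a" "real (Suc n)"]
    by (simp del: of_nat_Suc)
  interpret M: sigma_finite_measure M
    by (rule sigma_finite_measure_cballI[OF sets_M bf])
  interpret P: pair_sigma_finite M lborel ..
  have sp: "space M = UNIV"
    using sets_eq_imp_space_eq[OF sets_M] by simp
  have shift: "(\<integral>\<^sup>+x. f (x + a) \<partial>M) = (\<integral>\<^sup>+x. f x \<partial>M)" if [measurable]: "f \<in> borel_measurable borel" for f a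
    by (subst (2) trans[of a, symmetric]) (simp add: nn_integral_distr)
  have shift': "(\<integral>\<^sup>+x. f (a + x) \<partial>lborel) = (\<integral>\<^sup>+x. f x \<partial>lborel)"
    if [measurable]: "f \<in> borel_measurable borel" for f and a :: 'a
    by (subst (2) lborel_distr_plus[of a, symmetric]) (simp add: nn_integral_distr)
  have refl: "(\<integral>\<^sup>+x. f (a - x) \<partial>lborel) = (\<integral>\<^sup>+x. f x \<partial>lborel)"
    if [measurable]: "f \<in> borel_measurable borel" for f and a :: 'a
  proof -
    have "distr lborel borel (\<lambda>x. a + (-1) *\<^sub>R x) = lborel"
      using lborel_affine[of "-1" a] by (simp add: density_1)
    then have *: "distr lborel borel (\<lambda>x. a - x) = lborel" by simp
    show ?thesis
      by (subst (2) *[symmetric]) (simp add: nn_integral_distr)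
  qed
  define A where "A = cball (0::'a) 1"
  have [measurable]: "A \<in> sets borel" by (simp add: A_def)
  show ?thesis
  proof (rule measure_eqI)
    fix B assume "B \<in> sets M"
    then have [measurable]: "B \<in> sets borel" using sets_M by simp
    have "emeasure M A * emeasure lborel B = (\<integral>\<^sup>+x. indicator A x * emeasure lborel B \<partial>M)"
      by (simp add: nn_integral_multc)
    also have "\<dots> = (\<integral>\<^sup>+x. (\<integral>\<^sup>+y. indicator A x * indicator B (x + y) \<partial>lborel) \<partial>M)"
      using shift'[of "indicator B"] by (simp add: nn_integral_cmult)
    also have "\<dots> = (\<integral>\<^sup>+y. (\<integral>\<^sup>+x. indicator A x * indicator B (x + y) \<partial>M) \<partial>lborel)"
      by (rule P.Fubini'[symmetric]) measurable
    also have "\<dots> = (\<integral>\<^sup>+y. (\<integral>\<^sup>+x. indicator A (x - y) * indicator B x \<partial>M) \<partial>lborel)"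
    proof (rule nn_integral_cong)
      fix y :: 'a
      have "(\<lambda>x. indicator A (x - y) * indicator B x :: ennreal) \<in> borel_measurable borel"
        by measurable
      from shift[OF this, of y]
      show "(\<integral>\<^sup>+x. indicator A x * indicator B (x + y) \<partial>M) = (\<integral>\<^sup>+x. indicator A (x - y) * indicator B x \<partial>M)"
        by simp
    qed
    also have "\<dots> = (\<integral>\<^sup>+x. (\<integral>\<^sup>+y. indicator A (x - y) * indicator B x \<partial>lborel) \<partial>M)"
      by (rule P.Fubini') measurable
    also have "\<dots> = (\<integral>\<^sup>+x. emeasure lborel A * indicator B x \<partial>M)"
      using refl[of "indicator A"] by (simp add: nn_integral_multc)
    also have "\<dots> = emeasure lborel A * emeasure M B"
      using \<open>B \<in> sets M\<close> by (simp add: nn_integral_cmult)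
    finally have eq: "emeasure lborel A * emeasure lborel B = emeasure lborel A * emeasure M B"
      using ball[of 1] unfolding A_def by simp
    have "emeasure lborel A \<noteq> 0"
      unfolding A_def using emeasure_cball[of 1 "0::'a"] by (simp add: less_imp_neq[symmetric])
    moreover have "emeasure lborel A \<noteq> \<infinity>"
      unfolding A_def using emeasure_lborel_cball_finite[of "0::'a" 1] by simp
    ultimately show "emeasure M B = emeasure lborel B"
      using eq ennreal_mult_cancel_left by (metis infinity_ennreal_def)
  qed (simp add: sets_M)
qed

section \<open>Rotation invariance of Lebesgue measure\<close>

lemma distr_PiM_lborel_translate:
  assumes "finite B"
  shows "distr (Pi\<^sub>M B (\<lambda>_. lborel)) (Pi\<^sub>M B (\<lambda>_. lborel)) (\<lambda>f. \<lambda>b\<in>B. f b + c b :: real) =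
    Pi\<^sub>M B (\<lambda>_. lborel)"
proof -
  interpret product_sigma_finite "\<lambda>_. lborel::real measure" ..
  interpret finite_product_sigma_finite "\<lambda>_. lborel::real measure" B
    by standard fact
  show ?thesis
  proof (rule PiM_eqI[OF assms])
    fix A :: "'a \<Rightarrow> real set" assume A: "\<And>i. i \<in> B \<Longrightarrow> A i \<in> sets lborel"
    have *: "(\<lambda>f. \<lambda>b\<in>B. f b + c b) -` Pi\<^sub>E B A \<inter> space (Pi\<^sub>M B (\<lambda>_. lborel)) =
      Pi\<^sub>E B (\<lambda>b. (\<lambda>x. x + c b) -` A b)"
      by (auto simp: space_PiM PiE_iff)
    have m: "(\<lambda>x. x + c b) -` A b \<in> sets lborel" if "b \<in> B" for b
      using measurable_sets[of "\<lambda>x. x + c b" lborel lborel "A b"] A[OF that] by simp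
    have e: "emeasure lborel ((\<lambda>x. x + c b) -` A b) = emeasure lborel (A b)" if "b \<in> B" for b
    proof -
      have "emeasure lborel (A b) = emeasure (distr lborel borel ((+) (c b))) (A b)"
        by (simp add: lborel_distr_plus)
      also have "\<dots> = emeasure lborel ((+) (c b) -` A b)"
        using A[OF that] by (subst emeasure_distr) auto
      also have "(+) (c b) -` A b = (\<lambda>x. x + c b) -` A b"
        by (auto simp: add.commute)
      finally show ?thesis ..
    qed
    show "emeasure (distr (Pi\<^sub>M B (\<lambda>_. lborel)) (Pi\<^sub>M B (\<lambda>_. lborel)) (\<lambda>f. \<lambda>b\<in>B. f b + c b)) (Pi\<^sub>E B A) =
      (\<Prod>i\<in>B. emeasure lborel (A i))"
    proof -
      have "emeasure (Pi\<^sub>M B (\<lambda>_. lborel)) (Pi\<^sub>E B (\<lambda>b. (\<lambda>x. x + c b) -` A b)) = (\<Prod>i\<in>B. emeasure lborel (A i))"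
        by (subst measure_times[OF m]) (simp_all add: e)
      then show ?thesis
        using A assms by (subst emeasure_distr) (auto simp: * intro!: sets_PiM_I_finite)
    qed
  qed simp
qed

lemma orthonormal_inner:
  assumes "orthonormal_basis_of V B" "x \<in> B" "y \<in> B"
  shows "x \<bullet> y = (if x = y then 1 else 0)"
  using assms by (auto simp: orthonormal_basis_of_def pairwise_def orthogonal_def norm_eq_1)

lemma orthonormal_finite:
  fixes B :: "'a::euclidean_space set"
  assumes "orthonormal_basis_of V B"
  shows "finite B"
proof -
  have "0 \<notin> B" using assms by (auto simp: orthonormal_basis_of_def)
  then show ?thesis
    using assms pairwise_orthogonal_independent independent_imp_finite
    by (auto simp: orthonormal_basis_of_def)
qed

lemma orthonormal_expansion:
  fixes B :: "'a::euclidean_space set"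
  assumes "orthonormal_basis_of UNIV B"
  shows "(\<Sum>b\<in>B. (x \<bullet> b) *\<^sub>R b) = x"
proof -
  note fin = orthonormal_finite[OF assms]
  have "(x - (\<Sum>b\<in>B. (x \<bullet> b) *\<^sub>R b)) \<bullet> c = 0" if "c \<in> B" for c
  proof -
    have "(\<Sum>b\<in>B. (x \<bullet> b) *\<^sub>R b) \<bullet> c = (\<Sum>b\<in>B. if b = c then x \<bullet> b else 0)"
      unfolding inner_sum_left
      by (intro sum.cong) (auto simp: orthonormal_inner[OF assms _ that])
    then show ?thesis using fin that by (simp add: inner_diff_left)
  qed
  then have "orthogonal (x - (\<Sum>b\<in>B. (x \<bullet> b) *\<^sub>R b)) y" if "y \<in> span B" for y
    by (intro orthogonal_to_span[OF that]) (simp add: orthogonal_def)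
  then have "orthogonal (x - (\<Sum>b\<in>B. (x \<bullet> b) *\<^sub>R b)) (x - (\<Sum>b\<in>B. (x \<bullet> b) *\<^sub>R b))"
    using assms by (simp add: orthonormal_basis_of_def)
  then show ?thesis by (simp add: orthogonal_self)
qed

text \<open>Both conditions of the uniqueness theorem hold: a translation by \<open>a\<close> only
  shifts the coordinates by \<open>a \<bullet> b\<close>, and since the coordinate map is isometric,
  centered balls have the volume that \<open>emeasure_cball_aux\<close> gives for a product over any
  finite index set.\<close>

lemma lborel_orthonormal_basis:
  fixes B :: "'a::euclidean_space set"
  assumes B: "orthonormal_basis_of UNIV B"
  shows "distr (Pi\<^sub>M B (\<lambda>_. lborel)) borel (\<lambda>f. \<Sum>b\<in>B. f b *\<^sub>R b) = (lborel :: 'a measure)"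
    (is "?M = _")
proof (rule translation_invariant_eq_lborel)
  note fin = orthonormal_finite[OF B]
  interpret product_sigma_finite "\<lambda>_. lborel::real measure" ..
  have [measurable]: "(\<lambda>f. \<Sum>b\<in>B. f b *\<^sub>R b) \<in> borel_measurable (Pi\<^sub>M B (\<lambda>_. lborel))"
    by measurable
  have [measurable]: "(\<lambda>f. \<lambda>b\<in>B. f b + c b :: real) \<in> measurable (Pi\<^sub>M B (\<lambda>_. lborel)) (Pi\<^sub>M B (\<lambda>_. lborel))" for c
    by measurable
  show "sets ?M = sets borel" by simp
  show "distr ?M borel (\<lambda>x. x + a) = ?M" for a
  proof -
    have "?M = distr (distr (Pi\<^sub>M B (\<lambda>_. lborel)) (Pi\<^sub>M B (\<lambda>_. lborel)) (\<lambda>f. \<lambda>b\<in>B. f b + a \<bullet> b))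
      borel (\<lambda>f. \<Sum>b\<in>B. f b *\<^sub>R b)"
      by (simp add: distr_PiM_lborel_translate[OF fin])
    also have "\<dots> = distr (Pi\<^sub>M B (\<lambda>_. lborel)) borel (\<lambda>f. (\<Sum>b\<in>B. f b *\<^sub>R b) + a)"
      by (subst distr_distr) (auto intro!: distr_cong simp: o_def scaleR_left_distrib sum.distrib orthonormal_expansion[OF B])
    also have "\<dots> = distr ?M borel (\<lambda>x. x + a)"
      by (subst distr_distr) (auto simp: o_def)
    finally show ?thesis ..
  qed
  show "emeasure ?M (cball 0 r) = emeasure lborel (cball 0 r :: 'a set)" if "0 < r" for r
  proof -
    have card: "card B = DIM('a)"
    proof -
      have "0 \<notin> B" using B by (auto simp: orthonormal_basis_of_def)
      then have "independent B"
        using B pairwise_orthogonal_independent by (auto simp: orthonormal_basis_of_def)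
      then have "card B = dim (span B)"
        by (metis dim_span_eq_card_independent)
      moreover have "span B = UNIV" using B by (simp add: orthonormal_basis_of_def)
      ultimately show ?thesis by (metis dim_UNIV)
    qed
    have nrm: "norm (\<Sum>b\<in>B. f b *\<^sub>R b) = sqrt (\<Sum>b\<in>B. (f b)\<^sup>2)" for f
    proof -
      have "(norm (\<Sum>b\<in>B. f b *\<^sub>R b))\<^sup>2 = (\<Sum>b\<in>B. (norm (f b *\<^sub>R b))\<^sup>2)"
        using B fin by (intro norm_sum_Pythagorean) (auto simp: orthonormal_basis_of_def pairwise_def orthogonal_clauses)
      also have "\<dots> = (\<Sum>b\<in>B. (f b)\<^sup>2)"
        using B by (intro sum.cong) (auto simp: orthonormal_basis_of_def)
      finally show ?thesis by (metis norm_ge_zero real_sqrt_unique)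
    qed
    have "(\<lambda>f. \<Sum>b\<in>B. f b *\<^sub>R b) -` cball 0 r \<inter> space (Pi\<^sub>M B (\<lambda>_. lborel)) =
      {f. sqrt (\<Sum>i\<in>B. (f i)\<^sup>2) \<le> r} \<inter> space (Pi\<^sub>M B (\<lambda>_. lborel))"
      by (auto simp: nrm)
    then have "emeasure ?M (cball 0 r) = ennreal (unit_ball_vol (real (card B)) * r ^ card B)"
      using that by (subst emeasure_distr) (simp_all add: emeasure_cball_aux[OF fin])
    then show ?thesis
      using that by (simp add: card emeasure_cball)
  qed
qed

section \<open>Lebesgue measure on a hyperplane and integration along its normal\<close>

lemma orthonormal_basis_of_hyperplane:
  fixes \<xi> :: "'a::euclidean_space"
  assumes "norm \<xi> = 1" and B: "orthonormal_basis_of {x. x \<bullet> \<xi> = 0} B"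
  shows "\<xi> \<notin> B" "orthonormal_basis_of UNIV (insert \<xi> B)"
proof -
  have sub: "B \<subseteq> {x. x \<bullet> \<xi> = 0}"
    using B span_superset unfolding orthonormal_basis_of_def by blast
  show "\<xi> \<notin> B" using sub assms by (auto simp: dot_square_norm)
  have "x \<in> span (insert \<xi> B)" for x
  proof -
    have "x - (x \<bullet> \<xi>) *\<^sub>R \<xi> \<in> span B"
      using B assms(1) by (simp add: orthonormal_basis_of_def inner_diff_left dot_square_norm)
    then show ?thesis by (metis span_breakdown_eq)
  qed
  then show "orthonormal_basis_of UNIV (insert \<xi> B)"
    using B sub assms(1) unfolding orthonormal_basis_of_def
    by (auto simp: pairwise_insert orthogonal_def inner_commute)
qed

text \<open>Trades the two \<open>SOME\<close> terms of \<open>plane_lborel\<close> for an origin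
  and a basis of which only the defining properties are known.\<close>

lemma plane_lborel_hyperplane:
  fixes \<xi> :: "'a::euclidean_space"
  assumes \<xi>: "norm \<xi> = 1"
  obtains p B where "p \<bullet> \<xi> = t" "orthonormal_basis_of {x. x \<bullet> \<xi> = 0} B"
    "plane_lborel {x. x \<bullet> \<xi> = t} = distr (Pi\<^sub>M B (\<lambda>_. lborel)) borel (\<lambda>f. p + (\<Sum>b\<in>B. f b *\<^sub>R b))"
proof -
  let ?H = "{x. x \<bullet> \<xi> = t}"
  define p where "p = (SOME p. p \<in> ?H)"
  have "t *\<^sub>R \<xi> \<in> ?H" using \<xi> by (simp add: dot_square_norm)
  then have p: "p \<in> ?H" unfolding p_def by (rule someI)
  define B where "B = (SOME B. orthonormal_basis_of {x - p | x. x \<in> ?H} B)"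
  have eq: "{x - p | x. x \<in> ?H} = {x. x \<bullet> \<xi> = 0}"
  proof -
    have "\<exists>z. y = z - p \<and> z \<bullet> \<xi> = t" if "y \<bullet> \<xi> = 0" for y
      using that p by (intro exI[of _ "y + p"]) (auto simp: inner_add_left)
    then show ?thesis using p by (auto simp: inner_diff_left)
  qed
  have "subspace {x. x \<bullet> \<xi> = 0}"
    by (auto simp: subspace_def inner_add_left)
  then obtain C where "orthonormal_basis_of {x. x \<bullet> \<xi> = 0} C"
    unfolding orthonormal_basis_of_def by (metis orthonormal_basis_subspace)
  then have B: "orthonormal_basis_of {x. x \<bullet> \<xi> = 0} B"
    unfolding B_def eq by (rule someI)
  show ?thesis
    using that[OF _ B, of p] p unfolding plane_lborel_def Let_def p_def[symmetric] B_def[symmetric] by simp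
qed

lemma sets_plane_lborel[simp, measurable_cong]: "sets (plane_lborel A) = sets borel"
  by (simp add: plane_lborel_def Let_def)

lemma space_plane_lborel[simp]: "space (plane_lborel A) = UNIV"
  by (simp add: plane_lborel_def Let_def)

lemma AE_plane_lborel_hyperplane:
  fixes \<xi> :: "'a::euclidean_space"
  assumes \<xi>: "norm \<xi> = 1"
  shows "AE v in plane_lborel {x. x \<bullet> \<xi> = t}. v \<bullet> \<xi> = t"
proof -
  obtain p B where p: "p \<bullet> \<xi> = t" and B: "orthonormal_basis_of {x. x \<bullet> \<xi> = 0} B"
    and eq: "plane_lborel {x. x \<bullet> \<xi> = t} = distr (Pi\<^sub>M B (\<lambda>_. lborel)) borel (\<lambda>f. p + (\<Sum>b\<in>B. f b *\<^sub>R b))"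
    by (rule plane_lborel_hyperplane[OF \<xi>])
  have sub: "b \<bullet> \<xi> = 0" if "b \<in> B" for b
    using B span_base[OF that] unfolding orthonormal_basis_of_def by blast
  have "(p + (\<Sum>b\<in>B. f b *\<^sub>R b)) \<bullet> \<xi> = t" for f
    by (simp add: inner_add_left inner_sum_left sub p)
  then show ?thesis
    unfolding eq by (subst AE_distr_iff) auto
qed

text \<open>The normal \<xi> completes the basis of the hyperplane to one of the whole space, so the
  integral over its coordinate can be split off from the product. Translation invariance absorbs the
  origin \<open>p\<close>.\<close>

lemma nn_integral_hyperplane:
  fixes \<xi> :: "'a::euclidean_space"
  assumes \<xi>: "norm \<xi> = 1" and f[measurable]: "f \<in> borel_measurable borel"
  shows "(\<integral>\<^sup>+x. f x \<partial>lborel) = (\<integral>\<^sup>+v. (\<integral>\<^sup>+z. f (v + z *\<^sub>R \<xi>) \<partial>lborel) \<partial>plane_lborel {x. x \<bullet> \<xi> = t})"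
proof -
  obtain p B where p: "p \<bullet> \<xi> = t" and B: "orthonormal_basis_of {x. x \<bullet> \<xi> = 0} B"
    and eq: "plane_lborel {x. x \<bullet> \<xi> = t} = distr (Pi\<^sub>M B (\<lambda>_. lborel)) borel (\<lambda>f. p + (\<Sum>b\<in>B. f b *\<^sub>R b))"
    by (rule plane_lborel_hyperplane[OF \<xi>])
  note B' = orthonormal_basis_of_hyperplane[OF \<xi> B]
  note fin = orthonormal_finite[OF B]
  interpret product_sigma_finite "\<lambda>_. lborel::real measure" ..
  have [measurable]: "(\<lambda>f. p + (\<Sum>b\<in>B. f b *\<^sub>R b)) \<in> borel_measurable (Pi\<^sub>M B (\<lambda>_. lborel))"
    "(\<lambda>f. (\<Sum>b\<in>insert \<xi> B. f b *\<^sub>R b)) \<in> borel_measurable (Pi\<^sub>M (insert \<xi> B) (\<lambda>_. lborel))"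
    by measurable
  have s: "p + (\<Sum>b\<in>insert \<xi> B. (if b = \<xi> then y else x b) *\<^sub>R b) = p + (\<Sum>b\<in>B. x b *\<^sub>R b) + y *\<^sub>R \<xi>" for x y
  proof -
    have "(\<Sum>b\<in>B. (if b = \<xi> then y else x b) *\<^sub>R b) = (\<Sum>b\<in>B. x b *\<^sub>R b)"
      using B'(1) by (intro sum.cong) auto
    then show ?thesis using fin B'(1) by (simp add: algebra_simps)
  qed
  have "(\<integral>\<^sup>+x. f x \<partial>lborel) = (\<integral>\<^sup>+x. f (p + x) \<partial>lborel)"
    by (subst lborel_distr_plus[of p, symmetric]) (simp add: nn_integral_distr)
  also have "\<dots> = (\<integral>\<^sup>+g. f (p + (\<Sum>b\<in>insert \<xi> B. g b *\<^sub>R b)) \<partial>Pi\<^sub>M (insert \<xi> B) (\<lambda>_. lborel))"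
    by (subst lborel_orthonormal_basis[OF B'(2), symmetric]) (subst nn_integral_distr, auto)
  also have "\<dots> = (\<integral>\<^sup>+g. (\<integral>\<^sup>+z. f (p + (\<Sum>b\<in>B. g b *\<^sub>R b) + z *\<^sub>R \<xi>) \<partial>lborel) \<partial>Pi\<^sub>M B (\<lambda>_. lborel))"
    by (subst product_nn_integral_insert[OF fin B'(1)]) (auto simp: s fun_upd_def)
  also have "\<dots> = (\<integral>\<^sup>+v. (\<integral>\<^sup>+z. f (v + z *\<^sub>R \<xi>) \<partial>lborel) \<partial>plane_lborel {x. x \<bullet> \<xi> = t})"
    unfolding eq by (subst nn_integral_distr) auto
  finally show ?thesis .
qed

text \<open>A cylinder of height \<open>h\<close> over \<open>S\<close>. With \<open>h = 1\<close>
  it reduces finiteness and null sets on the plane to those of \<open>lborel\<close>.\<close>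

lemma emeasure_plane_lborel:
  fixes \<xi> :: "'a::euclidean_space"
  assumes \<xi>: "norm \<xi> = 1" and [measurable]: "S \<in> sets borel" and "0 \<le> h"
  shows "ennreal h * emeasure (plane_lborel {x. x \<bullet> \<xi> = t}) S =
    emeasure lborel {x. x - (x \<bullet> \<xi> - t) *\<^sub>R \<xi> \<in> S \<and> x \<bullet> \<xi> \<in> {t..t+h}}"
proof -
  let ?X = "{x. x - (x \<bullet> \<xi> - t) *\<^sub>R \<xi> \<in> S \<and> x \<bullet> \<xi> \<in> {t..t+h}}"
  have [measurable]: "?X \<in> sets borel" by measurable
  have "emeasure lborel ?X = (\<integral>\<^sup>+v. (\<integral>\<^sup>+z. indicator ?X (v + z *\<^sub>R \<xi>) \<partial>lborel) \<partial>plane_lborel {x. x \<bullet> \<xi> = t})"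
    using nn_integral_hyperplane[OF \<xi>, of "indicator ?X" t] by simp
  also have "\<dots> = (\<integral>\<^sup>+v. ennreal h * indicator S v \<partial>plane_lborel {x. x \<bullet> \<xi> = t})"
  proof (rule nn_integral_cong_AE, use AE_plane_lborel_hyperplane[OF \<xi>, of t] in eventually_elim)
    case (elim v)
    have "indicator ?X (v + z *\<^sub>R \<xi>) = (indicator S v * indicator {0..h} z :: ennreal)" for z
      using elim \<xi> by (auto simp: indicator_def inner_add_left dot_square_norm)
    then show ?case
      using \<open>0 \<le> h\<close> by (simp add: nn_integral_cmult mult.commute)
  qed
  also have "\<dots> = ennreal h * emeasure (plane_lborel {x. x \<bullet> \<xi> = t}) S"
    by (simp add: nn_integral_cmult)
  finally show ?thesis ..
qed

lemma emeasure_plane_lborel_finite: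
  fixes \<xi> :: "'a::euclidean_space"
  assumes \<xi>: "norm \<xi> = 1" and [measurable]: "S \<in> sets borel" and "bounded S"
  shows "emeasure (plane_lborel {x. x \<bullet> \<xi> = t}) S < \<infinity>"
proof -
  obtain R where R: "\<And>x. x \<in> S \<Longrightarrow> norm x \<le> R"
    using \<open>bounded S\<close> by (auto simp: bounded_iff)
  have "norm x \<le> R + (\<bar>t\<bar> + 1 + \<bar>t\<bar>)" if "x - (x \<bullet> \<xi> - t) *\<^sub>R \<xi> \<in> S" "x \<bullet> \<xi> \<in> {t..t+1}" for x
  proof -
    have "norm x \<le> norm (x - (x \<bullet> \<xi> - t) *\<^sub>R \<xi>) + norm ((x \<bullet> \<xi> - t) *\<^sub>R \<xi>)"
      by (metis diff_add_cancel norm_triangle_ineq)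
    then show ?thesis using R[OF that(1)] that(2) \<xi> by auto
  qed
  then have "bounded {x. x - (x \<bullet> \<xi> - t) *\<^sub>R \<xi> \<in> S \<and> x \<bullet> \<xi> \<in> {t..t+1}}"
    unfolding bounded_iff by blast
  from emeasure_bounded_finite[OF this] show ?thesis
    using emeasure_plane_lborel[OF \<xi>, of S 1 t] by simp
qed

lemma sigma_finite_plane_lborel:
  fixes \<xi> :: "'a::euclidean_space"
  assumes \<xi>: "norm \<xi> = 1"
  shows "sigma_finite_measure (plane_lborel {x. x \<bullet> \<xi> = t})"
  using emeasure_plane_lborel_finite[OF \<xi>] by (intro sigma_finite_measure_cballI) auto

lemma pair_sigma_finite_plane_lborel:
  fixes \<xi> :: "'a::euclidean_space"
  assumes \<xi>: "norm \<xi> = 1"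
  shows "pair_sigma_finite (plane_lborel {x. x \<bullet> \<xi> = t}) lborel"
  using sigma_finite_plane_lborel[OF \<xi>] sigma_finite_lborel by (rule pair_sigma_finite.intro)

text \<open>Fubini as an identity of measures, which makes it available for almost-everywhere
  statements and for vector-valued integrals too.\<close>

lemma distr_pair_plane_lborel:
  fixes \<xi> :: "'a::euclidean_space"
  assumes \<xi>: "norm \<xi> = 1"
  shows "distr (plane_lborel {x. x \<bullet> \<xi> = t} \<Otimes>\<^sub>M lborel) borel (\<lambda>(v, z). v + z *\<^sub>R \<xi>) = lborel"
proof (rule measure_eqI)
  fix X assume "X \<in> sets (distr (plane_lborel {x. x \<bullet> \<xi> = t} \<Otimes>\<^sub>M lborel) borel (\<lambda>(v, z). v + z *\<^sub>R \<xi>))"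
  then have [measurable]: "X \<in> sets borel" by simp
  interpret sigma_finite_measure "lborel::real measure" ..
  have [measurable]: "(\<lambda>(v, z). v + z *\<^sub>R \<xi>) \<in> borel_measurable (plane_lborel {x. x \<bullet> \<xi> = t} \<Otimes>\<^sub>M lborel)"
    by measurable
  have "emeasure (distr (plane_lborel {x. x \<bullet> \<xi> = t} \<Otimes>\<^sub>M lborel) borel (\<lambda>(v, z). v + z *\<^sub>R \<xi>)) X =
    (\<integral>\<^sup>+y. indicator X y \<partial>distr (plane_lborel {x. x \<bullet> \<xi> = t} \<Otimes>\<^sub>M lborel) borel (\<lambda>(v, z). v + z *\<^sub>R \<xi>))"
    by simp
  also have "\<dots> = (\<integral>\<^sup>+p. indicator X (fst p + snd p *\<^sub>R \<xi>) \<partial>(plane_lborel {x. x \<bullet> \<xi> = t} \<Otimes>\<^sub>M lborel))"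
    by (subst nn_integral_distr) (auto simp: split_beta)
  also have "\<dots> = (\<integral>\<^sup>+v. (\<integral>\<^sup>+z. indicator X (v + z *\<^sub>R \<xi>) \<partial>lborel) \<partial>plane_lborel {x. x \<bullet> \<xi> = t})"
    by (subst sigma_finite_measure.nn_integral_fst[OF sigma_finite_lborel, symmetric]) auto
  also have "\<dots> = emeasure lborel X"
    using nn_integral_hyperplane[OF \<xi>, of "indicator X" t] by simp
  finally show "emeasure (distr (plane_lborel {x. x \<bullet> \<xi> = t} \<Otimes>\<^sub>M lborel) borel (\<lambda>(v, z). v + z *\<^sub>R \<xi>)) X = emeasure lborel X" .
qed simp

subsection \<open>Cutting planes\<close>

lemma frontier_convex_null_sets:
  fixes S :: "'a::euclidean_space set"
  assumes "convex S"
  shows "frontier S \<in> null_sets lborel"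
  using negligible_convex_frontier[OF assms] null_sets_completion_iff[of "frontier S" lborel]
  by (simp add: negligible_iff_null_sets)

lemma hyperplane_null_sets:
  fixes \<xi> :: "'a::euclidean_space"
  assumes "\<xi> \<noteq> 0"
  shows "{x. x \<bullet> \<xi> = t} \<in> null_sets lborel"
proof -
  have "{x. x \<bullet> \<xi> = t} \<in> sets lborel" by simp
  then show ?thesis
    using negligible_hyperplane[of \<xi> t] assms null_sets_completion_iff[of "{x. x \<bullet> \<xi> = t}" lborel]
    by (simp add: negligible_iff_null_sets inner_commute)
qed

text \<open>The cylinder \<open>C\<close> over the section is convex, so its frontier is null in the
  whole space. If \<open>v\<close> in the plane lies on the frontier of \<open>K\<close>, then the
  entire line through \<open>v\<close> in direction \<xi> lies in the frontier of \<open>C\<close>,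
  and by Fubini this happens for almost no \<open>v\<close>. The interior point \<open>z0\<close>
  excludes a plane that merely touches \<open>K\<close>.\<close>

lemma AE_plane_not_frontier:
  fixes \<xi> :: "'a::euclidean_space"
  assumes \<xi>: "norm \<xi> = 1" and K: "convex K" "closed K" and z0: "z0 \<in> interior K" "z0 \<bullet> \<xi> = t"
  shows "AE v in plane_lborel {x. x \<bullet> \<xi> = t}. v \<notin> frontier K"
proof -
  define \<pi> where "\<pi> x = x - (x \<bullet> \<xi> - t) *\<^sub>R \<xi>" for x
  define C where "C = \<pi> -` K"
  have aff: "\<pi> ((1 - u) *\<^sub>R x + u *\<^sub>R y) = (1 - u) *\<^sub>R \<pi> x + u *\<^sub>R \<pi> y" for x y u
    by (simp add: \<pi>_def algebra_simps)
  have "convex C"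
    unfolding convex_alt C_def using K(1) by (auto simp: aff convex_alt)
  then have "AE x in lborel. x \<notin> frontier C"
    using AE_not_in[OF frontier_convex_null_sets] by auto
  then have "AE x in distr (plane_lborel {x. x \<bullet> \<xi> = t} \<Otimes>\<^sub>M lborel) borel (\<lambda>(v, z). v + z *\<^sub>R \<xi>). x \<notin> frontier C"
    by (simp only: distr_pair_plane_lborel[OF \<xi>])
  then have "AE p in plane_lborel {x. x \<bullet> \<xi> = t} \<Otimes>\<^sub>M lborel. (\<lambda>(v, z). v + z *\<^sub>R \<xi>) p \<notin> frontier C"
  proof -
    have [measurable]: "frontier C \<in> sets borel" by simp
    have "{x. x \<notin> frontier C} \<in> sets borel" by measurable
    with \<open>AE x in distr _ _ _. x \<notin> frontier C\<close> show ?thesis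
      by (subst (asm) AE_distr_iff) auto
  qed
  then have "AE v in plane_lborel {x. x \<bullet> \<xi> = t}. AE z in lborel. v + z *\<^sub>R \<xi> \<notin> frontier C"
    using pair_sigma_finite.AE_pair[OF pair_sigma_finite_plane_lborel[OF \<xi>]] by fastforce
  then show ?thesis
    using AE_plane_lborel_hyperplane[OF \<xi>, of t]
  proof eventually_elim
    case (elim v)
    show ?case
    proof
      assume v: "v \<in> frontier K"
      have "v \<in> K" using v K(2) by (simp add: frontier_def)
      have \<pi>v: "\<pi> (v + z *\<^sub>R \<xi>) = v" for z
        using elim(2) \<xi> by (simp add: \<pi>_def algebra_simps dot_square_norm)
      have "v + z *\<^sub>R \<xi> \<in> frontier C" for z
      proof -
        have "v + z *\<^sub>R \<xi> \<in> C" using \<open>v \<in> K\<close> by (simp add: C_def \<pi>v)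
        moreover have "v + z *\<^sub>R \<xi> \<notin> interior C"
        proof
          assume "v + z *\<^sub>R \<xi> \<in> interior C"
          then obtain r where r: "r > 0" "ball (v + z *\<^sub>R \<xi>) r \<subseteq> C"
            by (meson mem_interior)
          \<comment> \<open>Small enough that extending the segment from \<open>z0\<close> to
            \<open>v\<close> by the factor \<open>l\<close> stays in the ball; the summand 1 covers
            \<open>v = z0\<close>. The extended endpoint \<open>x\<close> is in \<open>K\<close>, so
            \<open>v\<close> lies strictly between an interior point and a point of
            \<open>K\<close>, and is interior itself.\<close>
          define l where "l = r / (2 * (norm (v - z0) + 1))"
          have l: "l > 0" using r by (simp add: l_def add_nonneg_pos)
          define x where "x = v + l *\<^sub>R (v - z0)"
          have "l * norm (v - z0) < r"
          proof -
            have "l * norm (v - z0) \<le> l * (norm (v - z0) + 1)" using l by simp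
            also have "\<dots> = r / 2"
            proof -
              have "norm (v - z0) + 1 \<noteq> 0" using norm_ge_zero[of "v - z0"] by linarith
              then show ?thesis unfolding l_def by (metis nonzero_eq_divide_eq divide_divide_eq_left mult.commute)
            qed
            finally show ?thesis using r by simp
          qed
          then have "x + z *\<^sub>R \<xi> \<in> ball (v + z *\<^sub>R \<xi>) r"
            using l by (simp add: x_def dist_norm)
          then have "x + z *\<^sub>R \<xi> \<in> C" using r by blast
          moreover have "x \<bullet> \<xi> = t"
            using elim(2) z0 by (simp add: x_def inner_add_left inner_diff_left)
          ultimately have x: "x \<in> K"
            using \<xi> by (simp add: C_def \<pi>_def algebra_simps dot_square_norm)
          have "v \<in> interior K"
          proof (cases "v = z0")
            case False
            have "v = (1 - 1 / (1 + l)) *\<^sub>R z0 + (1 / (1 + l)) *\<^sub>R x"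
            proof -
              have "(1 + l) *\<^sub>R v = (1 + l) *\<^sub>R ((1 - 1 / (1 + l)) *\<^sub>R z0 + (1 / (1 + l)) *\<^sub>R x)"
                using l by (simp add: x_def scaleR_add_right scaleR_diff_right right_diff_distrib) (simp add: algebra_simps)
              then show ?thesis using l by (simp del: scaleR_add_right)
            qed
            moreover have "z0 \<noteq> x"
            proof
              assume "z0 = x"
              then have "(1 + l) *\<^sub>R (v - z0) = 0" by (simp add: x_def algebra_simps)
              then show False using False l by simp
            qed
            ultimately have "v \<in> open_segment z0 x"
              using l by (auto simp: in_segment intro!: exI[of _ "1 / (1 + l)"])
            then show ?thesis
              using in_interior_closure_convex_segment[OF K(1) z0(1), of x] x closure_subset by blast
          qed (use z0 in simp)
          then show False using v by (simp add: frontier_def)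
        qed
        ultimately show ?thesis using closure_subset by (auto simp: frontier_def)
      qed
      then have "AE z in (lborel :: real measure). False" using elim(1) by simp
      then show False by (simp add: AE_iff_null null_sets_def)
    qed
  qed
qed

text \<open>A ball about \<open>z0\<close> inside \<open>K\<close> projects into itself, by
  Pythagoras. Were the section null, almost every line in direction \<xi> would miss this ball, and
  the ball would have volume 0.\<close>

lemma emeasure_plane_interior_pos:
  fixes \<xi> :: "'a::euclidean_space"
  assumes \<xi>: "norm \<xi> = 1" and K[measurable]: "K \<in> sets borel" and z0: "z0 \<in> interior K" "z0 \<bullet> \<xi> = t"
  shows "0 < emeasure (plane_lborel {x. x \<bullet> \<xi> = t}) K"
proof (rule ccontr)
  let ?M = "plane_lborel {x. x \<bullet> \<xi> = t}"
  assume "\<not> 0 < emeasure ?M K"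
  then have "K \<in> null_sets ?M" by (auto simp: null_sets_def)
  then have AE: "AE v in ?M. v \<notin> K" by (rule AE_not_in)
  obtain r where r: "r > 0" "ball z0 r \<subseteq> K" using z0 by (meson mem_interior)
  have "emeasure lborel (ball z0 r) = (\<integral>\<^sup>+v. (\<integral>\<^sup>+z. indicator (ball z0 r) (v + z *\<^sub>R \<xi>) \<partial>lborel) \<partial>?M)"
    using nn_integral_hyperplane[OF \<xi>, of "indicator (ball z0 r)" t]
    by (simp add: borel_measurable_indicator)
  also have "\<dots> = (\<integral>\<^sup>+v. 0 \<partial>?M)"
  proof (rule nn_integral_cong_AE, use AE AE_plane_lborel_hyperplane[OF \<xi>, of t] in eventually_elim)
    case (elim v)
    have "v + z *\<^sub>R \<xi> \<notin> ball z0 r" for z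
    proof
      assume "v + z *\<^sub>R \<xi> \<in> ball z0 r"
      then have "norm ((v - z0) + z *\<^sub>R \<xi>) < r" by (simp add: dist_norm norm_minus_commute algebra_simps)
      moreover have "(norm ((v - z0) + z *\<^sub>R \<xi>))\<^sup>2 = (norm (v - z0))\<^sup>2 + (norm (z *\<^sub>R \<xi>))\<^sup>2"
        using elim(2) z0 by (intro norm_add_Pythagorean) (simp add: orthogonal_def inner_diff_left)
      then have "(norm (v - z0))\<^sup>2 \<le> (norm ((v - z0) + z *\<^sub>R \<xi>))\<^sup>2"
        using zero_le_power2[of "norm (z *\<^sub>R \<xi>)"] by linarith
      then have "norm (v - z0) \<le> norm ((v - z0) + z *\<^sub>R \<xi>)"
        by (rule power2_le_imp_le) (rule norm_ge_zero)
      ultimately have "v \<in> ball z0 r" by (simp add: dist_norm norm_minus_commute)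
      then show False using r elim(1) by blast
    qed
    then show ?case by simp
  qed
  finally have "measure lborel (ball z0 r) = 0" by (simp add: measure_def)
  then show False using r by simp
qed

section \<open>The volume of a convex body below a level\<close>

locale cut_body =
  fixes K :: "'a::euclidean_space set" and \<delta> :: real
  assumes body: "convex_body K" and delta: "0 < \<delta>" "\<delta> < measure lborel K"
begin

lemma convex_K: "convex K" and compact_K: "compact K" and closed_K: "closed K"
  using body by (auto simp: convex_body_def compact_imp_closed)

lemma borel_K [measurable]: "K \<in> sets borel"
  using closed_K by simp

lemma emeasure_K: "emeasure lborel K < \<infinity>"
  using compact_K compact_imp_bounded emeasure_bounded_finite by blast

lemma fmeasurable_subset_K:
  assumes "A \<in> sets borel" "A \<subseteq> K"
  shows "A \<in> fmeasurable lborel"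
  using emeasure_mono[of A K lborel] emeasure_K assms by (auto intro: fmeasurableI)

lemma obtain_bound:
  obtains R where "0 < R" "\<And>x. x \<in> K \<Longrightarrow> norm x \<le> R"
  using compact_imp_bounded[OF compact_K] bounded_pos by metis

definition vol :: "'a \<Rightarrow> real \<Rightarrow> real" where
  "vol \<xi> t = measure lborel (K \<inter> {p. p \<bullet> \<xi> \<le> t})"

lemma vol_mono: "s \<le> t \<Longrightarrow> vol \<xi> s \<le> vol \<xi> t"
  unfolding vol_def by (intro measure_mono_fmeasurable fmeasurable_subset_K) auto

lemma interior_below:
  assumes "\<xi> \<noteq> 0" "0 < vol \<xi> t"
  obtains x where "x \<in> interior K" "x \<bullet> \<xi> < t"
proof -
  have "\<exists>x\<in>interior K. x \<bullet> \<xi> < t"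
  proof (rule ccontr)
    assume "\<not> (\<exists>x\<in>interior K. x \<bullet> \<xi> < t)"
    then have "K \<inter> {p. p \<bullet> \<xi> \<le> t} \<subseteq> frontier K \<union> {x. x \<bullet> \<xi> = t}"
      using closure_subset[of K] by (force simp: frontier_def)
    moreover have "frontier K \<union> {x. x \<bullet> \<xi> = t} \<in> null_sets lborel"
      using frontier_convex_null_sets[OF convex_K] hyperplane_null_sets[OF assms(1)] by blast
    ultimately have "K \<inter> {p. p \<bullet> \<xi> \<le> t} \<in> null_sets lborel"
      by (rule null_sets_subset[rotated 2]) auto
    then show False using assms(2) by (simp add: vol_def measure_def null_sets_def)
  qed
  then show ?thesis using that by blast
qed

lemma interior_above:
  assumes "vol \<xi> t < measure lborel K"
  obtains x where "x \<in> interior K" "t < x \<bullet> \<xi>"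
proof -
  have "\<exists>x\<in>interior K. t < x \<bullet> \<xi>"
  proof (rule ccontr)
    assume "\<not> (\<exists>x\<in>interior K. t < x \<bullet> \<xi>)"
    then have sub: "K - (K \<inter> {p. p \<bullet> \<xi> \<le> t}) \<subseteq> frontier K"
      using closure_subset[of K] by (force simp: frontier_def)
    have "AE x in lborel. x \<notin> frontier K"
      by (rule AE_not_in[OF frontier_convex_null_sets[OF convex_K]])
    then have "measure lborel K = measure lborel (K \<inter> {p. p \<bullet> \<xi> \<le> t})"
      by (intro measure_eq_AE) (use sub in \<open>auto elim!: eventually_mono\<close>)
    then show False using assms by (simp add: vol_def)
  qed
  then show ?thesis using that by blast
qed

text \<open>The two volume conditions give interior points below \<open>s\<close> and above
  \<open>t\<close>; the segment between them stays in the convex interior and crosses every level in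
  between.\<close>

lemma interior_level:
  assumes "\<xi> \<noteq> 0" "0 < vol \<xi> s" "vol \<xi> t < measure lborel K" "s \<le> c" "c \<le> t"
  obtains x where "x \<in> interior K" "x \<bullet> \<xi> = c"
proof -
  obtain x where x: "x \<in> interior K" "x \<bullet> \<xi> < s" using interior_below assms by metis
  obtain y where y: "y \<in> interior K" "t < y \<bullet> \<xi>" using interior_above assms by metis
  define u where "u = (c - x \<bullet> \<xi>) / (y \<bullet> \<xi> - x \<bullet> \<xi>)"
  have u: "0 \<le> u" "u \<le> 1" using x y assms by (auto simp: u_def divide_simps)
  have "(1 - u) *\<^sub>R x + u *\<^sub>R y \<in> interior K"
    using convex_interior[OF convex_K] x y u by (simp add: convex_alt)
  moreover have "((1 - u) *\<^sub>R x + u *\<^sub>R y) \<bullet> \<xi> = x \<bullet> \<xi> + u * (y \<bullet> \<xi> - x \<bullet> \<xi>)"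
    by (simp add: inner_add_left algebra_simps)
  then have "((1 - u) *\<^sub>R x + u *\<^sub>R y) \<bullet> \<xi> = c" using x y assms by (simp add: u_def)
  ultimately show ?thesis using that by blast
qed

text \<open>The volume conditions keep the levels within the heights that \<open>K\<close> attains,
  outside of which \<open>vol\<close> is constant. The open slab between the levels then contains an
  interior point, hence an open set of positive volume.\<close>

lemma vol_strict_mono:
  assumes \<xi>: "\<xi> \<noteq> 0" and "0 < vol \<xi> s" "vol \<xi> t < measure lborel K" "s < t"
  shows "vol \<xi> s < vol \<xi> t"
proof -
  obtain z where z: "z \<in> interior K" "z \<bullet> \<xi> = (s + t) / 2"
    using interior_level[of \<xi> s t "(s + t) / 2"] assms by auto
  define U where "U = interior K \<inter> ({p. s < p \<bullet> \<xi>} \<inter> {p. p \<bullet> \<xi> < t})"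
  have "open U" unfolding U_def
    using open_halfspace_gt[of s \<xi>] open_halfspace_lt[of \<xi> t]
    by (intro open_Int open_interior) (auto simp: inner_commute)
  moreover have "z \<in> U" using z assms by (simp add: U_def)
  ultimately have "0 < emeasure lborel U"
    using open_not_negligible[of U] null_sets_completion_iff[of U lborel]
    by (auto simp: negligible_iff_null_sets null_sets_def zero_less_iff_neq_zero)
  moreover have U: "U \<in> fmeasurable lborel"
    using \<open>open U\<close> interior_subset[of K] by (intro fmeasurable_subset_K) (auto simp: U_def)
  ultimately have "0 < measure lborel U"
    by (simp add: measure_def enn2real_positive_iff fmeasurable_def)
  have "vol \<xi> s + measure lborel U = measure lborel ((K \<inter> {p. p \<bullet> \<xi> \<le> s}) \<union> U)"
    unfolding vol_def using U fmeasurable_subset_K[of "K \<inter> {p. p \<bullet> \<xi> \<le> s}"]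
    by (intro measure_Union[symmetric]) (auto simp: U_def fmeasurable_def)
  also have "\<dots> \<le> vol \<xi> t"
    unfolding vol_def using U interior_subset[of K] assms(4)
    by (intro measure_mono_fmeasurable fmeasurable_subset_K) (auto simp: U_def fmeasurable_def)
  finally show ?thesis using \<open>0 < measure lborel U\<close> by simp
qed

text \<open>Off the null plane at level \<open>t\<close> the indicators are eventually constant, so
  dominated convergence applies. Continuity feeds the intermediate value theorem for the existence
  of the cutting level.\<close>

lemma isCont_vol:
  assumes "\<xi> \<noteq> 0"
  shows "isCont (vol \<xi>) t"
  unfolding continuous_at_sequentially comp_def
proof (intro allI impI)
  fix X assume X: "X \<longlonglongrightarrow> t"
  have vol: "vol \<xi> s = (LINT x|lborel. indicator (K \<inter> {p. p \<bullet> \<xi> \<le> s}) x :: real)" for s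
    by (simp add: vol_def)
  show "(\<lambda>n. vol \<xi> (X n)) \<longlonglongrightarrow> vol \<xi> t"
    unfolding vol
  proof (rule integral_dominated_convergence[where w = "indicator K"])
    show "AE x in lborel. (\<lambda>n. indicator (K \<inter> {p. p \<bullet> \<xi> \<le> X n}) x :: real) \<longlonglongrightarrow> indicator (K \<inter> {p. p \<bullet> \<xi> \<le> t}) x"
      using AE_not_in[OF hyperplane_null_sets[OF assms, of t]]
    proof eventually_elim
      case (elim x)
      have "\<forall>\<^sub>F n in sequentially. (x \<bullet> \<xi> \<le> X n) = (x \<bullet> \<xi> \<le> t)"
      proof (cases "x \<bullet> \<xi> < t")
        case True
        then show ?thesis using order_tendstoD(1)[OF X True] by (auto elim!: eventually_mono)
      next
        case False
        have "t < x \<bullet> \<xi>" using False elim by simp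
        show ?thesis
          using order_tendstoD(2)[OF X \<open>t < x \<bullet> \<xi>\<close>]
          by eventually_elim (use \<open>t < x \<bullet> \<xi>\<close> in auto)
      qed
      then have "\<forall>\<^sub>F n in sequentially. indicator (K \<inter> {p. p \<bullet> \<xi> \<le> t}) x = (indicator (K \<inter> {p. p \<bullet> \<xi> \<le> X n}) x :: real)"
        by eventually_elim (auto simp: indicator_def)
      then show ?case by (rule tendsto_eventually[OF eventually_mono]) simp
    qed
    show "integrable lborel (indicator K :: 'a \<Rightarrow> real)"
      using emeasure_K by (intro integrable_real_indicator) auto
  qed (auto simp: indicator_def)
qed

lemma vol_level_unique:
  assumes "\<xi> \<noteq> 0" "vol \<xi> s = \<delta>" "vol \<xi> t = \<delta>"
  shows "s = t"
  using vol_strict_mono[of \<xi> s t] vol_strict_mono[of \<xi> t s] assms delta by force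

lemma vol_level_exists:
  assumes "\<xi> \<noteq> 0"
  shows "\<exists>t. vol \<xi> t = \<delta>"
proof -
  obtain R where R: "0 < R" "\<And>x. x \<in> K \<Longrightarrow> norm x \<le> R" using obtain_bound by blast
  have b: "\<bar>x \<bullet> \<xi>\<bar> \<le> R * norm \<xi>" if "x \<in> K" for x
    using Cauchy_Schwarz_ineq2[of x \<xi>] mult_right_mono[OF R(2)[OF that], of "norm \<xi>"] by simp
  let ?B = "R * norm \<xi> + 1"
  have "K \<inter> {p. p \<bullet> \<xi> \<le> - ?B} = {}" using b by force
  then have "vol \<xi> (- ?B) \<le> \<delta>" using delta by (simp add: vol_def)
  moreover have "K \<inter> {p. p \<bullet> \<xi> \<le> ?B} = K" using b by force
  then have "\<delta> \<le> vol \<xi> ?B" using delta by (simp add: vol_def)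
  moreover have "- ?B \<le> ?B" using R by simp
  ultimately show ?thesis
    using IVT'[of "vol \<xi>" "- ?B" \<delta> ?B] isCont_vol[OF assms] by (auto intro: continuous_at_imp_continuous_on)
qed

lemma vol_cut_level:
  assumes "\<xi> \<noteq> 0"
  shows "vol \<xi> (cut_level K \<delta> \<xi>) = \<delta>"
proof -
  have "\<exists>!t. vol \<xi> t = \<delta>" using vol_level_exists vol_level_unique assms by blast
  from theI'[OF this] show ?thesis by (simp add: cut_level_def vol_def)
qed

lemma cut_plane_meets_interior:
  assumes "\<xi> \<noteq> 0"
  obtains z where "z \<in> interior K" "z \<bullet> \<xi> = cut_level K \<delta> \<xi>"
  using interior_level[of \<xi> "cut_level K \<delta> \<xi>" "cut_level K \<delta> \<xi>" "cut_level K \<delta> \<xi>"]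
    vol_cut_level[OF assms] delta assms by auto

end

subsection \<open>Tilting a cutting plane\<close>

text \<open>The difference of indicators is the signed indicator of the interval between 0 and
  \<open>w\<close>. Rescaling to the unit interval treats both signs of \<open>w\<close> alike and
  exposes the factor \<open>w\<close>, which is to be divided by the slope of the tilt.\<close>

lemma integral_signed_interval:
  fixes f :: "real \<Rightarrow> 'b::{banach, second_countable_topology}"
  assumes f[measurable]: "f \<in> borel_measurable borel"
  shows "(LINT z|lborel. (indicator {..w} z - indicator {..0} z) *\<^sub>R f z) =
    w *\<^sub>R (LINT l|lborel. indicator {0..1} l *\<^sub>R f (l * w))"
proof (cases "w = 0")
  case False
  have "(LINT z|lborel. (indicator {..w} z - indicator {..0} z) *\<^sub>R f z) =
    \<bar>w\<bar> *\<^sub>R (LINT l|lborel. (indicator {..w} (l * w) - indicator {..0} (l * w)) *\<^sub>R f (l * w))"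
    using lborel_integral_real_affine[OF False, of "\<lambda>z. (indicator {..w} z - indicator {..0} z) *\<^sub>R f z" 0]
    by (simp add: mult.commute)
  also have "(LINT l|lborel. (indicator {..w} (l * w) - indicator {..0} (l * w)) *\<^sub>R f (l * w)) =
    (LINT l|lborel. sgn w *\<^sub>R (indicator {0..1} l *\<^sub>R f (l * w)))"
  proof (rule integral_cong_AE)
    show "AE l in lborel. (indicator {..w} (l * w) - indicator {..0} (l * w)) *\<^sub>R f (l * w) =
        sgn w *\<^sub>R (indicator {0..1} l *\<^sub>R f (l * w))"
      \<comment> \<open>The half-lines differ by half-open intervals, so the endpoints of the unit
        interval are excepted.\<close>
      using AE_lborel_singleton[of 0] AE_lborel_singleton[of 1]
    proof eventually_elim
      case (elim l)
      have "indicator {..w} (l * w) - indicator {..0} (l * w) = sgn w * (indicator {0..1} l :: real)"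
      proof (cases "w > 0")
        case True
        have "l * w \<le> w \<longleftrightarrow> l \<le> 1" "l * w \<le> 0 \<longleftrightarrow> l \<le> 0"
          using True by (auto simp: mult_le_0_iff)
        then show ?thesis using True elim by (auto simp: indicator_def)
      next
        case False
        with \<open>w \<noteq> 0\<close> have w: "w < 0" by simp
        have "l * w \<le> w \<longleftrightarrow> 1 \<le> l" "l * w \<le> 0 \<longleftrightarrow> 0 \<le> l"
          using w by (auto simp: mult_le_0_iff)
        then show ?thesis using w elim by (auto simp: indicator_def)
      qed
      then show ?case by simp
    qed
  qed measurable
  also have "\<bar>w\<bar> *\<^sub>R \<dots> = (\<bar>w\<bar> * sgn w) *\<^sub>R (LINT l|lborel. indicator {0..1} l *\<^sub>R f (l * w))"
    by (simp only: integral_scaleR_right) (simp only: scaleR_scaleR)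
  finally show ?thesis by (simp only: abs_mult_sgn)
qed simp

text \<open>As \<eta> is orthogonal to \<xi>, the height \<open>a - e * (x \<bullet> \<eta>)\<close>
  is constant along each line in direction \<xi>. On the line through \<open>v\<close> the two
  half-spaces therefore differ by a signed segment of that length.\<close>

lemma integral_tilted_difference:
  fixes \<xi> :: "'a::euclidean_space" and G :: "'a \<Rightarrow> 'b::{banach, second_countable_topology}"
  assumes \<xi>: "norm \<xi> = 1" and \<eta>: "\<eta> \<bullet> \<xi> = 0" and G: "integrable lborel G"
  shows "(LINT x|lborel. (indicator {x. x \<bullet> \<xi> - t \<le> a - e * (x \<bullet> \<eta>)} x - indicator {x. x \<bullet> \<xi> \<le> t} x) *\<^sub>R G x) =
    (LINT v|plane_lborel {x. x \<bullet> \<xi> = t}. (a - e * (v \<bullet> \<eta>)) *\<^sub>R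
      (LINT l|lborel. indicator {0..1} l *\<^sub>R G (v + (l * (a - e * (v \<bullet> \<eta>))) *\<^sub>R \<xi>)))"
proof -
  let ?M = "plane_lborel {x. x \<bullet> \<xi> = t}"
  let ?S = "{x. x \<bullet> \<xi> - t \<le> a - e * (x \<bullet> \<eta>)}" let ?T = "{x. x \<bullet> \<xi> \<le> t}"
  interpret pair_sigma_finite ?M lborel by (rule pair_sigma_finite_plane_lborel[OF \<xi>])
  have [measurable]: "G \<in> borel_measurable borel"
    using borel_measurable_integrable[OF G] by simp
  have [measurable]: "?S \<in> sets borel" "?T \<in> sets borel" by measurable
  define H where "H x = (indicator ?S x - indicator ?T x) *\<^sub>R G x" for x
  have H[measurable]: "H \<in> borel_measurable borel"
    unfolding H_def by measurable
  have "integrable lborel H"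
    unfolding H_def scaleR_diff_left
    by (intro Bochner_Integration.integrable_diff integrable_mult_indicator G) auto
  then have int: "integrable (?M \<Otimes>\<^sub>M lborel) (\<lambda>p. H ((\<lambda>(v, z). v + z *\<^sub>R \<xi>) p))"
    by (subst integrable_distr_eq[symmetric, where N = borel]) (auto simp: distr_pair_plane_lborel[OF \<xi>])
  have "integral\<^sup>L lborel H = (LINT p|(?M \<Otimes>\<^sub>M lborel). H ((\<lambda>(v, z). v + z *\<^sub>R \<xi>) p))"
    by (subst distr_pair_plane_lborel[OF \<xi>, of t, symmetric], subst integral_distr) auto
  also have "\<dots> = (LINT v|?M. LINT z|lborel. H (v + z *\<^sub>R \<xi>))"
    using integral_fst'[OF int] by simp
  also have "\<dots> = (LINT v|?M. (a - e * (v \<bullet> \<eta>)) *\<^sub>R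
      (LINT l|lborel. indicator {0..1} l *\<^sub>R G (v + (l * (a - e * (v \<bullet> \<eta>))) *\<^sub>R \<xi>)))"
  proof (rule integral_cong_AE)
    show "AE v in ?M. (LINT z|lborel. H (v + z *\<^sub>R \<xi>)) = (a - e * (v \<bullet> \<eta>)) *\<^sub>R
      (LINT l|lborel. indicator {0..1} l *\<^sub>R G (v + (l * (a - e * (v \<bullet> \<eta>))) *\<^sub>R \<xi>))"
      using AE_plane_lborel_hyperplane[OF \<xi>, of t]
    proof eventually_elim
      case (elim v)
      have "H (v + z *\<^sub>R \<xi>) = (indicator {..a - e * (v \<bullet> \<eta>)} z - indicator {..0} z) *\<^sub>R G (v + z *\<^sub>R \<xi>)" for z
      proof -
        have "(v + z *\<^sub>R \<xi>) \<bullet> \<xi> = t + z" "(v + z *\<^sub>R \<xi>) \<bullet> \<eta> = v \<bullet> \<eta>"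
          using elim \<xi> \<eta> by (simp_all add: inner_add_left dot_square_norm inner_commute[of \<xi> \<eta>])
        then have "v + z *\<^sub>R \<xi> \<in> ?S \<longleftrightarrow> z \<in> {..a - e * (v \<bullet> \<eta>)}" "v + z *\<^sub>R \<xi> \<in> ?T \<longleftrightarrow> z \<in> {..0}"
          by auto
        then show ?thesis unfolding H_def indicator_def by (simp only:)
      qed
      then show ?case
        using integral_signed_interval[of "\<lambda>z. G (v + z *\<^sub>R \<xi>)" "a - e * (v \<bullet> \<eta>)"] by simp
    qed
  qed measurable
  finally show ?thesis unfolding H_def .
qed

text \<open>The inner integral is the average of \<open>indicator K x *\<^sub>R g x\<close> over the
  segment between the two planes above \<open>v\<close>. It tends to the value at \<open>v\<close>
  wherever this function is continuous, that is, off the frontier of \<open>K\<close>. The weights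
  \<open>h\<close> remain abstract because several are needed for the volume and for the first
  moment.\<close>

lemma tendsto_integral_tilted:
  fixes \<xi> :: "'a::euclidean_space" and g :: "'a \<Rightarrow> 'b::{banach, second_countable_topology}"
  assumes \<xi>: "norm \<xi> = 1" and K: "convex K" "compact K" and z0: "z0 \<in> interior K" "z0 \<bullet> \<xi> = t"
    and g: "continuous_on UNIV g"
    and ae: "a \<longlonglongrightarrow> 0" "e \<longlonglongrightarrow> 0"
    and h: "\<And>v. (\<lambda>n. h n v) \<longlonglongrightarrow> h' v" "\<And>n. h n \<in> borel_measurable borel" "h' \<in> borel_measurable borel"
    and hb: "\<And>r. \<exists>c. \<forall>n v. norm v \<le> r \<longrightarrow> \<bar>h n v :: real\<bar> \<le> c"
  shows "(\<lambda>n. LINT v|plane_lborel {x. x \<bullet> \<xi> = t}. h n v *\<^sub>R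
      (LINT l|lborel. indicator {0..1} l *\<^sub>R
        (\<lambda>x. indicator K x *\<^sub>R g x) (v + (l * (a n - e n * (v \<bullet> \<eta>))) *\<^sub>R \<xi>)))
    \<longlonglongrightarrow> (LINT v|plane_lborel {x. x \<bullet> \<xi> = t}. h' v *\<^sub>R (indicator K v *\<^sub>R g v))" (is ?lim)
    and "\<And>n. integrable (plane_lborel {x. x \<bullet> \<xi> = t}) (\<lambda>v. h n v *\<^sub>R
      (LINT l|lborel. indicator {0..1} l *\<^sub>R
        (\<lambda>x. indicator K x *\<^sub>R g x) (v + (l * (a n - e n * (v \<bullet> \<eta>))) *\<^sub>R \<xi>)))" (is "\<And>n. ?int n")
proof -
  let ?M = "plane_lborel {x. x \<bullet> \<xi> = t}"
  define G where "G x = indicator K x *\<^sub>R g x" for x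
  have [measurable]: "K \<in> sets borel" using K(2) by (simp add: compact_imp_closed)
  have [measurable]: "g \<in> borel_measurable borel"
    using g by (rule borel_measurable_continuous_onI)
  have [measurable]: "G \<in> borel_measurable borel" unfolding G_def by measurable
  note h(2)[measurable] h(3)[measurable]
  obtain R where R: "\<And>x. x \<in> K \<Longrightarrow> norm x \<le> R"
    using compact_imp_bounded[OF K(2)] by (auto simp: bounded_iff)
  have "compact (g ` K)" using K(2) g by (intro compact_continuous_image) (auto intro: continuous_on_subset)
  then obtain B where B: "0 < B" "\<And>x. x \<in> K \<Longrightarrow> norm (g x) \<le> B"
    using compact_imp_bounded bounded_pos by (metis image_eqI)
  have GB: "norm (G x) \<le> B" for x using B by (auto simp: G_def indicator_def)
  \<comment> \<open>If \<open>v + z *\<^sub>R \<xi>\<close> is in \<open>K\<close> and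
    \<open>v\<close> in the plane, then \<open>z\<close> is at most \<open>R + \<bar>t\<bar>\<close>
    in absolute value. So all averages vanish for \<open>v\<close> outside the ball of radius
    \<open>r\<close>, which gives an integrable bound.\<close>
  define r where "r = R + (R + \<bar>t\<bar>)"
  obtain c where c: "\<And>n v. norm v \<le> r \<Longrightarrow> \<bar>h n v\<bar> \<le> c" using hb by metis
  have supp: "norm v \<le> r" if "v + z *\<^sub>R \<xi> \<in> K" "v \<bullet> \<xi> = t" for v z
  proof -
    have "z = (v + z *\<^sub>R \<xi>) \<bullet> \<xi> - t" using that \<xi> by (simp add: inner_add_left dot_square_norm)
    moreover have "\<bar>(v + z *\<^sub>R \<xi>) \<bullet> \<xi>\<bar> \<le> R"
      using Cauchy_Schwarz_ineq2[of "v + z *\<^sub>R \<xi>" \<xi>] R[OF that(1)] \<xi> by simp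
    ultimately have "\<bar>z\<bar> \<le> R + \<bar>t\<bar>" by linarith
    moreover have "norm v \<le> norm (v + z *\<^sub>R \<xi>) + norm (z *\<^sub>R \<xi>)"
      by (metis add_diff_cancel norm_triangle_ineq4)
    ultimately show ?thesis using R[OF that(1)] \<xi> by (simp add: r_def)
  qed
  define w where "w n v = a n - e n * (v \<bullet> \<eta>)" for n v
  define A where "A n v = (LINT l|lborel. indicator {0..1} l *\<^sub>R G (v + (l * w n v) *\<^sub>R \<xi>))" for n v
  have [measurable]: "A n \<in> borel_measurable borel" for n
    unfolding A_def w_def by measurable
  have int01: "integrable lborel (\<lambda>l::real. indicator {0..1} l * B)" by simp
  have Ab: "norm (A n v) \<le> B" for n v
  proof -
    have "norm (A n v) \<le> (LINT l|lborel. norm (indicator {0..1} l *\<^sub>R G (v + (l * w n v) *\<^sub>R \<xi>)))"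
      unfolding A_def by (rule integral_norm_bound)
    also have "\<dots> \<le> (LINT l|lborel. indicator {0..1::real} l * B)"
    proof (rule integral_mono_AE'[OF int01])
      have "norm (indicator {0..1} l *\<^sub>R G (v + (l * w n v) *\<^sub>R \<xi>)) \<le> indicator {0..1} l * B" for l :: real
        using GB by (auto simp: indicator_def)
      then show "AE l in lborel. norm (indicator {0..1::real} l *\<^sub>R G (v + (l * w n v) *\<^sub>R \<xi>)) \<le> indicator {0..1} l * B"
        by simp
    qed (use B in \<open>auto simp: indicator_def\<close>)
    finally show ?thesis by simp
  qed
  have A0: "A n v = 0" if "v \<bullet> \<xi> = t" "r < norm v" for n v
  proof -
    have "G (v + z *\<^sub>R \<xi>) = 0" for z using supp[of v z] that by (auto simp: G_def indicator_def)
    then show ?thesis by (simp add: A_def)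
  qed
  have Alim: "(\<lambda>n. A n v) \<longlonglongrightarrow> G v" if "v \<notin> frontier K" for v
  proof -
    have cont: "isCont G v"
    proof (cases "v \<in> K")
      case True
      then have "v \<in> interior K" using that closure_subset by (auto simp: frontier_def)
      then have "\<forall>\<^sub>F x in nhds v. G x = g x"
        unfolding eventually_nhds using interior_subset[of K]
        by (intro exI[of _ "interior K"]) (auto simp: G_def indicator_def)
      then show ?thesis 
        using isCont_cong[of G g v] g by (simp add: continuous_on_eq_continuous_at)
    next
      case False
      then have "\<forall>\<^sub>F x in nhds v. G x = 0"
        unfolding eventually_nhds using compact_imp_closed[OF K(2)]
        by (intro exI[of _ "- K"]) (auto simp: G_def open_Compl)
      then show ?thesis using isCont_cong[of G "\<lambda>_. 0" v] by simp
    qed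
    have wn: "(\<lambda>n. w n v) \<longlonglongrightarrow> 0"
      unfolding w_def using tendsto_diff[OF ae(1) tendsto_mult_right[OF ae(2), of "v \<bullet> \<eta>"]] by simp
    have "(\<lambda>n. A n v) \<longlonglongrightarrow> (LINT l|lborel. indicator {0..1::real} l *\<^sub>R G v)"
      unfolding A_def
    proof (rule integral_dominated_convergence[OF _ _ int01])
      have "(\<lambda>n. indicator {0..1} l *\<^sub>R G (v + (l * w n v) *\<^sub>R \<xi>)) \<longlonglongrightarrow> indicator {0..1} l *\<^sub>R G v" for l :: real
      proof -
        have "(\<lambda>n. v + (l * w n v) *\<^sub>R \<xi>) \<longlonglongrightarrow> v + (l * 0) *\<^sub>R \<xi>"
          by (intro tendsto_intros wn)
        then have "(\<lambda>n. v + (l * w n v) *\<^sub>R \<xi>) \<longlonglongrightarrow> v" by simp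
        then show ?thesis using isCont_tendsto_compose[OF cont] by (intro tendsto_intros) blast
      qed
      then show "AE l in lborel. (\<lambda>n. indicator {0..1} l *\<^sub>R G (v + (l * w n v) *\<^sub>R \<xi>)) \<longlonglongrightarrow> indicator {0..1::real} l *\<^sub>R G v"
        by simp
      show "AE l in lborel. norm (indicator {0..1} l *\<^sub>R G (v + (l * w n v) *\<^sub>R \<xi>)) \<le> indicator {0..1::real} l * B" for n
        using GB by (auto simp: indicator_def)
    qed measurable
    then show ?thesis by simp
  qed
  have w: "integrable ?M (\<lambda>v. indicator (cball 0 r) v * (c * B))"
      using emeasure_plane_lborel_finite[OF \<xi>, of "cball 0 r" t]
      by (intro integrable_mult_left integrable_real_indicator) auto
  have lim: "AE v in ?M. (\<lambda>n. h n v *\<^sub>R A n v) \<longlonglongrightarrow> h' v *\<^sub>R G v"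
      using AE_plane_not_frontier[OF \<xi> K(1) compact_imp_closed[OF K(2)] z0]
      by eventually_elim (intro tendsto_intros h Alim)
  have bd: "AE v in ?M. norm (h n v *\<^sub>R A n v) \<le> indicator (cball 0 r) v * (c * B)" for n
      using AE_plane_lborel_hyperplane[OF \<xi>, of t]
    proof eventually_elim
      case (elim v)
      show ?case
      proof (cases "norm v \<le> r")
        case True
        then have "\<bar>h n v\<bar> * norm (A n v) \<le> c * B"
          using c[OF True, of n] by (intro mult_mono Ab) auto
        then show ?thesis using True by simp
      qed (use A0 elim in simp)
    qed
  have "(\<lambda>n. LINT v|?M. h n v *\<^sub>R A n v) \<longlonglongrightarrow> (LINT v|?M. h' v *\<^sub>R G v)"
    by (rule integral_dominated_convergence[OF _ _ w lim bd]) measurable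
  then show ?lim unfolding A_def w_def G_def .
  have "integrable ?M (\<lambda>v. h n v *\<^sub>R A n v)" for n
    by (rule integrable_dominated_convergence2[OF _ _ w lim bd]) measurable
  then show "?int n" for n unfolding A_def w_def G_def .
qed

section \<open>Tilting at constant submerged volume\<close>

context cut_body
begin

abbreviation section_lborel :: "'a \<Rightarrow> 'a measure" where
  "section_lborel \<xi> \<equiv> plane_lborel {x. x \<bullet> \<xi> = cut_level K \<delta> \<xi>}"

lemma integrable_section:
  fixes f :: "'a \<Rightarrow> 'b::{banach, second_countable_topology}"
  assumes \<xi>: "norm \<xi> = 1" and f: "continuous_on UNIV f"
  shows "integrable (section_lborel \<xi>) (\<lambda>v. indicator K v *\<^sub>R f v)"
proof -
  have [measurable]: "f \<in> borel_measurable borel" using f by (rule borel_measurable_continuous_onI)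
  have "compact (f ` K)" using compact_K f by (intro compact_continuous_image) (auto intro: continuous_on_subset)
  then obtain B where "\<And>x. x \<in> K \<Longrightarrow> norm (f x) \<le> B"
    using compact_imp_bounded bounded_pos by (metis image_eqI)
  then show ?thesis
    using emeasure_plane_lborel_finite[OF \<xi> borel_K compact_imp_bounded[OF compact_K]]
    by (intro integrableI_bounded_set_indicator[of _ _ _ B]) auto
qed

lemma integrable_body:
  fixes f :: "'a \<Rightarrow> 'b::{banach, second_countable_topology}"
  assumes f: "continuous_on UNIV f"
  shows "integrable lborel (\<lambda>v. indicator K v *\<^sub>R f v)"
proof -
  have [measurable]: "f \<in> borel_measurable borel" using f by (rule borel_measurable_continuous_onI)
  have "compact (f ` K)" using compact_K f by (intro compact_continuous_image) (auto intro: continuous_on_subset)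
  then obtain B where "\<And>x. x \<in> K \<Longrightarrow> norm (f x) \<le> B"
    using compact_imp_bounded bounded_pos by (metis image_eqI)
  then show ?thesis
    using emeasure_K by (intro integrableI_bounded_set_indicator[of _ _ _ B]) auto
qed

text \<open>If the tilted plane missed the old one inside \<open>K\<close>, the two volumes would differ.\<close>

lemma tilted_offset_le:
  assumes \<xi>: "\<xi> \<noteq> 0" and \<eta>: "norm \<eta> \<le> 1" and R: "\<And>x. x \<in> K \<Longrightarrow> norm x \<le> R"
    and vol: "measure lborel (K \<inter> {x. x \<bullet> \<xi> - cut_level K \<delta> \<xi> \<le> a - e * (x \<bullet> \<eta>)}) = \<delta>"
  shows "\<bar>a\<bar> \<le> \<bar>e\<bar> * R"
proof -
  let ?t = "cut_level K \<delta> \<xi>" let ?S = "{x. x \<bullet> \<xi> - ?t \<le> a - e * (x \<bullet> \<eta>)}"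
  have b: "\<bar>e * (x \<bullet> \<eta>)\<bar> \<le> \<bar>e\<bar> * R" if "x \<in> K" for x
  proof -
    have "\<bar>x \<bullet> \<eta>\<bar> \<le> norm x * norm \<eta>" by (rule Cauchy_Schwarz_ineq2)
    also have "\<dots> \<le> R * 1"
      using R[OF that] \<eta> norm_ge_zero[of x] by (intro mult_mono norm_ge_zero) linarith+
    finally show ?thesis by (simp add: abs_mult mult_left_mono)
  qed
  have [measurable]: "?S \<in> sets borel" by measurable
  have "\<not> \<bar>e\<bar> * R < a"
  proof
    assume less: "\<bar>e\<bar> * R < a"
    \<comment> \<open>On \<open>K\<close> the term \<open>e * (x \<bullet> \<eta>)\<close> is at
      most \<open>\<bar>e\<bar> * R\<close>, so the tilted part contains everything below the raised
      level. Two distinct levels would then have volume \<delta>.\<close>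
    have "vol \<xi> (?t + (a - \<bar>e\<bar> * R)) \<le> measure lborel (K \<inter> ?S)"
      unfolding vol_def using b by (intro measure_mono_fmeasurable fmeasurable_subset_K) (fastforce simp: abs_le_iff)+
    moreover have "vol \<xi> ?t \<le> vol \<xi> (?t + (a - \<bar>e\<bar> * R))" using less by (intro vol_mono) simp
    ultimately have "vol \<xi> (?t + (a - \<bar>e\<bar> * R)) = \<delta>" using vol vol_cut_level[OF \<xi>] by simp
    then show False using vol_level_unique[OF \<xi> vol_cut_level[OF \<xi>]] less by fastforce
  qed
  moreover have "\<not> a < - (\<bar>e\<bar> * R)"
  proof
    assume less: "a < - (\<bar>e\<bar> * R)"
    have "measure lborel (K \<inter> ?S) \<le> vol \<xi> (?t + (a + \<bar>e\<bar> * R))"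
      unfolding vol_def using b by (intro measure_mono_fmeasurable fmeasurable_subset_K) (fastforce simp: abs_le_iff)+
    moreover have "vol \<xi> (?t + (a + \<bar>e\<bar> * R)) \<le> vol \<xi> ?t" using less by (intro vol_mono) simp
    ultimately have "vol \<xi> (?t + (a + \<bar>e\<bar> * R)) = \<delta>" using vol vol_cut_level[OF \<xi>] by simp
    then show False using vol_level_unique[OF \<xi> vol_cut_level[OF \<xi>]] less by fastforce
  qed
  ultimately show ?thesis by linarith
qed

text \<open>Here \<beta> is the coordinate of the section's centroid in direction \<eta>. Constancy
  of the volume forces \<open>a n / e n\<close> to tend to \<beta>, which is the turning about the
  centroid; the change of the first moment, divided by \<open>e n\<close>, is then an integral with
  weights tending to \<open>\<beta> - v \<bullet> \<eta>\<close>.\<close>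

lemma tilted_moment_tendsto:
  fixes a e :: "nat \<Rightarrow> real"
  assumes \<xi>: "norm \<xi> = 1" and \<eta>: "norm \<eta> = 1" "\<eta> \<bullet> \<xi> = 0"
    and e: "e \<longlonglongrightarrow> 0" "\<And>n. e n \<noteq> 0"
    and vol: "\<And>n. measure lborel (K \<inter> {x. x \<bullet> \<xi> - cut_level K \<delta> \<xi> \<le> a n - e n * (x \<bullet> \<eta>)}) = \<delta>"
  defines "\<beta> \<equiv> (LINT v|section_lborel \<xi>. indicator K v *\<^sub>R (v \<bullet> \<eta>)) / (LINT v|section_lborel \<xi>. indicator K v)"
  shows "(\<lambda>n. (1 / e n) *\<^sub>R
      ((LINT x|lborel. indicator (K \<inter> {x. x \<bullet> \<xi> - cut_level K \<delta> \<xi> \<le> a n - e n * (x \<bullet> \<eta>)}) x *\<^sub>R x) -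
       (LINT x|lborel. indicator (K \<inter> {x. x \<bullet> \<xi> \<le> cut_level K \<delta> \<xi>}) x *\<^sub>R x)))
    \<longlonglongrightarrow> (LINT v|section_lborel \<xi>. (\<beta> - v \<bullet> \<eta>) *\<^sub>R (indicator K v *\<^sub>R v))"
proof -
  have nz: "\<xi> \<noteq> 0" using \<xi> by auto
  let ?t = "cut_level K \<delta> \<xi>" let ?M = "section_lborel \<xi>"
  let ?T = "{x. x \<bullet> \<xi> \<le> ?t}"
  define S where "S n = {x. x \<bullet> \<xi> - ?t \<le> a n - e n * (x \<bullet> \<eta>)}" for n
  note vol = vol[folded S_def]
  have [measurable]: "S n \<in> sets borel" for n unfolding S_def by measurable
  obtain R where R: "0 < R" "\<And>x. x \<in> K \<Longrightarrow> norm x \<le> R" using obtain_bound by blast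
  obtain z0 where z0: "z0 \<in> interior K" "z0 \<bullet> \<xi> = ?t" using cut_plane_meets_interior[OF nz] by blast
  \<comment> \<open>This makes the offsets tend to 0, and it bounds the quotients \<open>b n\<close>
    uniformly, as the domination of the weights requires.\<close>
  have ab: "\<bar>a n\<bar> \<le> \<bar>e n\<bar> * R" for n
    using tilted_offset_le[OF nz _ R(2) vol[unfolded S_def]] \<eta> by simp
  have a0: "a \<longlonglongrightarrow> 0"
  proof (rule tendsto_rabs_zero_cancel, rule tendsto_sandwich[of "\<lambda>_. 0" _ _ "\<lambda>n. \<bar>e n\<bar> * R"])
    show "(\<lambda>n. \<bar>e n\<bar> * R) \<longlonglongrightarrow> 0"
      using tendsto_mult_right[OF tendsto_rabs_zero[OF e(1)], of R] by simp
  qed (use ab in auto)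
  define A1 where "A1 n v = (LINT l|lborel. indicator {0..1::real} l *\<^sub>R
    (indicator K (v + (l * (a n - e n * (v \<bullet> \<eta>))) *\<^sub>R \<xi>) *\<^sub>R (1::real)))" for n v
  define A2 where "A2 n v = (LINT l|lborel. indicator {0..1::real} l *\<^sub>R
    (indicator K (v + (l * (a n - e n * (v \<bullet> \<eta>))) *\<^sub>R \<xi>) *\<^sub>R (v + (l * (a n - e n * (v \<bullet> \<eta>))) *\<^sub>R \<xi>)))" for n v
  define b where "b n = a n / e n" for n
  have bb: "\<bar>b n\<bar> \<le> R" for n
    using ab[of n] e(2)[of n] by (simp add: b_def abs_divide pos_divide_le_eq mult.commute)
  note tilt = tendsto_integral_tilted[OF \<xi> convex_K compact_K z0 _ a0 e(1), where \<eta> = \<eta>]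
  have hbound: "\<exists>c. \<forall>n v. norm v \<le> r \<longrightarrow> \<bar>x n - v \<bullet> \<eta>\<bar> \<le> c" if "\<And>n. \<bar>x n\<bar> \<le> R" for r and x :: "nat \<Rightarrow> real"
  proof (intro exI[of _ "R + r"] allI impI)
    fix n and v :: 'a assume "norm v \<le> r"
    then show "\<bar>x n - v \<bullet> \<eta>\<bar> \<le> R + r"
      using that[of n] Cauchy_Schwarz_ineq2[of v \<eta>] \<eta>(1) by simp
  qed
  have I1: "integrable ?M (\<lambda>v. 1 *\<^sub>R A1 n v)" for n
    unfolding A1_def by (rule tilt(2)) (auto intro!: exI[of _ 1])
  have L1: "(\<lambda>n. LINT v|?M. 1 *\<^sub>R A1 n v) \<longlonglongrightarrow> (LINT v|?M. 1 *\<^sub>R (indicator K v *\<^sub>R (1::real)))"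
    unfolding A1_def by (rule tilt(1)) (auto intro!: exI[of _ 1])
  have I2: "integrable ?M (\<lambda>v. (0 - v \<bullet> \<eta>) *\<^sub>R A1 n v)" for n
    unfolding A1_def by (rule tilt(2)[where h = "\<lambda>_ v. 0 - v \<bullet> \<eta>" and h' = "\<lambda>v. 0 - v \<bullet> \<eta>"])
      (use hbound[of "\<lambda>_. 0"] R in auto)
  have L2: "(\<lambda>n. LINT v|?M. (0 - v \<bullet> \<eta>) *\<^sub>R A1 n v) \<longlonglongrightarrow> (LINT v|?M. (0 - v \<bullet> \<eta>) *\<^sub>R (indicator K v *\<^sub>R (1::real)))"
    unfolding A1_def by (rule tilt(1)) (use hbound[of "\<lambda>_. 0"] R in auto)
  have L3: "(\<lambda>n. LINT v|?M. (b n - v \<bullet> \<eta>) *\<^sub>R A2 n v) \<longlonglongrightarrow> (LINT v|?M. (\<beta> - v \<bullet> \<eta>) *\<^sub>R (indicator K v *\<^sub>R v))"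
    if "b \<longlonglongrightarrow> \<beta>"
    unfolding A2_def by (rule tilt(1)) (use hbound[OF bb] that in \<open>auto intro!: tendsto_intros\<close>)
  have diff1: "(LINT v|?M. (a n - e n * (v \<bullet> \<eta>)) *\<^sub>R A1 n v) = 0" for n
  proof -
    have "(LINT v|?M. (a n - e n * (v \<bullet> \<eta>)) *\<^sub>R A1 n v) =
      (LINT x|lborel. (indicator (S n) x - indicator ?T x) *\<^sub>R (indicator K x *\<^sub>R (1::real)))"
      unfolding A1_def S_def using integrable_body[of "\<lambda>_. 1::real"]
      by (subst integral_tilted_difference[OF \<xi> \<eta>(2)]) auto
    also have "\<dots> = (LINT x|lborel. indicator (K \<inter> S n) x - indicator (K \<inter> ?T) x)"
      by (intro Bochner_Integration.integral_cong) (auto simp: indicator_def)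
    also have "\<dots> = measure lborel (K \<inter> S n) - measure lborel (K \<inter> ?T)"
    proof -
      have "K \<inter> S n \<in> fmeasurable lborel" "K \<inter> ?T \<in> fmeasurable lborel"
        by (intro fmeasurable_subset_K; measurable; simp)+
      then show ?thesis
        by (subst Bochner_Integration.integral_diff) (auto simp: fmeasurable_def intro!: integrable_real_indicator)
    qed
    also have "\<dots> = 0" using vol vol_cut_level[OF nz] by (simp add: vol_def)
    finally show ?thesis .
  qed
  have diff2: "(LINT v|?M. (a n - e n * (v \<bullet> \<eta>)) *\<^sub>R A2 n v) =
      (LINT x|lborel. indicator (K \<inter> S n) x *\<^sub>R x) - (LINT x|lborel. indicator (K \<inter> ?T) x *\<^sub>R x)" for n
  proof -
    have i: "integrable lborel (\<lambda>x. indicator (K \<inter> T) x *\<^sub>R x)" if [measurable]: "T \<in> sets borel" for T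
    proof -
      have "integrable lborel (\<lambda>x. indicator T x *\<^sub>R (indicator K x *\<^sub>R x))"
        by (rule integrable_mult_indicator[OF _ integrable_body[OF continuous_on_id]]) simp
      then show ?thesis by (rule Bochner_Integration.integrable_cong[THEN iffD1, rotated 2]) (auto simp: indicator_def)
    qed
    have "(LINT v|?M. (a n - e n * (v \<bullet> \<eta>)) *\<^sub>R A2 n v) =
      (LINT x|lborel. (indicator (S n) x - indicator ?T x) *\<^sub>R (indicator K x *\<^sub>R x))"
      unfolding A2_def S_def
      by (rule integral_tilted_difference[OF \<xi> \<eta>(2) integrable_body[OF continuous_on_id], symmetric])
    also have "\<dots> = (LINT x|lborel. indicator (K \<inter> S n) x *\<^sub>R x - indicator (K \<inter> ?T) x *\<^sub>R x)"
      by (intro Bochner_Integration.integral_cong) (auto simp: indicator_def)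
    also have "\<dots> = (LINT x|lborel. indicator (K \<inter> S n) x *\<^sub>R x) - (LINT x|lborel. indicator (K \<inter> ?T) x *\<^sub>R x)"
      by (intro Bochner_Integration.integral_diff i) measurable
    finally show ?thesis .
  qed
  have mpos: "0 < (LINT v|?M. indicator K v :: real)"
    using emeasure_plane_interior_pos[OF \<xi> borel_K z0]
      emeasure_plane_lborel_finite[OF \<xi> borel_K compact_imp_bounded[OF compact_K], of ?t]
    by (simp add: measure_def enn2real_positive_iff)
  \<comment> \<open>The left side is 0 by \<open>diff1\<close>, so this is a linear equation for
    \<open>a n\<close>. Its coefficients converge, and the limit of the first one is the positive
    area of the section.\<close>
  have split: "(LINT v|?M. (a n - e n * (v \<bullet> \<eta>)) *\<^sub>R A1 n v) =
      a n * (LINT v|?M. 1 *\<^sub>R A1 n v) + e n * (LINT v|?M. (0 - v \<bullet> \<eta>) *\<^sub>R A1 n v)" for n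
  proof -
    have "(LINT v|?M. (a n - e n * (v \<bullet> \<eta>)) *\<^sub>R A1 n v) =
      (LINT v|?M. a n *\<^sub>R (1 *\<^sub>R A1 n v) + e n *\<^sub>R ((0 - v \<bullet> \<eta>) *\<^sub>R A1 n v))"
      by (intro Bochner_Integration.integral_cong) (auto simp: algebra_simps)
    also have "\<dots> = (LINT v|?M. a n *\<^sub>R (1 *\<^sub>R A1 n v)) + (LINT v|?M. e n *\<^sub>R ((0 - v \<bullet> \<eta>) *\<^sub>R A1 n v))"
      by (intro Bochner_Integration.integral_add integrable_scaleR_right I1 I2)
    also have "\<dots> = a n *\<^sub>R (LINT v|?M. 1 *\<^sub>R A1 n v) + e n *\<^sub>R (LINT v|?M. (0 - v \<bullet> \<eta>) *\<^sub>R A1 n v)"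
      by (simp only: integral_scaleR_right)
    finally show ?thesis by (simp only: real_scaleR_def)
  qed
  have "b \<longlonglongrightarrow> \<beta>"
  proof -
    have "(\<lambda>n. - (LINT v|?M. (0 - v \<bullet> \<eta>) *\<^sub>R A1 n v) / (LINT v|?M. 1 *\<^sub>R A1 n v)) \<longlonglongrightarrow>
      - (LINT v|?M. (0 - v \<bullet> \<eta>) *\<^sub>R (indicator K v *\<^sub>R (1::real))) / (LINT v|?M. 1 *\<^sub>R (indicator K v *\<^sub>R (1::real)))"
      using L1 L2 mpos by (intro tendsto_intros) auto
    also have "- (LINT v|?M. (0 - v \<bullet> \<eta>) *\<^sub>R (indicator K v *\<^sub>R (1::real))) / (LINT v|?M. 1 *\<^sub>R (indicator K v *\<^sub>R (1::real))) = \<beta>"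
      unfolding \<beta>_def by (simp add: mult.commute)
    finally show ?thesis
    proof (rule Lim_transform_eventually)
      have "\<forall>\<^sub>F n in sequentially. 0 < (LINT v|?M. 1 *\<^sub>R A1 n v)"
        using order_tendstoD(1)[OF L1] mpos by simp
      then show "\<forall>\<^sub>F n in sequentially. - (LINT v|?M. (0 - v \<bullet> \<eta>) *\<^sub>R A1 n v) / (LINT v|?M. 1 *\<^sub>R A1 n v) = b n"
      proof eventually_elim
        case (elim n)
        then show ?case
          using diff1[of n] e(2)[of n] unfolding split b_def by (simp add: field_simps)
      qed
    qed
  qed
  note L3[OF this]
  moreover have "(LINT v|?M. (b n - v \<bullet> \<eta>) *\<^sub>R A2 n v) = (1 / e n) *\<^sub>R
      ((LINT x|lborel. indicator (K \<inter> S n) x *\<^sub>R x) - (LINT x|lborel. indicator (K \<inter> ?T) x *\<^sub>R x))" for n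
  proof -
    have "(LINT v|?M. (b n - v \<bullet> \<eta>) *\<^sub>R A2 n v) = (LINT v|?M. (1 / e n) *\<^sub>R ((a n - e n * (v \<bullet> \<eta>)) *\<^sub>R A2 n v))"
    proof (rule Bochner_Integration.integral_cong)
      fix v
      have "b n - v \<bullet> \<eta> = (1 / e n) * (a n - e n * (v \<bullet> \<eta>))"
        using e(2)[of n] by (simp add: b_def field_simps)
      then show "(b n - v \<bullet> \<eta>) *\<^sub>R A2 n v = (1 / e n) *\<^sub>R ((a n - e n * (v \<bullet> \<eta>)) *\<^sub>R A2 n v)"
        by simp
    qed simp
    also have "\<dots> = (1 / e n) *\<^sub>R (LINT v|?M. (a n - e n * (v \<bullet> \<eta>)) *\<^sub>R A2 n v)"
      by (rule integral_scaleR_right)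
    finally show ?thesis unfolding diff2 .
  qed
  ultimately show ?thesis unfolding S_def by simp
qed

end

subsection \<open>Great circles of directions\<close>

definition rot :: "'a::euclidean_space \<Rightarrow> 'a \<Rightarrow> real \<Rightarrow> 'a" where
  "rot \<xi> \<eta> \<theta> = cos \<theta> *\<^sub>R \<xi> + sin \<theta> *\<^sub>R \<eta>"

lemma rot_0 [simp]: "rot \<xi> \<eta> 0 = \<xi>"
  by (simp add: rot_def)

lemma rot_has_vector_derivative:
  "(rot \<xi> \<eta> has_vector_derivative rot \<eta> (- \<xi>) \<theta>) (at \<theta>)"
proof -
  have "((\<lambda>\<theta>. cos \<theta> *\<^sub>R \<xi> + sin \<theta> *\<^sub>R \<eta>) has_vector_derivative - sin \<theta> *\<^sub>R \<xi> + cos \<theta> *\<^sub>R \<eta>) (at \<theta>)"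
    by (auto intro!: derivative_eq_intros simp: has_real_derivative_iff_has_vector_derivative[symmetric])
  then show ?thesis by (simp add: rot_def[abs_def] add.commute)
qed

text \<open>Any point of the circle may serve as its start, with
  \<open>rot \<eta> (- \<xi>) \<theta>\<close> as the unit tangent there.\<close>

lemma rot_add: "rot \<xi> \<eta> (\<theta> + h) = rot (rot \<xi> \<eta> \<theta>) (rot \<eta> (- \<xi>) \<theta>) h"
  by (simp add: rot_def cos_add sin_add algebra_simps)

lemma norm_rot:
  assumes "norm \<xi> = 1" "norm \<eta> = 1" "\<eta> \<bullet> \<xi> = 0"
  shows "norm (rot \<xi> \<eta> \<theta>) = 1"
proof -
  have "rot \<xi> \<eta> \<theta> \<bullet> rot \<xi> \<eta> \<theta> = 1"
  proof -
    have "\<xi> \<bullet> \<xi> = 1" "\<eta> \<bullet> \<eta> = 1" "\<xi> \<bullet> \<eta> = 0"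
      using assms by (simp_all add: norm_eq_1 inner_commute)
    then show ?thesis
      unfolding rot_def inner_add_left inner_add_right inner_scaleR_left inner_scaleR_right
      using assms(3) by simp
  qed
  then show ?thesis by (simp add: norm_eq_1)
qed

lemma rot_orthogonal:
  assumes "norm \<xi> = 1" "norm \<eta> = 1" "\<eta> \<bullet> \<xi> = 0"
  shows "rot \<eta> (- \<xi>) \<theta> \<bullet> rot \<xi> \<eta> \<theta> = 0"
proof -
  have "\<xi> \<bullet> \<xi> = 1" "\<eta> \<bullet> \<eta> = 1" "\<xi> \<bullet> \<eta> = 0"
    using assms by (simp_all add: norm_eq_1 inner_commute)
  then show ?thesis
    unfolding rot_def inner_add_left inner_add_right inner_scaleR_left inner_scaleR_right
    using assms(3) by simp
qed

lemma orthogonal_unit_exists: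
  fixes \<xi> :: "'a::euclidean_space"
  assumes "2 \<le> DIM('a)"
  obtains \<eta> where "norm \<eta> = 1" "\<eta> \<bullet> \<xi> = 0"
proof -
  obtain y where "y \<noteq> 0" "orthogonal \<xi> y" using orthogonal_to_vector_exists[OF assms] by blast
  then show ?thesis
    by (intro that[of "y /\<^sub>R norm y"]) (auto simp: orthogonal_def inner_commute)
qed

lemma great_circle_exists:
  fixes \<xi> \<zeta> :: "'a::euclidean_space"
  assumes "2 \<le> DIM('a)" "norm \<xi> = 1" "norm \<zeta> = 1"
  obtains \<eta> \<theta> where "norm \<eta> = 1" "\<eta> \<bullet> \<xi> = 0" "\<zeta> = rot \<xi> \<eta> \<theta>"
proof -
  define u where "u = \<zeta> - (\<zeta> \<bullet> \<xi>) *\<^sub>R \<xi>"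
  have u: "u \<bullet> \<xi> = 0" using assms by (simp add: u_def inner_diff_left dot_square_norm)
  obtain \<eta> where \<eta>: "norm \<eta> = 1" "\<eta> \<bullet> \<xi> = 0" "u = norm u *\<^sub>R \<eta>"
  proof (cases "u = 0")
    \<comment> \<open>Here \<zeta> is \<xi> or its opposite, and any great circle through \<xi> will
      do.\<close>
    case True
    then show ?thesis using orthogonal_unit_exists[OF assms(1)] that by (metis norm_zero scaleR_zero_left)
  next
    case False
    then show ?thesis using u by (intro that[of "u /\<^sub>R norm u"]) auto
  qed
  have z: "\<zeta> = (\<zeta> \<bullet> \<xi>) *\<^sub>R \<xi> + norm u *\<^sub>R \<eta>"
    using \<eta>(3) by (simp add: u_def)
  have "orthogonal ((\<zeta> \<bullet> \<xi>) *\<^sub>R \<xi>) (norm u *\<^sub>R \<eta>)"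
    using \<eta>(2) by (simp add: orthogonal_def inner_commute)
  from norm_add_Pythagorean[OF this]
  have "(norm \<zeta>)\<^sup>2 = (norm ((\<zeta> \<bullet> \<xi>) *\<^sub>R \<xi>))\<^sup>2 + (norm (norm u *\<^sub>R \<eta>))\<^sup>2"
    unfolding z[symmetric] .
  then have "(\<zeta> \<bullet> \<xi>)\<^sup>2 + (norm u)\<^sup>2 = 1" using assms \<eta>(1) by simp
  then obtain \<theta> where "\<zeta> \<bullet> \<xi> = cos \<theta>" "norm u = sin \<theta>" by (rule sincos_total_2pi)
  then show ?thesis using that[OF \<eta>(1,2), of \<theta>] z by (simp add: rot_def)
qed

text \<open>Derivatives are required only at the start of each great circle; by
  \<open>rot_add\<close> they vanish all along it. Any two unit vectors lie on a common great
  circle.\<close>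

lemma const_on_sphere:
  fixes f :: "'a::euclidean_space \<Rightarrow> 'b::real_normed_vector"
  assumes dim: "2 \<le> DIM('a)"
    and deriv: "\<And>\<xi> \<eta>. norm \<xi> = 1 \<Longrightarrow> norm \<eta> = 1 \<Longrightarrow> \<eta> \<bullet> \<xi> = 0 \<Longrightarrow>
      ((\<lambda>\<theta>. f (rot \<xi> \<eta> \<theta>)) has_vector_derivative 0) (at 0)"
    and "norm \<xi> = 1" "norm \<zeta> = 1"
  shows "f \<xi> = f \<zeta>"
proof -
  obtain \<eta> \<theta> where \<eta>: "norm \<eta> = 1" "\<eta> \<bullet> \<xi> = 0" and \<zeta>: "\<zeta> = rot \<xi> \<eta> \<theta>"
    using great_circle_exists[OF dim assms(3,4)] by blast
  have "((\<lambda>\<theta>. f (rot \<xi> \<eta> \<theta>)) has_vector_derivative 0) (at \<theta>)" for \<theta>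
  proof -
    let ?g = "\<lambda>h. f (rot (rot \<xi> \<eta> \<theta>) (rot \<eta> (- \<xi>) \<theta>) h)"
    have "(?g has_vector_derivative 0) (at 0)"
      using assms(3) \<eta> norm_rot[of \<xi> \<eta>] norm_rot[of \<eta> "- \<xi>"] rot_orthogonal[of \<xi> \<eta>]
      by (intro deriv) (auto simp: inner_commute)
    then have "((?g \<circ> (\<lambda>x. x - \<theta>)) has_vector_derivative 1 *\<^sub>R 0) (at \<theta>)"
      by (intro vector_diff_chain_at) (auto intro!: derivative_eq_intros)
    moreover have "?g \<circ> (\<lambda>x. x - \<theta>) = (\<lambda>\<theta>. f (rot \<xi> \<eta> \<theta>))"
      by (simp add: fun_eq_iff rot_add[symmetric])
    ultimately show ?thesis by simp
  qed
  then have "\<exists>c. \<forall>\<theta>\<in>UNIV. f (rot \<xi> \<eta> \<theta>) = c"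
    by (intro has_derivative_zero_constant) (auto simp: has_vector_derivative_def)
  then show ?thesis unfolding \<zeta> by (metis UNIV_I rot_0)
qed

text \<open>The tilt enters through its slope, the derivative is taken in the angle; this limit
  exchanges the two.\<close>

lemma tan_divide_tendsto: "((\<lambda>x::real. tan x / x) \<longlongrightarrow> 1) (at 0)"
  using DERIV_tan[of "0::real"] by (simp add: DERIV_def)

subsection \<open>The second moments of the cutting sections\<close>

context cut_body
begin

text \<open>This is \<open>\<eta> \<bullet> M \<zeta>\<close> for the matrix of second moments, kept
  as a bilinear form so that no coordinates on the section are needed.\<close>

definition section_moment :: "'a \<Rightarrow> 'a \<Rightarrow> 'a \<Rightarrow> real" where
  "section_moment \<xi> \<eta> \<zeta> = (LINT v|section_lborel \<xi>. indicator K v *\<^sub>R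
    (((v - section_center K \<delta> \<xi>) \<bullet> \<eta>) * ((v - section_center K \<delta> \<xi>) \<bullet> \<zeta>)))"

lemma integral_cut_plane:
  fixes f :: "'a \<Rightarrow> 'b::{banach, second_countable_topology}"
  assumes \<xi>: "norm \<xi> = 1" and [measurable]: "f \<in> borel_measurable borel"
  shows "(LINT v:K \<inter> cut_plane K \<delta> \<xi>|plane_lborel (cut_plane K \<delta> \<xi>). f v) =
    (LINT v|section_lborel \<xi>. indicator K v *\<^sub>R f v)"
  unfolding set_lebesgue_integral_def cut_plane_def
proof (rule integral_cong_AE)
  show "AE v in section_lborel \<xi>. indicat_real (K \<inter> {p. p \<bullet> \<xi> = cut_level K \<delta> \<xi>}) v *\<^sub>R f v = indicat_real K v *\<^sub>R f v"
    using AE_plane_lborel_hyperplane[OF \<xi>] by eventually_elim (auto simp: indicator_def)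
qed measurable

lemma measure_section_pos:
  assumes \<xi>: "norm \<xi> = 1"
  shows "0 < measure (section_lborel \<xi>) K"
proof -
  have "\<xi> \<noteq> 0" using \<xi> by auto
  then obtain z where "z \<in> interior K" "z \<bullet> \<xi> = cut_level K \<delta> \<xi>" using cut_plane_meets_interior by blast
  then show ?thesis
    using emeasure_plane_interior_pos[OF \<xi> borel_K]
      emeasure_plane_lborel_finite[OF \<xi> borel_K compact_imp_bounded[OF compact_K]]
    by (simp add: measure_def enn2real_positive_iff)
qed

lemma section_center_eq:
  assumes \<xi>: "norm \<xi> = 1"
  shows "measure (section_lborel \<xi>) K *\<^sub>R section_center K \<delta> \<xi> = (LINT v|section_lborel \<xi>. indicator K v *\<^sub>R v)"
proof -
  have "measure (section_lborel \<xi>) (K \<inter> cut_plane K \<delta> \<xi>) = measure (section_lborel \<xi>) K"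
  proof (rule measure_eq_AE)
    show "AE v in section_lborel \<xi>. v \<in> K \<inter> cut_plane K \<delta> \<xi> \<longleftrightarrow> v \<in> K"
      using AE_plane_lborel_hyperplane[OF \<xi>] by eventually_elim (auto simp: cut_plane_def)
  qed (auto simp: cut_plane_def)
  moreover have "(LINT v:K \<inter> cut_plane K \<delta> \<xi>|plane_lborel (cut_plane K \<delta> \<xi>). v) = (LINT v|section_lborel \<xi>. indicator K v *\<^sub>R v)"
    by (rule integral_cut_plane[OF \<xi>]) simp
  ultimately show ?thesis
    using measure_section_pos[OF \<xi>]
    by (simp add: section_center_def center_of_mass_def cut_plane_def)
qed

lemma section_inner:
  assumes \<xi>: "norm \<xi> = 1"
  shows "(LINT v|section_lborel \<xi>. indicator K v *\<^sub>R (v \<bullet> \<zeta>)) = measure (section_lborel \<xi>) K * (section_center K \<delta> \<xi> \<bullet> \<zeta>)"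
proof -
  have "(LINT v|section_lborel \<xi>. indicator K v *\<^sub>R (v \<bullet> \<zeta>)) = (LINT v|section_lborel \<xi>. (indicator K v *\<^sub>R v) \<bullet> \<zeta>)"
    by simp
  also have "\<dots> = (LINT v|section_lborel \<xi>. indicator K v *\<^sub>R v) \<bullet> \<zeta>"
    by (rule integral_inner_left) (rule integrable_section[OF \<xi> continuous_on_id])
  also have "\<dots> = measure (section_lborel \<xi>) K * (section_center K \<delta> \<xi> \<bullet> \<zeta>)"
    by (simp flip: section_center_eq[OF \<xi>])
  finally show ?thesis .
qed

lemma section_centered:
  assumes \<xi>: "norm \<xi> = 1"
  shows "(LINT v|section_lborel \<xi>. indicator K v *\<^sub>R ((v - section_center K \<delta> \<xi>) \<bullet> \<zeta>)) = 0"
proof -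
  have "(LINT v|section_lborel \<xi>. indicator K v *\<^sub>R ((v - section_center K \<delta> \<xi>) \<bullet> \<zeta>)) =
    (LINT v|section_lborel \<xi>. indicator K v *\<^sub>R (v \<bullet> \<zeta>) - indicator K v *\<^sub>R (section_center K \<delta> \<xi> \<bullet> \<zeta>))"
    by (simp add: inner_diff_left algebra_simps)
  also have "\<dots> = (LINT v|section_lborel \<xi>. indicator K v *\<^sub>R (v \<bullet> \<zeta>)) -
      (LINT v|section_lborel \<xi>. indicator K v *\<^sub>R (section_center K \<delta> \<xi> \<bullet> \<zeta>))"
    by (intro Bochner_Integration.integral_diff integrable_section[OF \<xi>] continuous_intros)
  also have "\<dots> = 0"
    by (simp only: section_inner[OF \<xi>]) simp
  finally show ?thesis .
qed

lemma section_center_level: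
  assumes \<xi>: "norm \<xi> = 1"
  shows "section_center K \<delta> \<xi> \<bullet> \<xi> = cut_level K \<delta> \<xi>"
proof -
  have "measure (section_lborel \<xi>) K * (section_center K \<delta> \<xi> \<bullet> \<xi>) = (LINT v|section_lborel \<xi>. indicator K v *\<^sub>R (v \<bullet> \<xi>))"
    by (rule section_inner[OF \<xi>, symmetric])
  also have "\<dots> = (LINT v|section_lborel \<xi>. indicator K v * cut_level K \<delta> \<xi>)"
  proof (rule integral_cong_AE)
    show "AE v in section_lborel \<xi>. indicator K v *\<^sub>R (v \<bullet> \<xi>) = indicator K v * cut_level K \<delta> \<xi>"
      using AE_plane_lborel_hyperplane[OF \<xi>] by eventually_elim simp
  qed measurable
  also have "\<dots> = measure (section_lborel \<xi>) K * cut_level K \<delta> \<xi>" by simp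
  finally show ?thesis using measure_section_pos[OF \<xi>] by simp
qed

lemma section_moment_direction:
  assumes \<xi>: "norm \<xi> = 1"
  shows "section_moment \<xi> \<eta> \<xi> = 0"
proof -
  have "section_moment \<xi> \<eta> \<xi> = (LINT v|section_lborel \<xi>. 0)"
    unfolding section_moment_def
  proof (rule integral_cong_AE)
    show "AE v in section_lborel \<xi>. indicator K v *\<^sub>R
      (((v - section_center K \<delta> \<xi>) \<bullet> \<eta>) * ((v - section_center K \<delta> \<xi>) \<bullet> \<xi>)) = 0"
      using AE_plane_lborel_hyperplane[OF \<xi>]
      by eventually_elim (simp add: inner_diff_left section_center_level[OF \<xi>])
  qed measurable
  then show ?thesis by simp
qed

lemma section_moment_sym: "section_moment \<xi> \<eta> \<zeta> = section_moment \<xi> \<zeta> \<eta>"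
  by (simp add: section_moment_def mult.commute)

lemma section_moment_scale: "section_moment \<xi> \<eta> (r *\<^sub>R \<zeta>) = r * section_moment \<xi> \<eta> \<zeta>"
proof -
  have "section_moment \<xi> \<eta> (r *\<^sub>R \<zeta>) = (LINT v|section_lborel \<xi>. r * (indicator K v *\<^sub>R
    (((v - section_center K \<delta> \<xi>) \<bullet> \<eta>) * ((v - section_center K \<delta> \<xi>) \<bullet> \<zeta>))))"
    unfolding section_moment_def by (simp add: ac_simps)
  then show ?thesis unfolding section_moment_def by (simp only: integral_mult_right_zero)
qed

lemma section_moment_add:
  assumes \<xi>: "norm \<xi> = 1"
  shows "section_moment \<xi> \<eta> (x + y) = section_moment \<xi> \<eta> x + section_moment \<xi> \<eta> y"
  unfolding section_moment_def inner_add_right distrib_left scaleR_add_right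
  by (intro Bochner_Integration.integral_add integrable_section[OF \<xi>] continuous_intros)

text \<open>A vanishing moment would confine almost all of the section to the hyperplane through the
  centroid with normal \<open>n\<close>. That set is null in the section plane, because the cylinder
  over it lies in a hyperplane of the space, whereas the section has positive area.\<close>

lemma section_moment_pos:
  assumes \<xi>: "norm \<xi> = 1" and n: "norm n = 1" "n \<bullet> \<xi> = 0"
  shows "0 < section_moment \<xi> n n"
proof -
  let ?M = "section_lborel \<xi>" let ?c = "section_center K \<delta> \<xi>"
  let ?f = "\<lambda>v. indicator K v *\<^sub>R (((v - ?c) \<bullet> n) * ((v - ?c) \<bullet> n))"
  have nonneg: "AE v in ?M. 0 \<le> ?f v" by simp
  have int: "integrable ?M ?f" by (intro integrable_section[OF \<xi>] continuous_intros)
  have "section_moment \<xi> n n \<noteq> 0"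
  proof
    assume "section_moment \<xi> n n = 0"
    then have AE1: "AE v in ?M. ?f v = 0"
      using integral_nonneg_eq_0_iff_AE[OF int nonneg] by (simp add: section_moment_def)
    have "n \<noteq> 0" using n by auto
    have [measurable]: "{x. x \<bullet> n = ?c \<bullet> n} \<in> sets borel" by measurable
    have "emeasure ?M {x. x \<bullet> n = ?c \<bullet> n} = emeasure lborel {x. x - (x \<bullet> \<xi> - cut_level K \<delta> \<xi>) *\<^sub>R \<xi> \<in> {x. x \<bullet> n = ?c \<bullet> n} \<and>
        x \<bullet> \<xi> \<in> {cut_level K \<delta> \<xi>..cut_level K \<delta> \<xi> + 1}}"
      using emeasure_plane_lborel[OF \<xi>, of "{x. x \<bullet> n = ?c \<bullet> n}" 1 "cut_level K \<delta> \<xi>"] by simp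
    also have "\<dots> \<le> emeasure lborel {x. x \<bullet> n = ?c \<bullet> n}"
      using n by (intro emeasure_mono) (auto simp: inner_diff_left inner_commute[of \<xi> n])
    also have "\<dots> = 0"
      using hyperplane_null_sets[OF \<open>n \<noteq> 0\<close>, of "?c \<bullet> n"] by (auto simp: null_sets_def)
    finally have "{x. x \<bullet> n = ?c \<bullet> n} \<in> null_sets ?M" by (simp add: null_sets_def)
    from AE_not_in[OF this] AE1 have "AE v in ?M. v \<notin> K"
      by eventually_elim (auto simp: inner_diff_left)
    then have "K \<in> null_sets ?M" by (simp add: AE_iff_null_sets)
    then show False using measure_section_pos[OF \<xi>] by (simp add: measure_def null_sets_def)
  qed
  moreover have "0 \<le> section_moment \<xi> n n"
    unfolding section_moment_def by (rule integral_nonneg_AE[OF nonneg])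
  ultimately show ?thesis by simp
qed

section \<open>The derivative of the submerged center\<close>

lemma submerged_center_eq:
  assumes "\<xi> \<noteq> 0"
  shows "submerged_center K \<delta> \<xi> = (1 / \<delta>) *\<^sub>R (LINT x|lborel. indicator (K \<inter> cut_halfspace K \<delta> \<xi>) x *\<^sub>R x)"
  using vol_cut_level[OF assms]
  by (simp add: submerged_center_def center_of_mass_def cut_halfspace_def vol_def set_lebesgue_integral_def)

lemma submerged_center_has_vector_derivative:
  assumes \<xi>: "norm \<xi> = 1" and \<eta>: "norm \<eta> = 1" "\<eta> \<bullet> \<xi> = 0"
  obtains D where "((\<lambda>\<theta>. submerged_center K \<delta> (rot \<xi> \<eta> \<theta>)) has_vector_derivative D) (at 0)"
    "\<And>\<zeta>. D \<bullet> \<zeta> = - section_moment \<xi> \<eta> \<zeta> / \<delta>"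
proof -
  let ?M = "section_lborel \<xi>" let ?c = "section_center K \<delta> \<xi>" let ?t = "cut_level K \<delta> \<xi>"
  let ?C = "\<lambda>\<theta>. submerged_center K \<delta> (rot \<xi> \<eta> \<theta>)"
  define I where "I = (LINT v|?M. (?c \<bullet> \<eta> - v \<bullet> \<eta>) *\<^sub>R (indicator K v *\<^sub>R v))"
  define D where "D = (1 / \<delta>) *\<^sub>R I"
  have \<beta>: "(LINT v|?M. indicator K v *\<^sub>R (v \<bullet> \<eta>)) / (LINT v|?M. indicator K v) = ?c \<bullet> \<eta>"
    using measure_section_pos[OF \<xi>] by (simp only: section_inner[OF \<xi>]) simp
  \<comment> \<open>For angles in this window the cosine is positive and the tangent vanishes only
    at 0.\<close>
  have lim: "((\<lambda>h. (1 / h) *\<^sub>R (?C h - ?C 0)) \<longlongrightarrow> D) (at 0 within {-1<..<1})"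
    unfolding tendsto_at_iff_sequentially
  proof (intro allI impI)
    fix X :: "nat \<Rightarrow> real" assume X01: "\<forall>i. X i \<in> {-1<..<1} - {0}" and X0: "X \<longlonglongrightarrow> 0"
    have Xb: "X n \<noteq> 0" "- 1 < X n" "X n < 1" for n using X01 by auto
    have pi: "1 < pi / 2" using pi_gt3 by linarith
    have cos: "0 < cos (X n)" for n
      using Xb[of n] pi by (intro cos_gt_zero_pi) linarith+
    define e where "e n = tan (X n)" for n
    have e0: "e n \<noteq> 0" for n
    proof (cases "0 < X n")
      case True
      then show ?thesis using tan_gt_zero[of "X n"] Xb[of n] pi unfolding e_def by linarith
    next
      case False
      then show ?thesis using tan_less_zero[of "X n"] Xb[of n] pi unfolding e_def by linarith
    qed
    have e: "e \<longlonglongrightarrow> 0"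
      unfolding e_def using isCont_tendsto_compose[OF isCont_tan X0] by simp
    \<comment> \<open>Dividing the inequality of the rotated half-space by the cosine puts it in the
      form of height over the old plane, with slope \<open>e n\<close> and this offset.\<close>
    define a where "a n = cut_level K \<delta> (rot \<xi> \<eta> (X n)) / cos (X n) - ?t" for n
    have half: "{x. x \<bullet> \<xi> - ?t \<le> a n - e n * (x \<bullet> \<eta>)} = cut_halfspace K \<delta> (rot \<xi> \<eta> (X n))" for n
    proof -
      have "x \<bullet> \<xi> - ?t \<le> a n - e n * (x \<bullet> \<eta>) \<longleftrightarrow> x \<bullet> rot \<xi> \<eta> (X n) \<le> cut_level K \<delta> (rot \<xi> \<eta> (X n))" for x
      proof -
        have "x \<bullet> rot \<xi> \<eta> (X n) = cos (X n) * (x \<bullet> \<xi> + e n * (x \<bullet> \<eta>))"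
          using cos[of n] by (simp add: rot_def inner_add_right e_def tan_def field_simps)
        moreover have "cut_level K \<delta> (rot \<xi> \<eta> (X n)) = cos (X n) * (a n + ?t)"
          using cos[of n] by (simp add: a_def)
        ultimately have "x \<bullet> rot \<xi> \<eta> (X n) \<le> cut_level K \<delta> (rot \<xi> \<eta> (X n)) \<longleftrightarrow> x \<bullet> \<xi> + e n * (x \<bullet> \<eta>) \<le> a n + ?t"
          using cos[of n] by simp
        then show ?thesis by linarith
      qed
      then show ?thesis by (auto simp: cut_halfspace_def)
    qed
    have nz: "rot \<xi> \<eta> \<theta> \<noteq> 0" for \<theta>
      using norm_rot[OF \<xi> \<eta>, of \<theta>] by auto
    have vol: "measure lborel (K \<inter> {x. x \<bullet> \<xi> - ?t \<le> a n - e n * (x \<bullet> \<eta>)}) = \<delta>" for n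
      unfolding half using vol_cut_level[OF nz] by (simp add: vol_def cut_halfspace_def)
    have "(\<lambda>n. (1 / e n) *\<^sub>R
      ((LINT x|lborel. indicator (K \<inter> cut_halfspace K \<delta> (rot \<xi> \<eta> (X n))) x *\<^sub>R x) -
       (LINT x|lborel. indicator (K \<inter> cut_halfspace K \<delta> \<xi>) x *\<^sub>R x))) \<longlonglongrightarrow> I"
      using tilted_moment_tendsto[OF \<xi> \<eta> e e0 vol]
      unfolding half \<beta> I_def by (simp add: cut_halfspace_def)
    moreover have "(\<lambda>n. e n / X n) \<longlonglongrightarrow> 1"
      using tan_divide_tendsto X0 Xb unfolding tendsto_at_iff_sequentially e_def comp_def by auto
    ultimately have "(\<lambda>n. (e n / X n) *\<^sub>R ((1 / \<delta>) *\<^sub>R ((1 / e n) *\<^sub>R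
      ((LINT x|lborel. indicator (K \<inter> cut_halfspace K \<delta> (rot \<xi> \<eta> (X n))) x *\<^sub>R x) -
       (LINT x|lborel. indicator (K \<inter> cut_halfspace K \<delta> \<xi>) x *\<^sub>R x))))) \<longlonglongrightarrow> 1 *\<^sub>R ((1 / \<delta>) *\<^sub>R I)"
      by (intro tendsto_intros)
    moreover have "(1 / X n) *\<^sub>R (?C (X n) - ?C 0) = (e n / X n) *\<^sub>R ((1 / \<delta>) *\<^sub>R ((1 / e n) *\<^sub>R
      ((LINT x|lborel. indicator (K \<inter> cut_halfspace K \<delta> (rot \<xi> \<eta> (X n))) x *\<^sub>R x) -
       (LINT x|lborel. indicator (K \<inter> cut_halfspace K \<delta> \<xi>) x *\<^sub>R x))))" for n
      using nz[of "X n"] nz[of 0] e0[of n]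
      by (simp add: submerged_center_eq scaleR_diff_right[symmetric])
    ultimately show "((\<lambda>h. (1 / h) *\<^sub>R (?C h - ?C 0)) \<circ> X) \<longlonglongrightarrow> D"
      by (simp add: comp_def D_def)
  qed
  have "at (0::real) within {-1<..<1} = at 0" by (rule at_within_open) auto
  with lim have lim: "((\<lambda>h. (1 / h) *\<^sub>R (?C h - ?C 0)) \<longlongrightarrow> D) (at 0)" by simp
  have "(?C has_vector_derivative D) (at 0)"
    unfolding has_vector_derivative_def has_derivative_at
  proof
    have "((\<lambda>h. norm ((1 / h) *\<^sub>R (?C h - ?C 0) - D)) \<longlongrightarrow> 0) (at 0)"
      using tendsto_norm_zero[OF LIM_zero[OF lim]] .
    then show "((\<lambda>h. norm (?C (0 + h) - ?C 0 - h *\<^sub>R D) / norm h) \<longlongrightarrow> 0) (at 0)"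
    proof (rule Lim_transform_eventually)
      show "\<forall>\<^sub>F h in at 0. norm ((1 / h) *\<^sub>R (?C h - ?C 0) - D) = norm (?C (0 + h) - ?C 0 - h *\<^sub>R D) / norm h"
        unfolding eventually_at_filter
      proof (intro always_eventually allI impI)
        fix h :: real assume "h \<noteq> 0"
        then have "(1 / h) *\<^sub>R (?C h - ?C 0) - D = (1 / h) *\<^sub>R (?C (0 + h) - ?C 0 - h *\<^sub>R D)"
          by (simp add: scaleR_diff_right)
        then show "norm ((1 / h) *\<^sub>R (?C h - ?C 0) - D) = norm (?C (0 + h) - ?C 0 - h *\<^sub>R D) / norm h"
          by (simp only: norm_scaleR) simp
      qed
    qed
  qed (rule bounded_linear_scaleR_left)
  moreover have "D \<bullet> \<zeta> = - section_moment \<xi> \<eta> \<zeta> / \<delta>" for \<zeta>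
  proof -
    have i1: "integrable ?M (\<lambda>v. indicator K v *\<^sub>R (((v - ?c) \<bullet> \<eta>) * ((v - ?c) \<bullet> \<zeta>)))"
      and i2: "integrable ?M (\<lambda>v. indicator K v *\<^sub>R ((v - ?c) \<bullet> \<eta>))"
      by (intro integrable_section[OF \<xi>] continuous_intros)+
    have "integrable ?M (\<lambda>v. indicator K v *\<^sub>R ((?c \<bullet> \<eta> - v \<bullet> \<eta>) *\<^sub>R v))"
      by (intro integrable_section[OF \<xi>] continuous_intros)
    then have "integrable ?M (\<lambda>v. (?c \<bullet> \<eta> - v \<bullet> \<eta>) *\<^sub>R (indicator K v *\<^sub>R v))"
      by (simp add: mult.commute)
    then have "I \<bullet> \<zeta> = (LINT v|?M. ((?c \<bullet> \<eta> - v \<bullet> \<eta>) *\<^sub>R (indicator K v *\<^sub>R v)) \<bullet> \<zeta>)"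
      unfolding I_def by (intro integral_inner_left[symmetric])
    \<comment> \<open>The factor \<open>v \<bullet> \<zeta>\<close> is split at the centroid; the
      constant part \<open>?c \<bullet> \<zeta>\<close> then integrates to 0 by
      \<open>section_centered\<close>.\<close>
    also have "\<dots> = (LINT v|?M. (- 1) * (indicator K v *\<^sub>R (((v - ?c) \<bullet> \<eta>) * ((v - ?c) \<bullet> \<zeta>))) +
        (- (?c \<bullet> \<zeta>)) * (indicator K v *\<^sub>R ((v - ?c) \<bullet> \<eta>)))"
      by (intro Bochner_Integration.integral_cong) (auto simp: inner_diff_left algebra_simps)
    also have "\<dots> = (LINT v|?M. (- 1) * (indicator K v *\<^sub>R (((v - ?c) \<bullet> \<eta>) * ((v - ?c) \<bullet> \<zeta>)))) +
        (LINT v|?M. (- (?c \<bullet> \<zeta>)) * (indicator K v *\<^sub>R ((v - ?c) \<bullet> \<eta>)))"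
      by (intro Bochner_Integration.integral_add integrable_mult_right i1 i2)
    also have "\<dots> = - section_moment \<xi> \<eta> \<zeta>"
      unfolding section_moment_def by (simp only: integral_mult_right_zero section_centered[OF \<xi>])
    finally show ?thesis by (simp add: D_def)
  qed
  ultimately show ?thesis using that by blast
qed

end

subsection \<open>Codimension two planes\<close>

lemma orthogonal_pair_eq:
  "{y. \<forall>x\<in>span {a, b}. orthogonal x y} = {y. y \<bullet> a = 0 \<and> y \<bullet> b = 0}"
proof -
  have "\<forall>x\<in>span {a, b}. orthogonal y x" if "y \<bullet> a = 0" "y \<bullet> b = 0" for y
  proof
    fix x assume "x \<in> span {a, b}"
    then show "orthogonal y x"
      by (rule orthogonal_to_span) (use that in \<open>auto simp: orthogonal_def\<close>)
  qed
  moreover have "a \<in> span {a, b}" "b \<in> span {a, b}" by (auto intro: span_base)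
  ultimately show ?thesis by (auto simp: orthogonal_def inner_commute)
qed

lemma dim_orthogonal_pair:
  fixes \<xi> n :: "'a::euclidean_space"
  assumes "norm \<xi> = 1" "norm n = 1" "n \<bullet> \<xi> = 0"
  shows "dim {y. y \<bullet> \<xi> = 0 \<and> y \<bullet> n = 0} + 2 = DIM('a)"
proof -
  have ne: "\<xi> \<noteq> n" using assms by (auto simp: dot_square_norm)
  have "independent {\<xi>, n}"
    using assms by (intro pairwise_orthogonal_independent) (auto simp: pairwise_insert orthogonal_def inner_commute)
  then have "dim (span {\<xi>, n}) = 2"
    using ne by (simp add: dim_eq_card_independent)
  moreover have "dim {y \<in> UNIV. \<forall>x\<in>span {\<xi>, n}. orthogonal x y} + dim (span {\<xi>, n}) = dim (UNIV :: 'a set)"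
    by (rule dim_subspace_orthogonal_to_vectors) auto
  ultimately show ?thesis by (simp add: orthogonal_pair_eq)
qed

lemma codim2_plane:
  fixes \<xi> n c :: "'a::euclidean_space"
  assumes "norm \<xi> = 1" "norm n = 1" "n \<bullet> \<xi> = 0"
  defines "P \<equiv> {x. x \<bullet> \<xi> = c \<bullet> \<xi> \<and> x \<bullet> n = c \<bullet> n}"
  shows "affine P" "aff_dim P = int DIM('a) - 2"
proof -
  let ?W = "{y. y \<bullet> \<xi> = 0 \<and> y \<bullet> n = 0}"
  have W: "subspace ?W" by (auto simp: subspace_def inner_add_left)
  have "x \<in> (+) c ` ?W" if "x \<in> P" for x
    using that by (intro image_eqI[of _ _ "x - c"]) (auto simp: P_def inner_diff_left)
  then have P: "P = (+) c ` ?W"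
    by (auto simp: P_def inner_add_left)
  show "affine P" unfolding P using W affine_translation subspace_imp_affine by blast
  show "aff_dim P = int DIM('a) - 2"
    unfolding P aff_dim_translation_eq aff_dim_subspace[OF W]
    using dim_orthogonal_pair[OF assms(1-3)] by linarith
qed

text \<open>The direction space of \<open>P\<close> has one dimension less than the orthogonal
  complement of \<xi> that contains it, so some vector of the complement is normal to it. Counting
  dimensions shows that \<xi> and this normal determine \<open>P\<close>.\<close>

lemma codim2_plane_exists:
  fixes \<xi> c :: "'a::euclidean_space"
  assumes dim: "2 \<le> DIM('a)" and \<xi>: "norm \<xi> = 1" and P: "affine P" "aff_dim P = int DIM('a) - 2" "c \<in> P"
    and sub: "P \<subseteq> {x. x \<bullet> \<xi> = c \<bullet> \<xi>}"
  obtains n where "norm n = 1" "n \<bullet> \<xi> = 0" "P = {x. x \<bullet> \<xi> = c \<bullet> \<xi> \<and> x \<bullet> n = c \<bullet> n}"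
proof -
  define S where "S = (\<lambda>x. x - c) ` P"
  have S: "subspace S" unfolding S_def using P(1,3) by (rule affine_diffs_subspace_subtract)
  have PS: "P = (+) c ` S" by (force simp: S_def image_image)
  have dS: "int (dim S) = int DIM('a) - 2"
    using P(2) unfolding PS aff_dim_translation_eq aff_dim_subspace[OF S] .
  let ?T = "{x. x \<bullet> \<xi> = 0}"
  have T: "subspace ?T" by (auto simp: subspace_def inner_add_left)
  have ST: "S \<subseteq> ?T" using sub by (auto simp: S_def inner_diff_left)
  have "dim ?T = DIM('a) - 1"
  proof -
    have "\<xi> \<noteq> 0" using \<xi> by auto
    then show ?thesis using dim_hyperplane[of \<xi>] by (simp add: inner_commute)
  qed
  then have "S \<noteq> ?T" using dS dim by auto
  then have "span S \<subset> span ?T" using ST S T by (simp add: span_eq_iff[THEN iffD2] psubset_eq)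
  then obtain x where x: "x \<noteq> 0" "x \<in> span ?T" "\<And>y. y \<in> span S \<Longrightarrow> orthogonal x y"
    using orthogonal_to_subspace_exists_gen by blast
  define n where "n = x /\<^sub>R norm x"
  have n: "norm n = 1" "n \<bullet> \<xi> = 0"
  proof -
    have "x \<in> ?T" using x(2) T by (metis span_eq_iff)
    then show "norm n = 1" "n \<bullet> \<xi> = 0" using x(1) by (simp_all add: n_def)
  qed
  let ?W = "{y. y \<bullet> \<xi> = 0 \<and> y \<bullet> n = 0}"
  have W: "subspace ?W" by (auto simp: subspace_def inner_add_left)
  have "S \<subseteq> ?W"
    using ST x(3) span_superset by (fastforce simp: n_def orthogonal_def inner_commute)
  then have "S = ?W"
    using dim_orthogonal_pair[OF \<xi> n] dS by (intro subspace_dim_equal[OF S W]) auto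
  then have "P = {x. x \<bullet> \<xi> = c \<bullet> \<xi> \<and> x \<bullet> n = c \<bullet> n}"
    unfolding PS by (auto simp: inner_add_left inner_diff_left intro!: image_eqI[of _ _ "_ - c"])
  then show ?thesis using that[OF n] by blast
qed

lemma infdist_codim2_plane:
  fixes \<xi> n c v :: "'a::euclidean_space"
  assumes "norm \<xi> = 1" and n: "norm n = 1" "n \<bullet> \<xi> = 0" and v: "v \<bullet> \<xi> = c \<bullet> \<xi>"
  shows "infdist v {x. x \<bullet> \<xi> = c \<bullet> \<xi> \<and> x \<bullet> n = c \<bullet> n} = \<bar>(v - c) \<bullet> n\<bar>" (is "infdist v ?P = _")
proof (rule antisym)
  have p: "v - ((v - c) \<bullet> n) *\<^sub>R n \<in> ?P"
    using n v by (simp add: inner_diff_left dot_square_norm)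
  show "infdist v ?P \<le> \<bar>(v - c) \<bullet> n\<bar>"
    using infdist_le[OF p, of v] n by (simp add: dist_norm)
  have "\<bar>(v - c) \<bullet> n\<bar> \<le> dist v x" if "x \<in> ?P" for x
    using that Cauchy_Schwarz_ineq2[of "v - x" n] n by (simp add: inner_diff_left dist_norm)
  then show "\<bar>(v - c) \<bullet> n\<bar> \<le> infdist v ?P"
    using p by (subst infdist_notempty) (auto intro!: cINF_greatest)
qed

text \<open>The condition \<open>k \<noteq> 0\<close> is part of the definition: if the two centers
  coincide, their affine hull is a point and not parallel to a line.\<close>

lemma floats_in_equilibrium_iff:
  assumes \<xi>: "norm \<xi> = 1"
  shows "floats_in_equilibrium K \<delta> \<xi> \<longleftrightarrow>
    (\<exists>k. k \<noteq> 0 \<and> submerged_center K \<delta> \<xi> = center_of_mass lborel K + k *\<^sub>R \<xi>)"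
proof -
  let ?A = "center_of_mass lborel K" let ?B = "submerged_center K \<delta> \<xi>"
  have hull: "affine hull {?A, ?B} = range (\<lambda>u. ?A + u *\<^sub>R (?B - ?A))" by (rule affine_hull_2_alt)
  show ?thesis
  proof
    assume "floats_in_equilibrium K \<delta> \<xi>"
    then obtain a where a: "span {\<xi>} = (+) a ` range (\<lambda>u. ?A + u *\<^sub>R (?B - ?A))"
      unfolding floats_in_equilibrium_def affine_parallel_def hull by blast
    have "a + (?A + 0 *\<^sub>R (?B - ?A)) \<in> span {\<xi>}" "a + (?A + 1 *\<^sub>R (?B - ?A)) \<in> span {\<xi>}"
      unfolding a by blast+
    then have "(a + ?B) - (a + ?A) \<in> span {\<xi>}" by (intro span_diff) auto
    then obtain k where k: "?B - ?A = k *\<^sub>R \<xi>" by (auto simp: span_singleton)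
    have "k \<noteq> 0"
    proof
      assume "k = 0"
      then have "span {\<xi>} = {a + ?A}" unfolding a k by auto
      moreover have "\<xi> \<in> span {\<xi>}" "0 \<in> span {\<xi>}" by (simp_all add: span_base span_0)
      ultimately have "\<xi> = 0" by (metis singletonD)
      then show False using \<xi> by auto
    qed
    then show "\<exists>k. k \<noteq> 0 \<and> ?B = ?A + k *\<^sub>R \<xi>" using k by (intro exI[of _ k]) (auto simp: algebra_simps)
  next
    assume "\<exists>k. k \<noteq> 0 \<and> ?B = ?A + k *\<^sub>R \<xi>"
    then obtain k where k: "k \<noteq> 0" "?B = ?A + k *\<^sub>R \<xi>" by blast
    have "span {\<xi>} = (+) (- ?A) ` range (\<lambda>u. ?A + u *\<^sub>R (?B - ?A))"
    proof -
      have "(+) (- ?A) ` range (\<lambda>u. ?A + u *\<^sub>R (?B - ?A)) = range (\<lambda>u. (u * k) *\<^sub>R \<xi>)"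
        using k(2) by (simp add: image_image)
      also have "\<dots> = range (\<lambda>r. r *\<^sub>R \<xi>)"
      proof -
        have "range (\<lambda>u. u * k) = UNIV" using k(1) by (intro surjI[of _ "\<lambda>r. r / k"]) simp
        then have "range (\<lambda>r. r *\<^sub>R \<xi>) = (\<lambda>r. r *\<^sub>R \<xi>) ` range (\<lambda>u. u * k)" by simp
        then show ?thesis by (simp only: image_image)
      qed
      finally show ?thesis by (simp only: span_singleton)
    qed
    then show "floats_in_equilibrium K \<delta> \<xi>"
      unfolding floats_in_equilibrium_def affine_parallel_def hull by blast
  qed
qed

subsection \<open>The characterization\<close>

context cut_body
begin

lemma moment_of_inertia_eq:
  assumes \<xi>: "norm \<xi> = 1" and n: "norm n = 1" "n \<bullet> \<xi> = 0"
  defines "c \<equiv> section_center K \<delta> \<xi>"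
  shows "moment_of_inertia (cut_plane K \<delta> \<xi>) (K \<inter> cut_plane K \<delta> \<xi>) {x. x \<bullet> \<xi> = c \<bullet> \<xi> \<and> x \<bullet> n = c \<bullet> n} =
    section_moment \<xi> n n"
proof -
  let ?P = "{x. x \<bullet> \<xi> = c \<bullet> \<xi> \<and> x \<bullet> n = c \<bullet> n}"
  have m: "(\<lambda>v. (infdist v ?P)\<^sup>2) \<in> borel_measurable borel"
    by (intro borel_measurable_continuous_onI continuous_intros)
  have "moment_of_inertia (cut_plane K \<delta> \<xi>) (K \<inter> cut_plane K \<delta> \<xi>) ?P =
    (LINT v|section_lborel \<xi>. indicator K v *\<^sub>R (infdist v ?P)\<^sup>2)"
    unfolding moment_of_inertia_def by (rule integral_cut_plane[OF \<xi> m])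
  also have "\<dots> = section_moment \<xi> n n"
    unfolding section_moment_def
  proof (rule integral_cong_AE)
    show "AE v in section_lborel \<xi>. indicator K v *\<^sub>R (infdist v ?P)\<^sup>2 = indicator K v *\<^sub>R
      (((v - section_center K \<delta> \<xi>) \<bullet> n) * ((v - section_center K \<delta> \<xi>) \<bullet> n))"
      using AE_plane_lborel_hyperplane[OF \<xi>]
    proof eventually_elim
      case (elim v)
      have "infdist v ?P = \<bar>(v - c) \<bullet> n\<bar>"
        using elim section_center_level[OF \<xi>] by (intro infdist_codim2_plane[OF \<xi> n]) (simp add: c_def)
      then show ?case by (simp add: c_def power2_eq_square)
    qed
  qed (use m in measurable)
  finally show ?thesis .
qed

text \<open>The planes \<open>P\<close> correspond to unit normals \<open>n\<close> orthogonal to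
  \<xi>, determined up to sign, and the distance from \<open>P\<close> within the cutting plane is
  the absolute value of the coordinate along \<open>n\<close>.\<close>

lemma constant_section_moments_iff:
  assumes dim: "2 \<le> DIM('a)"
  shows "constant_section_moments K \<delta> \<longleftrightarrow>
    (\<exists>c. \<forall>\<xi> n. norm \<xi> = 1 \<longrightarrow> norm n = 1 \<longrightarrow> n \<bullet> \<xi> = 0 \<longrightarrow> section_moment \<xi> n n = c)"
proof
  assume "constant_section_moments K \<delta>"
  then obtain c where c: "\<And>\<xi> P. norm \<xi> = 1 \<Longrightarrow> affine P \<Longrightarrow> aff_dim P = int DIM('a) - 2 \<Longrightarrow>
      P \<subseteq> cut_plane K \<delta> \<xi> \<Longrightarrow> section_center K \<delta> \<xi> \<in> P \<Longrightarrow>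
      moment_of_inertia (cut_plane K \<delta> \<xi>) (K \<inter> cut_plane K \<delta> \<xi>) P = c"
    unfolding constant_section_moments_def by auto
  have "section_moment \<xi> n n = c" if \<xi>: "norm \<xi> = 1" and n: "norm n = 1" "n \<bullet> \<xi> = 0" for \<xi> n
    unfolding moment_of_inertia_eq[OF \<xi> n, symmetric]
    by (rule c[OF \<xi> codim2_plane[OF \<xi> n]]) (auto simp: cut_plane_def section_center_level[OF \<xi>])
  then show "\<exists>c. \<forall>\<xi> n. norm \<xi> = 1 \<longrightarrow> norm n = 1 \<longrightarrow> n \<bullet> \<xi> = 0 \<longrightarrow> section_moment \<xi> n n = c" by blast
next
  assume "\<exists>c. \<forall>\<xi> n. norm \<xi> = 1 \<longrightarrow> norm n = 1 \<longrightarrow> n \<bullet> \<xi> = 0 \<longrightarrow> section_moment \<xi> n n = c"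
  then obtain c where c: "\<And>\<xi> n. norm \<xi> = 1 \<Longrightarrow> norm n = 1 \<Longrightarrow> n \<bullet> \<xi> = 0 \<Longrightarrow> section_moment \<xi> n n = c" by blast
  show "constant_section_moments K \<delta>"
    unfolding constant_section_moments_def
  proof (intro exI[of _ c] ballI allI impI)
    fix \<xi> P assume "\<xi> \<in> sphere (0::'a) 1" and P: "affine P \<and> aff_dim P = int DIM('a) - 2 \<and>
       P \<subseteq> cut_plane K \<delta> \<xi> \<and> section_center K \<delta> \<xi> \<in> P"
    then have \<xi>: "norm \<xi> = 1" by simp
    obtain n where n: "norm n = 1" "n \<bullet> \<xi> = 0"
      "P = {x. x \<bullet> \<xi> = section_center K \<delta> \<xi> \<bullet> \<xi> \<and> x \<bullet> n = section_center K \<delta> \<xi> \<bullet> n}"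
    proof (rule codim2_plane_exists[OF dim \<xi>, of P "section_center K \<delta> \<xi>"])
      show "P \<subseteq> {x. x \<bullet> \<xi> = section_center K \<delta> \<xi> \<bullet> \<xi>}"
        using P unfolding section_center_level[OF \<xi>] cut_plane_def by simp
    qed (use P in auto)
    show "moment_of_inertia (cut_plane K \<delta> \<xi>) (K \<inter> cut_plane K \<delta> \<xi>) P = c"
      unfolding n(3) moment_of_inertia_eq[OF \<xi> n(1,2)] using c \<xi> n by blast
  qed
qed

lemma floating_imp_constant_moments:
  assumes dim: "2 \<le> DIM('a)" and fl: "floats_in_every_orientation K \<delta>"
  shows "constant_section_moments K \<delta>"
proof -
  let ?A = "center_of_mass lborel K" let ?C = "submerged_center K \<delta>"
  \<comment> \<open>Written as an inner product so that the product rule applies. Both of its terms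
    vanish: \<open>?C \<xi> - ?A\<close> is parallel to \<xi>, and \<open>D\<close> is orthogonal to
    \<xi>.\<close>
  define k where "k \<xi> = (?C \<xi> - ?A) \<bullet> \<xi>" for \<xi>
  have C: "?C \<xi> = ?A + k \<xi> *\<^sub>R \<xi>" if \<xi>: "norm \<xi> = 1" for \<xi>
  proof -
    have "floats_in_equilibrium K \<delta> \<xi>"
      using fl \<xi> by (simp add: floats_in_every_orientation_def)
    then obtain r where "?C \<xi> = ?A + r *\<^sub>R \<xi>"
      unfolding floats_in_equilibrium_iff[OF \<xi>] by blast
    then show ?thesis using \<xi> by (simp add: k_def dot_square_norm)
  qed
  have k: "k \<xi> = k \<zeta>" if "norm \<xi> = 1" "norm \<zeta> = 1" for \<xi> \<zeta>
  proof (rule const_on_sphere[OF dim _ that])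
    fix \<xi> \<eta> :: 'a assume \<xi>: "norm \<xi> = 1" and \<eta>: "norm \<eta> = 1" "\<eta> \<bullet> \<xi> = 0"
    obtain D where D: "((\<lambda>\<theta>. ?C (rot \<xi> \<eta> \<theta>)) has_vector_derivative D) (at 0)"
      "\<And>\<zeta>. D \<bullet> \<zeta> = - section_moment \<xi> \<eta> \<zeta> / \<delta>"
      using submerged_center_has_vector_derivative[OF \<xi> \<eta>] by blast
    have "((\<lambda>\<theta>. (?C (rot \<xi> \<eta> \<theta>) - ?A) \<bullet> rot \<xi> \<eta> \<theta>) has_vector_derivative
      (?C (rot \<xi> \<eta> 0) - ?A) \<bullet> rot \<eta> (- \<xi>) 0 + D \<bullet> rot \<xi> \<eta> 0) (at 0)"
      by (intro bounded_bilinear.has_vector_derivative[OF bounded_bilinear_inner] rot_has_vector_derivative)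
        (simp add: has_vector_derivative_diff_const D(1))
    moreover have "(?C \<xi> - ?A) \<bullet> \<eta> = 0" using C[OF \<xi>] \<eta> by (simp add: inner_commute)
    moreover have "D \<bullet> \<xi> = 0" by (simp add: D(2) section_moment_direction[OF \<xi>])
    ultimately show "((\<lambda>\<theta>. k (rot \<xi> \<eta> \<theta>)) has_vector_derivative 0) (at 0)" by (simp add: k_def)
  qed
  obtain e :: 'a where e: "norm e = 1" using orthogonal_unit_exists[OF dim] by blast
  have "section_moment \<xi> n n = - \<delta> * k e" if \<xi>: "norm \<xi> = 1" and n: "norm n = 1" "n \<bullet> \<xi> = 0" for \<xi> n
  proof -
    obtain D where D: "((\<lambda>\<theta>. ?C (rot \<xi> n \<theta>)) has_vector_derivative D) (at 0)"
      "\<And>\<zeta>. D \<bullet> \<zeta> = - section_moment \<xi> n \<zeta> / \<delta>"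
      using submerged_center_has_vector_derivative[OF \<xi> n] by blast
    have "(\<lambda>\<theta>. ?C (rot \<xi> n \<theta>)) = (\<lambda>\<theta>. k e *\<^sub>R rot \<xi> n \<theta> + ?A)"
      using C norm_rot[OF \<xi> n] k[OF _ e] by (simp add: fun_eq_iff add.commute)
    moreover have "((\<lambda>\<theta>. k e *\<^sub>R rot \<xi> n \<theta> + ?A) has_vector_derivative k e *\<^sub>R rot n (- \<xi>) 0) (at 0)"
      unfolding has_vector_derivative_add_const
      by (rule bounded_linear.has_vector_derivative[OF bounded_linear_scaleR_right rot_has_vector_derivative])
    \<comment> \<open>With \<open>k\<close> constant, the derivative of the submerged center is
      computed a second time; pairing both results with \<open>n\<close> gives the moment.\<close>
    ultimately have "D = k e *\<^sub>R n" using vector_derivative_unique_at[OF D(1)] by simp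
    then have "k e = - section_moment \<xi> n n / \<delta>" using D(2)[of n] n by (simp add: dot_square_norm)
    then show ?thesis using delta by (simp add: field_simps)
  qed
  then show ?thesis unfolding constant_section_moments_iff[OF dim] by blast
qed

lemma constant_moments_imp_spherical:
  assumes dim: "2 \<le> DIM('a)" and "constant_section_moments K \<delta>"
  obtains p r where "0 < r" "\<And>\<xi>. norm \<xi> = 1 \<Longrightarrow> submerged_center K \<delta> \<xi> = p - r *\<^sub>R \<xi>"
proof -
  let ?C = "submerged_center K \<delta>"
  obtain c where c: "\<And>\<xi> n. norm \<xi> = 1 \<Longrightarrow> norm n = 1 \<Longrightarrow> n \<bullet> \<xi> = 0 \<Longrightarrow> section_moment \<xi> n n = c"
    using assms(2) unfolding constant_section_moments_iff[OF dim] by blast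
  obtain e :: 'a where e: "norm e = 1" using orthogonal_unit_exists[OF dim] by blast
  obtain e' where e': "norm e' = 1" "e' \<bullet> e = 0" using orthogonal_unit_exists[OF dim] by blast
  \<comment> \<open>One pair of orthogonal unit vectors decides the sign of the common constant, and
    so of the radius \<open>c / \<delta>\<close>.\<close>
  have "0 < c" using section_moment_pos[OF e e'] c[OF e e'] by simp
  have diag: "section_moment \<xi> x x = c * (x \<bullet> x)" if \<xi>: "norm \<xi> = 1" and x: "x \<bullet> \<xi> = 0" for \<xi> x
  proof (cases "x = 0")
    case True
    then show ?thesis using section_moment_scale[of \<xi> x 0 x] by simp
  next
    case False
    define n where "n = x /\<^sub>R norm x"
    have xn: "x = norm x *\<^sub>R n" using False by (simp add: n_def)
    have "section_moment \<xi> n n = c" using False x by (intro c \<xi>) (auto simp: n_def)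
    then have "section_moment \<xi> x x = norm x * norm x * c"
      by (subst (1 2) xn) (simp add: section_moment_scale section_moment_sym[of \<xi> "_ *\<^sub>R n"])
    then show ?thesis by (simp add: dot_square_norm power2_eq_square)
  qed
  have polar: "section_moment \<xi> x y = c * (x \<bullet> y)" if \<xi>: "norm \<xi> = 1" and xy: "x \<bullet> \<xi> = 0" "y \<bullet> \<xi> = 0" for \<xi> x y
  proof -
    have "section_moment \<xi> (x + y) (x + y) = section_moment \<xi> x x + 2 * section_moment \<xi> x y + section_moment \<xi> y y"
      using section_moment_add[OF \<xi>, of x x y] section_moment_add[OF \<xi>, of y x y]
        section_moment_add[OF \<xi>, of "x + y" x y] section_moment_sym[of \<xi> "x + y" x]
        section_moment_sym[of \<xi> "x + y" y] section_moment_sym[of \<xi> y x]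
      by linarith
    then show ?thesis
      using diag[OF \<xi>, of "x + y"] diag[OF \<xi> xy(1)] diag[OF \<xi> xy(2)] xy
      by (simp add: inner_add_left inner_add_right inner_commute[of y x] algebra_simps)
  qed
  have const: "?C \<xi> + (c / \<delta>) *\<^sub>R \<xi> = ?C \<zeta> + (c / \<delta>) *\<^sub>R \<zeta>" if "norm \<xi> = 1" "norm \<zeta> = 1" for \<xi> \<zeta>
  proof (rule const_on_sphere[OF dim _ that])
    fix \<xi> \<eta> :: 'a assume \<xi>: "norm \<xi> = 1" and \<eta>: "norm \<eta> = 1" "\<eta> \<bullet> \<xi> = 0"
    obtain D where D: "((\<lambda>\<theta>. ?C (rot \<xi> \<eta> \<theta>)) has_vector_derivative D) (at 0)"
      "\<And>\<zeta>. D \<bullet> \<zeta> = - section_moment \<xi> \<eta> \<zeta> / \<delta>"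
      using submerged_center_has_vector_derivative[OF \<xi> \<eta>] by blast
    \<comment> \<open>The derivative of the vector to be shown constant. It is orthogonal to \<xi>,
      so \<open>polar\<close> applies to \<open>E\<close> itself and the two contributions to
      \<open>E \<bullet> E\<close> cancel.\<close>
    define E where "E = D + (c / \<delta>) *\<^sub>R \<eta>"
    have "E \<bullet> \<xi> = 0" using \<eta> by (simp add: E_def inner_add_left D(2) section_moment_direction[OF \<xi>])
    then have "E \<bullet> E = 0"
      using polar[OF \<xi> \<eta>(2), of E] by (subst E_def) (simp add: inner_add_left D(2))
    then have "E = 0" by simp
    moreover have "((\<lambda>\<theta>. ?C (rot \<xi> \<eta> \<theta>) + (c / \<delta>) *\<^sub>R rot \<xi> \<eta> \<theta>) has_vector_derivative
        D + (c / \<delta>) *\<^sub>R rot \<eta> (- \<xi>) 0) (at 0)"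
      by (intro has_vector_derivative_add D(1)
        bounded_linear.has_vector_derivative[OF bounded_linear_scaleR_right] rot_has_vector_derivative)
    ultimately show "((\<lambda>\<theta>. ?C (rot \<xi> \<eta> \<theta>) + (c / \<delta>) *\<^sub>R rot \<xi> \<eta> \<theta>) has_vector_derivative 0) (at 0)"
      by (simp add: E_def)
  qed
  show ?thesis
  proof (rule that)
    show "0 < c / \<delta>" using \<open>0 < c\<close> delta by simp
    show "?C \<xi> = ?C e + (c / \<delta>) *\<^sub>R e - (c / \<delta>) *\<^sub>R \<xi>" if "norm \<xi> = 1" for \<xi>
      using const[OF that e] by (simp add: algebra_simps)
  qed
qed

lemma constant_moments_imp_floating:
  assumes dim: "2 \<le> DIM('a)" and mom: "constant_section_moments K \<delta>"
    and center: "center_of_mass lborel K = center_of_mass (hausdorff_measure (DIM('a) - 1)) (surface_of_centers K \<delta>)"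
  shows "floats_in_every_orientation K \<delta>"
proof -
  obtain p r where r: "0 < r" and C: "\<And>\<xi>. norm \<xi> = 1 \<Longrightarrow> submerged_center K \<delta> \<xi> = p - r *\<^sub>R \<xi>"
    using constant_moments_imp_spherical[OF dim mom] by blast
  have "surface_of_centers K \<delta> = sphere p r"
  proof
    show "surface_of_centers K \<delta> \<subseteq> sphere p r"
      using r by (auto simp: surface_of_centers_def C dist_norm)
    show "sphere p r \<subseteq> surface_of_centers K \<delta>"
    proof
      fix x assume x: "x \<in> sphere p r"
      \<comment> \<open>The submerged center lies opposite to its direction, so the direction
        belonging to \<open>x\<close> points from \<open>x\<close> to \<open>p\<close>.\<close>
      define \<xi> where "\<xi> = (1 / r) *\<^sub>R (p - x)"
      have "norm \<xi> = 1" "x = p - r *\<^sub>R \<xi>" using x r by (auto simp: \<xi>_def dist_norm)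
      then show "x \<in> surface_of_centers K \<delta>"
        unfolding surface_of_centers_def using C by (intro image_eqI[of _ _ \<xi>]) auto
    qed
  qed
  \<comment> \<open>The moments alone leave \<open>p\<close> undetermined; the assumption on the two
    centers of mass identifies it, and equilibrium follows with the factor
    \<open>- r\<close>.\<close>
  then have "center_of_mass lborel K = p"
    using center center_of_mass_hausdorff_sphere[OF r] by simp
  have "floats_in_equilibrium K \<delta> \<xi>" if "norm \<xi> = 1" for \<xi>
    unfolding floats_in_equilibrium_iff[OF that]
    using C[OF that] r \<open>center_of_mass lborel K = p\<close> by (intro exI[of _ "- r"]) simp
  then show ?thesis by (simp add: floats_in_every_orientation_def)
qed

end

theorem theorem1:
  fixes K :: "'a::euclidean_space set" and \<delta> :: real
  assumes "DIM('a) \<ge> 3"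
    and "convex_body K"
    and "0 < \<delta>" and "\<delta> < measure lborel K"
  shows "(floats_in_every_orientation K \<delta> \<longrightarrow> constant_section_moments K \<delta>) \<and>
    (C1_boundary K \<and>
     center_of_mass lborel K =
       center_of_mass (hausdorff_measure (DIM('a) - 1)) (surface_of_centers K \<delta>) \<and>
     constant_section_moments K \<delta> \<longrightarrow>
     floats_in_every_orientation K \<delta>)"
proof -
  interpret cut_body K \<delta> by standard fact+
  have "2 \<le> DIM('a)" using assms(1) by simp
  then show ?thesis
    using floating_imp_constant_moments constant_moments_imp_floating by blast
qed

end
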